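(* Let $c>0$ and $\Delta=(0,c]$. Let $X_1,X_2,\dots$ be i.i.d. real random variables with common distribution $G$, let $S_0=0$, $S_n=\sum_{k=1}^nX_k$, and let $\pi$ be the distribution of $M=\sup_{n\ge0}S_n$. Let $$\nu(dx)=\mathbf 1_{(0,\infty)}(x)\sum_{n=1}^\infty n^{-1}G^{*n}(dx),\qquad B=\nu((0,\infty))=\sum_{n=1}^\infty n^{-1}P(S_n>0),\qquad \lambda=1-e^{-B},$$ and let $G_0$ be the probability distribution on $\mathbb R_+$ such that $\lambda G_0$ is the defective distribution of the first ascending ladder height of $\{S_n\}$. Suppose that $-\infty<\mathbb E[X_1]<0$ and that $G$ is non-lattice. Then the following are equivalent: (i) $\pi\in\mathcal S_\Delta$; (ii) $B^{-1}\nu\in\mathcal S_\Delta$; (iii) $B^{-1}\nu\in\mathcal L_\Delta$ and $\pi(x+\Delta)\sim\nu(x+\Delta)$; (iv) $G_0\in\mathcal S_\Delta$; (v) $G_0\in\mathcal L_\Delta$ and $\pi(x+\Delta)\sim\frac{\lambda}{1-\lambda}\,G_0(x+\Delta)$.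
   Context: The condition $-\infty<\mathbb E[X_1]<0$ ensures $M<\infty$ a.s. and $B<\infty$. The first ascending ladder height is $S_\tau$ with $\tau=\inf\{n\ge1:S_n>0\}$, on the event $\{\tau<\infty\}$; $G_0(\{0\})=0$ and equivalently $G_0=-\lambda^{-1}\sum_{n=1}^\infty((-1)^n/n!)\,\nu^{*n}$, i.e. $\nu=\sum_{n=1}^\infty(\lambda^n/n)G_0^{*n}$. Assertions that $B^{-1}\nu$ or $G_0$ belong to a class include $B>0$, so that these distributions are defined. $G$ is non-lattice if its support is not contained in any lattice $h\mathbb Z$, $h>0$. For $\Delta=(0,c]$ and a measure $F$, $F(x+\Delta):=F((x,x+c])$. $F^{*n}$ is the $n$-fold convolution. $\alpha(x)\sim\beta(x)$ means $\alpha(x)/\beta(x)\to1$ as $x\to\infty$. A non-negative measurable function $\alpha$ belongs to $\mathcal L$ if there is $x_0>0$ with $\alpha(x)>0$ for $x\ge x_0$ and, for every fixed $y>0$, $\alpha(x+y)\sim\alpha(x)$. A distribution $F$ is in $\mathcal L_\Delta$ if the function $x\mapsto F(x+\Delta)$ is in $\mathcal L$. $F\in\mathcal S_\Delta$ if $F\in\mathcal L_\Delta$ and $F^{*2}(x+\Delta)\sim 2F(x+\Delta)$. *)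

theory Defs
  imports "HOL-Probability.Probability" "HOL-Library.Landau_Symbols"
begin

text \<open>
  The library relation \<open>\<alpha> \<sim>[at_top] \<beta>\<close> reads the quotient 0/0 as 1.  Below (and in the theorem)
  it is only ever used together with eventual positivity of one of the two functions, where it
  says precisely that \<open>\<alpha> x / \<beta> x\<close> tends to 1.
\<close>

definition long_tailed :: "(real \<Rightarrow> real) \<Rightarrow> bool" where
  "long_tailed \<alpha> \<longleftrightarrow>
     \<alpha> \<in> borel_measurable borel \<and> (\<forall>x. 0 \<le> \<alpha> x) \<and>
     (\<exists>x0>0. \<forall>x\<ge>x0. 0 < \<alpha> x) \<and>
     (\<forall>y>0. (\<lambda>x. \<alpha> (x + y)) \<sim>[at_top] \<alpha>)"

definition loc :: "real \<Rightarrow> real measure \<Rightarrow> real \<Rightarrow> real" where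
  "loc c F x = measure F {x<..x + c}"

definition class_L :: "real \<Rightarrow> real measure \<Rightarrow> bool" where
  "class_L c F \<longleftrightarrow> real_distribution F \<and> long_tailed (loc c F)"

definition class_S :: "real \<Rightarrow> real measure \<Rightarrow> bool" where
  "class_S c F \<longleftrightarrow>
     class_L c F \<and> loc c (convolution F F) \<sim>[at_top] (\<lambda>x. 2 * loc c F x)"

definition msupport :: "real measure \<Rightarrow> real set" where
  "msupport F = {x. \<forall>\<epsilon>>0. 0 < emeasure F (ball x \<epsilon>)}"

definition non_lattice :: "real measure \<Rightarrow> bool" where
  "non_lattice F \<longleftrightarrow> \<not> (\<exists>h>0. msupport F \<subseteq> range (\<lambda>k::int. h * of_int k))"

primrec conv_power :: "nat \<Rightarrow> real measure \<Rightarrow> real measure" where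
  "conv_power 0 F = return borel 0"
| "conv_power (Suc n) F = convolution F (conv_power n F)"

definition harmonic :: "real measure \<Rightarrow> real measure" where
  "harmonic G = measure_of UNIV (sets borel)
     (\<lambda>A. \<Sum>n. ennreal (1 / real (Suc n)) * emeasure (conv_power (Suc n) G) (A \<inter> {0<..}))"

lemma space_harmonic [simp]: "space (harmonic G) = UNIV"
  by (simp add: harmonic_def)

lemma sets_harmonic [simp, measurable_cong]: "sets (harmonic G) = sets borel"
  using sets.sigma_sets_eq[of "borel :: real measure"] by (simp add: harmonic_def)

lemma sets_conv_power [simp]: "sets (conv_power n F) = sets borel"
  by (cases n) simp_all

lemma ennreal_suminf_swap:
  fixes f :: "nat \<Rightarrow> nat \<Rightarrow> ennreal"
  shows "(\<Sum>i. \<Sum>n. f i n) = (\<Sum>n. \<Sum>i. f i n)"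
  using nn_integral_suminf[of "\<lambda>n i. f i n" "count_space UNIV"]
  by (simp add: nn_integral_count_space_nat)

text \<open>The set function in \<open>harmonic_def\<close> is a measure, so \<open>harmonic\<close> takes the intended values.\<close>

lemma emeasure_harmonic:
  assumes "A \<in> sets borel"
  shows "emeasure (harmonic G) A =
    (\<Sum>n. ennreal (1 / real (Suc n)) * emeasure (conv_power (Suc n) G) (A \<inter> {0<..}))"
    (is "_ = ?\<mu> A")
proof (rule emeasure_measure_of[OF harmonic_def])
  show "positive (sets (harmonic G)) ?\<mu>"
    by (simp add: positive_def)
  show "countably_additive (sets (harmonic G)) ?\<mu>"
  proof (rule countably_additiveI)
    fix D :: "nat \<Rightarrow> real set"
    assume D: "range D \<subseteq> sets (harmonic G)" "disjoint_family D"
    have "(\<Sum>i. ?\<mu> (D i)) =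
      (\<Sum>n. \<Sum>i. ennreal (1 / real (Suc n)) * emeasure (conv_power (Suc n) G) (D i \<inter> {0<..}))"
      by (rule ennreal_suminf_swap)
    also have "\<dots> = ?\<mu> (\<Union>i. D i)"
    proof (intro suminf_cong)
      fix n
      have "(\<Sum>i. emeasure (conv_power (Suc n) G) (D i \<inter> {0<..})) =
        emeasure (conv_power (Suc n) G) (\<Union>i. D i \<inter> {0<..})"
        using D by (intro suminf_emeasure) (auto simp: disjoint_family_on_def)
      then show "(\<Sum>i. ennreal (1 / real (Suc n)) * emeasure (conv_power (Suc n) G) (D i \<inter> {0<..})) =
        ennreal (1 / real (Suc n)) * emeasure (conv_power (Suc n) G) ((\<Union>i. D i) \<inter> {0<..})"
        by (simp only: ennreal_suminf_cmult Int_UN_distrib2 UN_extend_simps)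
    qed
    finally show "(\<Sum>i. ?\<mu> (D i)) = ?\<mu> (\<Union>i. D i)" .
  qed
qed (use assms in auto)

text \<open>
  \<open>measure\<close> would send an infinite total mass to 0; for \<open>G\<close> integrable with negative mean the
  mass is finite.
\<close>

definition harmonic_mass :: "real measure \<Rightarrow> real" where
  "harmonic_mass G = measure (harmonic G) {0<..}"

definition ladder_prob :: "real measure \<Rightarrow> real" where
  "ladder_prob G = 1 - exp (- harmonic_mass G)"

text \<open>The steps are \<open>X 1, X 2, \<dots>\<close>; the value \<open>X 0\<close> is never used.\<close>

definition walk :: "(nat \<Rightarrow> 'a \<Rightarrow> real) \<Rightarrow> nat \<Rightarrow> 'a \<Rightarrow> real" where
  "walk X n \<omega> = (\<Sum>k=1..n. X k \<omega>)"

text \<open>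
  The supremum is formed in the extended reals; \<open>real_of_ereal\<close> changes it only on the event that
  it is infinite, which is null when the steps have negative mean.
\<close>

definition sup_distr :: "'a measure \<Rightarrow> (nat \<Rightarrow> 'a \<Rightarrow> real) \<Rightarrow> real measure" where
  "sup_distr P X = distr P borel (\<lambda>\<omega>. real_of_ereal (SUP n. ereal (walk X n \<omega>)))"

definition ladder_event :: "'a measure \<Rightarrow> (nat \<Rightarrow> 'a \<Rightarrow> real) \<Rightarrow> 'a set" where
  "ladder_event P X = {\<omega> \<in> space P. \<exists>n\<ge>1. 0 < walk X n \<omega>}"

text \<open>Only meaningful on \<open>ladder_event\<close>, i.e. when the first ascending ladder epoch is finite.\<close>

definition ladder_epoch :: "(nat \<Rightarrow> 'a \<Rightarrow> real) \<Rightarrow> 'a \<Rightarrow> nat" where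
  "ladder_epoch X \<omega> = Inf {n. 1 \<le> n \<and> 0 < walk X n \<omega>}"

text \<open>The defective distribution: its total mass is the probability of \<open>ladder_event\<close>.\<close>

definition ladder_defective :: "'a measure \<Rightarrow> (nat \<Rightarrow> 'a \<Rightarrow> real) \<Rightarrow> real measure" where
  "ladder_defective P X =
     distr (restrict_space P (ladder_event P X)) borel (\<lambda>\<omega>. walk X (ladder_epoch X \<omega>) \<omega>)"

end

theory Submission
  imports Defs
begin

text \<open>
  Write \<open>\<Lambda>\<close> for the defective distribution of the first ascending ladder height and \<open>p\<close> for its
  mass.  Two facts about the walk reduce the theorem to a statement about measures on \<open>[0, \<infinity>)\<close>.

  \<^item> Regeneration at the first ladder epoch gives \<open>\<pi> = (1 - p) \<delta>\<^sub>0 + \<Lambda> * \<pi>\<close>, so that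
    \<open>\<pi> = (1 - p) \<Sum>n. \<Lambda>\<^sup>n\<close> (\<open>char_max_law\<close>).  Here \<open>p < 1\<close> comes from the maximal ergodic lemma
    (\<open>p_less_1\<close>), and \<open>\<pi>\<close> has no mass at infinity because this mass \<open>q\<close> satisfies \<open>q = p q\<close>.

  \<^item> Spitzer's identity \<open>\<nu> = \<Sum>n. \<Lambda>\<^sup>n / n\<close> (\<open>spitzer_char\<close>, \<open>char_harmonic\<close>).  Let \<open>H n\<close> and \<open>L n\<close> be
    the laws of \<open>S\<^sub>n\<close> on \<open>\<tau> > n\<close> and on \<open>\<tau> = n\<close>.  One step of the walk gives
    \<open>H n * G = H (n + 1) + L (n + 1)\<close>, which is the Wiener-Hopf factorisation written as a
    recursion.  Since \<open>H\<close> lives on \<open>(-\<infinity>, 0]\<close> and \<open>L\<close> on \<open>(0, \<infinity>)\<close>, its logarithmic derivative can be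
    separated into the two half lines (\<open>wiener_hopf_split\<close>); the part on \<open>(0, \<infinity>)\<close> is the
    derivative of \<open>- Ln (1 - \<Sum>n. L n z\<^sup>n)\<close>.

  Hence, with \<open>G\<^sub>0 = \<Lambda> / p\<close>, \<open>\<nu>\<^sub>1 = \<nu> / B\<close> and \<open>1 - p = exp (- B)\<close>, the law \<open>\<pi>\<close> is a geometric compound
  of \<open>G\<^sub>0\<close> and a Poisson compound of \<open>\<nu>\<^sub>1\<close>, and \<open>\<nu>\<close> is a logarithmic compound of \<open>G\<^sub>0\<close>.  The
  equivalences follow from four facts about window masses \<open>F (x, x + c]\<close>.

  \<^item> If \<open>F\<close> is locally subexponential, then \<open>\<Sum>n. a\<^sub>n F\<^sup>n\<close> has window masses asymptotic to
    \<open>\<Sum>n. n a\<^sub>n\<close> times those of \<open>F\<close>, provided that \<open>\<Sum>n. a\<^sub>n z\<^sup>n\<close> converges for some \<open>z > 1\<close>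
    (\<open>ratio_lim_mixture\<close>, by Kesten's bound \<open>kesten_bound\<close>).

  \<^item> If \<open>F\<close> is only long-tailed, then \<open>F\<^sup>n\<close> still has asymptotically at least \<open>n\<close> times the window
    masses of \<open>F\<close>.  If the total in the previous item is attained, no term can exceed its lower
    bound, and \<open>F\<close> is locally subexponential (\<open>ratio_lim_mixture_imp_square\<close>).

  \<^item> Local subexponentiality passes to distributions whose window masses are asymptotically
    proportional (\<open>local_subexponential_transfer\<close>).

  \<^item> If \<open>\<pi>\<close> is locally subexponential, then so is \<open>G\<^sub>0\<close> (\<open>ratio_lim_geometric_root\<close>).  This is the
    implication that inverts the compounding.  Cut \<open>\<Lambda> = S + T\<close> at a high level \<open>K\<close>.  Then
    \<open>\<pi> * (\<delta>\<^sub>0 - S) = (1 - p) (\<delta>\<^sub>0 + \<rho>)\<close> with \<open>\<rho> = T * \<pi> / (1 - p)\<close>, where \<open>\<rho>\<close> is small in mass and has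
    window masses proportional to those of \<open>\<pi>\<close>.  Thus \<open>\<delta>\<^sub>0 + \<rho>\<close> can be inverted by its
    Neumann series.

  Identities between convolutions are verified on Fourier transforms, where they become identities
  between numbers, and transported back to measures by Levy's uniqueness theorem
  (\<open>lin_comb_char_iff\<close>).
\<close>

section \<open>Countable mixtures of measures and their Fourier transforms\<close>

lemma finite_borel_measure_iff:
  "finite_borel_measure M \<longleftrightarrow> finite_measure M \<and> sets M = sets borel"
  by (auto simp: finite_borel_measure_def finite_borel_measure_axioms_def)

lemma finite_borel_measureD:
  assumes "finite_borel_measure M"
  shows "finite_measure M" "sets M = sets borel" "space M = UNIV"
  using assms sets_eq_imp_space_eq[of M borel] by (auto simp: finite_borel_measure_iff)

lemma finite_borel_measure_convolution:
  "finite_borel_measure M \<Longrightarrow> finite_borel_measure N \<Longrightarrow> finite_borel_measure (convolution M N)"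
  by (simp add: finite_borel_measure_iff convolution_finite)

definition mixture :: "(nat \<Rightarrow> real) \<Rightarrow> (nat \<Rightarrow> real measure) \<Rightarrow> real measure" where
  "mixture a \<mu> = measure_of UNIV (sets borel) (\<lambda>A. \<Sum>n. ennreal (a n) * emeasure (\<mu> n) A)"

lemma space_mixture [simp]: "space (mixture a \<mu>) = UNIV"
  by (simp add: mixture_def)

lemma sets_mixture [simp, measurable_cong]: "sets (mixture a \<mu>) = sets borel"
  using sets.sigma_sets_eq[of "borel :: real measure"] by (simp add: mixture_def)

lemma emeasure_mixture:
  assumes \<mu>: "\<And>n. sets (\<mu> n) = sets borel" and A: "A \<in> sets borel"
  shows "emeasure (mixture a \<mu>) A = (\<Sum>n. ennreal (a n) * emeasure (\<mu> n) A)"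
    (is "_ = ?\<mu> A")
proof (rule emeasure_measure_of[OF mixture_def])
  show "positive (sets (mixture a \<mu>)) ?\<mu>"
    by (simp add: positive_def)
  show "countably_additive (sets (mixture a \<mu>)) ?\<mu>"
  proof (rule countably_additiveI)
    fix D :: "nat \<Rightarrow> real set"
    assume D: "range D \<subseteq> sets (mixture a \<mu>)" "disjoint_family D"
    have "(\<Sum>i. ?\<mu> (D i)) = (\<Sum>n. \<Sum>i. ennreal (a n) * emeasure (\<mu> n) (D i))"
      by (rule ennreal_suminf_swap)
    also have "\<dots> = ?\<mu> (\<Union>i. D i)"
      using D \<mu> by (intro suminf_cong) (simp add: ennreal_suminf_cmult suminf_emeasure)
    finally show "(\<Sum>i. ?\<mu> (D i)) = ?\<mu> (\<Union>i. D i)" .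
  qed
qed (use A in auto)

text \<open>
  The weights are arbitrary reals, clipped at 0 by \<open>ennreal\<close>; the formula holds for simple functions
  and passes to monotone limits.
\<close>

lemma nn_integral_mixture:
  assumes \<mu>: "\<And>n. sets (\<mu> n) = sets borel" and f: "f \<in> borel_measurable borel"
  shows "(\<integral>\<^sup>+x. f x \<partial>mixture a \<mu>) = (\<Sum>n. ennreal (a n) * (\<integral>\<^sup>+x. f x \<partial>\<mu> n))"
proof -
  have meas: "g \<in> borel_measurable (\<mu> n)" if "g \<in> borel_measurable borel"
    for g :: "real \<Rightarrow> ennreal" and n
    using that measurable_cong_sets[OF \<mu>[of n] refl] by blast
  have meas': "g \<in> borel_measurable (mixture a \<mu>)" if "g \<in> borel_measurable borel"
    for g :: "real \<Rightarrow> ennreal"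
    using that measurable_cong_sets[OF sets_mixture refl] by blast
  show ?thesis using f
  proof (induction rule: borel_measurable_induct)
    case (cong f g)
    then show ?case
      by (simp add: fun_eq_iff)
  next
    case (set A)
    then show ?case
      using \<mu> by (simp add: emeasure_mixture)
  next
    case (mult u c)
    then show ?case
      by (simp add: nn_integral_cmult meas meas' mult.left_commute ennreal_suminf_cmult)
  next
    case (add u v)
    then show ?case
      by (simp add: nn_integral_add meas meas' distrib_left suminf_add)
  next
    case (seq U)
    have "(\<integral>\<^sup>+x. (SUP i. U i) x \<partial>mixture a \<mu>) = (SUP i. \<integral>\<^sup>+x. U i x \<partial>mixture a \<mu>)"
      using seq by (simp add: nn_integral_monotone_convergence_SUP meas' image_comp)
    also have "\<dots> = (SUP i. \<Sum>n. ennreal (a n) * (\<integral>\<^sup>+x. U i x \<partial>\<mu> n))"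
      using seq by simp
    also have "\<dots> = (\<Sum>n. SUP i. ennreal (a n) * (\<integral>\<^sup>+x. U i x \<partial>\<mu> n))"
      using seq(3) by (intro ennreal_suminf_SUP_eq[symmetric])
        (auto simp: mono_def le_fun_def intro!: mult_left_mono nn_integral_mono)
    also have "\<dots> = (\<Sum>n. ennreal (a n) * (\<integral>\<^sup>+x. (SUP i. U i) x \<partial>\<mu> n))"
      using seq
      by (intro suminf_cong)
         (simp add: nn_integral_monotone_convergence_SUP meas image_comp SUP_mult_left_ennreal)
    finally show ?case .
  qed
qed

lemma ennreal_suminf_sums:
  assumes "\<And>n. 0 \<le> f n" "0 \<le> x" "(\<Sum>n. ennreal (f n)) = ennreal x"
  shows "f sums x"
proof -
  have s: "summable f"
    using assms by (intro summable_suminf_not_top) auto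
  then have "(\<Sum>n. ennreal (f n)) = ennreal (suminf f)"
    using assms(1) by (intro suminf_ennreal2) auto
  then have "suminf f = x"
    using assms s suminf_nonneg by (metis ennreal_inj)
  then show ?thesis
    using s by (simp add: sums_iff)
qed

context
  fixes a :: "nat \<Rightarrow> real" and \<mu> :: "nat \<Rightarrow> real measure"
  assumes fbm: "\<And>n. finite_borel_measure (\<mu> n)" and a: "\<And>n. 0 \<le> a n"
    and summ: "summable (\<lambda>n. a n * measure (\<mu> n) UNIV)"
begin

private lemma sets_\<mu>: "sets (\<mu> n) = sets borel"
  using fbm by (rule finite_borel_measureD)

lemma finite_borel_measure_mixture: "finite_borel_measure (mixture a \<mu>)"
proof -
  have "(\<Sum>n. ennreal (a n) * emeasure (\<mu> n) UNIV) = (\<Sum>n. ennreal (a n * measure (\<mu> n) UNIV))"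
    using a by (simp add: finite_measure.emeasure_eq_measure[OF finite_borel_measureD(1)[OF fbm]]
        ennreal_mult)
  also have "\<dots> < \<top>"
    using a summ by (simp add: suminf_ennreal2 less_top)
  finally have "finite_measure (mixture a \<mu>)"
    by (intro finite_measureI) (simp add: emeasure_mixture sets_\<mu>)
  then show ?thesis
    by (simp add: finite_borel_measure_iff)
qed

lemma measure_mixture_sums:
  assumes A: "A \<in> sets borel"
  shows "(\<lambda>n. a n * measure (\<mu> n) A) sums measure (mixture a \<mu>) A"
proof (rule ennreal_suminf_sums)
  interpret m: finite_borel_measure "mixture a \<mu>"
    by (rule finite_borel_measure_mixture)
  have "(\<Sum>n. ennreal (a n * measure (\<mu> n) A)) = emeasure (mixture a \<mu>) A"
    using a A by (simp add: emeasure_mixture sets_\<mu> ennreal_mult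
        finite_measure.emeasure_eq_measure[OF finite_borel_measureD(1)[OF fbm]])
  then show "(\<Sum>n. ennreal (a n * measure (\<mu> n) A)) = ennreal (measure (mixture a \<mu>) A)"
    by (simp add: m.emeasure_eq_measure)
qed (use a in auto)

private lemma integral_mixture_nonneg:
  fixes f :: "real \<Rightarrow> real"
  assumes [measurable]: "f \<in> borel_measurable borel" and f: "\<And>x. 0 \<le> f x" "\<And>x. f x \<le> C"
  shows "(\<lambda>n. a n * (\<integral>x. f x \<partial>\<mu> n)) sums (\<integral>x. f x \<partial>mixture a \<mu>)"
proof (rule ennreal_suminf_sums)
  have *: "ennreal (\<integral>x. f x \<partial>M) = (\<integral>\<^sup>+x. ennreal (f x) \<partial>M)" if "finite_borel_measure M" for M
  proof -
    interpret finite_borel_measure M by fact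
    have "integrable M f"
      using f M_is_borel by (intro integrable_const_bound[where B = C]) auto
    then show ?thesis
      using f by (simp add: nn_integral_eq_integral)
  qed
  have "(\<Sum>n. ennreal (a n * (\<integral>x. f x \<partial>\<mu> n))) = (\<Sum>n. ennreal (a n) * (\<integral>\<^sup>+x. ennreal (f x) \<partial>\<mu> n))"
    using a f by (simp add: ennreal_mult *[OF fbm])
  also have "\<dots> = (\<integral>\<^sup>+x. ennreal (f x) \<partial>mixture a \<mu>)"
    by (rule nn_integral_mixture[symmetric]) (auto simp: sets_\<mu>)
  also have "\<dots> = ennreal (\<integral>x. f x \<partial>mixture a \<mu>)"
    by (rule *[OF finite_borel_measure_mixture, symmetric])
  finally show "(\<Sum>n. ennreal (a n * (\<integral>x. f x \<partial>\<mu> n))) = ennreal (\<integral>x. f x \<partial>mixture a \<mu>)" .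
qed (use a f in auto)

private lemma integral_mixture_bounded:
  fixes f :: "real \<Rightarrow> real"
  assumes [measurable]: "f \<in> borel_measurable borel" and f: "\<And>x. \<bar>f x\<bar> \<le> 1"
  shows "(\<lambda>n. a n * (\<integral>x. f x \<partial>\<mu> n)) sums (\<integral>x. f x \<partial>mixture a \<mu>)"
proof -
  have f': "0 \<le> f x + 1" "f x + 1 \<le> 2" for x
    using f[of x] by linarith+
  have *: "(\<integral>x. f x + 1 \<partial>M) - (\<integral>x. 1 \<partial>M) = (\<integral>x. f x \<partial>M)" if "finite_borel_measure M" for M
  proof -
    interpret finite_borel_measure M by fact
    have "integrable M f"
      using f M_is_borel by (intro integrable_const_bound[where B = 1]) auto
    then show ?thesis
      by simp
  qed
  have "(\<lambda>n. a n * (\<integral>x. f x + 1 \<partial>\<mu> n) - a n * (\<integral>x. 1 \<partial>\<mu> n)) sums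
    ((\<integral>x. f x + 1 \<partial>mixture a \<mu>) - (\<integral>x. 1 \<partial>mixture a \<mu>))"
    by (intro sums_diff integral_mixture_nonneg[where C = 2] f') auto
  then show ?thesis
    by (simp only: right_diff_distrib[symmetric] * fbm finite_borel_measure_mixture)
qed

lemma char_mixture_sums: "(\<lambda>n. complex_of_real (a n) * char (\<mu> n) t) sums char (mixture a \<mu>) t"
proof -
  have char_eq: "char M t = Complex (\<integral>x. cos (t * x) \<partial>M) (\<integral>x. sin (t * x) \<partial>M)"
    if "finite_borel_measure M" for M
  proof -
    interpret finite_borel_measure M by fact
    have i: "integrable M (\<lambda>x. iexp (t * x))"
      using M_is_borel by (intro integrable_const_bound[where B = 1]) auto
    show ?thesis
      using integral_Re[OF i] integral_Im[OF i]
      by (simp add: complex_eq_iff char_def Re_exp Im_exp)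
  qed
  have "(\<lambda>n. Complex (a n * (\<integral>x. cos (t * x) \<partial>\<mu> n)) (a n * (\<integral>x. sin (t * x) \<partial>\<mu> n))) sums
    Complex (\<integral>x. cos (t * x) \<partial>mixture a \<mu>) (\<integral>x. sin (t * x) \<partial>mixture a \<mu>)"
    unfolding sums_complex_iff by (auto intro!: integral_mixture_bounded)
  then show ?thesis
    by (simp add: char_eq fbm finite_borel_measure_mixture complex_of_real_mult_Complex)
qed

end

lemma char_0: "char M 0 = complex_of_real (measure M (space M))"
  by (simp add: char_def complex_eq_iff)

lemma norm_char_le:
  assumes "finite_borel_measure M"
  shows "norm (char M t) \<le> measure M UNIV"
proof -
  interpret finite_borel_measure M by fact
  have "norm (char M t) \<le> (\<integral>x. norm (iexp (t * x)) \<partial>M)"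
    unfolding char_def by (rule integral_norm_bound)
  also have "\<dots> = measure M UNIV"
    using sets_eq_imp_space_eq[OF M_is_borel] by simp
  finally show ?thesis .
qed

lemma char_convolution:
  assumes "finite_borel_measure M" "finite_borel_measure N"
  shows "char (convolution M N) t = char M t * char N t"
proof -
  interpret M: finite_borel_measure M by fact
  interpret N: finite_borel_measure N by fact
  interpret pair_sigma_finite M N ..
  interpret MN: finite_measure "M \<Otimes>\<^sub>M N"
    by (intro finite_measure_pair_measure M.finite_measure_axioms N.finite_measure_axioms)
  note [measurable_cong] = M.M_is_borel N.M_is_borel
  have "char (convolution M N) t = (CLINT z|M \<Otimes>\<^sub>M N. iexp (t * (fst z + snd z)))"
    unfolding char_def convolution_def
    by (subst integral_distr) (auto simp: split_beta)
  also have "\<dots> = (CLINT z|M \<Otimes>\<^sub>M N. (case z of (x, y) \<Rightarrow> iexp (t * x) * iexp (t * y)))"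
    by (simp add: split_beta exp_add[symmetric] algebra_simps)
  also have "\<dots> = (CLINT x|M. CLINT y|N. iexp (t * x) * iexp (t * y))"
    by (rule integral_fst[symmetric])
       (auto intro!: MN.integrable_const_bound[where B = 1] simp: norm_mult split_beta)
  finally show ?thesis
    by (simp add: char_def)
qed

lemma finite_borel_measure_scale:
  assumes "finite_borel_measure M"
  shows "finite_borel_measure (scale_measure (ennreal r) M)"
proof -
  interpret finite_borel_measure M by fact
  show ?thesis
    by (auto simp: finite_borel_measure_iff M_is_borel space_scale_measure emeasure_eq_measure
        ennreal_mult_eq_top_iff intro!: finite_measureI)
qed

lemma char_scale:
  assumes M: "finite_borel_measure M" and r: "0 \<le> r"
  shows "char (scale_measure (ennreal r) M) t = complex_of_real r * char M t"
proof -
  note [measurable_cong] = finite_borel_measureD(2)[OF M]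
  have "scale_measure (ennreal r) M = density M (\<lambda>_. ennreal r)"
    by (intro measure_eqI) (simp_all add: emeasure_density_const)
  then have "char (scale_measure (ennreal r) M) t = (CLINT x|M. r *\<^sub>R iexp (t * x))"
    unfolding char_def using r by (simp only: integral_density) (subst integral_density, auto)
  then show ?thesis
    by (simp add: char_def scaleR_conv_of_real)
qed

lemma finite_borel_measure_return: "finite_borel_measure (return borel (x :: real))"
  by (simp add: finite_borel_measure_iff prob_space.finite_measure prob_space_return)

lemma char_return_0: "char (return borel (0 :: real)) t = 1"
  by (simp add: char_def integral_return)

lemma finite_borel_measure_conv_power:
  "finite_borel_measure F \<Longrightarrow> finite_borel_measure (conv_power n F)"
  by (induction n) (simp_all add: finite_borel_measure_return finite_borel_measure_convolution)

lemma char_conv_power: "finite_borel_measure F \<Longrightarrow> char (conv_power n F) t = char F t ^ n"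
  by (induction n) (simp_all add: char_return_0 char_convolution finite_borel_measure_conv_power)

lemma measure_conv_power_UNIV:
  assumes F: "finite_borel_measure F"
  shows "measure (conv_power n F) UNIV = measure F UNIV ^ n"
proof -
  have "complex_of_real (measure (conv_power n F) UNIV) = complex_of_real (measure F UNIV ^ n)"
    using char_conv_power[OF F, of n 0] finite_borel_measure_conv_power[OF F, of n] F
    by (simp add: char_0 finite_borel_measureD)
  then show ?thesis
    by (simp only: of_real_eq_iff)
qed

text \<open>
  The value of the transform at 0 is the total mass.  After division by it, Levy's uniqueness
  theorem for probability distributions applies.
\<close>

lemma finite_borel_measure_eqI_char:
  assumes M: "finite_borel_measure M" and N: "finite_borel_measure N"
    and eq: "\<And>t. char M t = char N t"
  shows "M = N"
proof -
  note MD = finite_borel_measureD[OF M] and ND = finite_borel_measureD[OF N]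
  define m where "m = measure M UNIV"
  have m: "measure N UNIV = m"
    using eq[of 0] by (simp add: char_0 MD ND m_def)
  have em: "emeasure M UNIV = ennreal m" "emeasure N UNIV = ennreal m"
    using m by (simp_all add: finite_measure.emeasure_eq_measure MD ND m_def)
  show ?thesis
  proof (cases "m = 0")
    case True
    have "emeasure M A = 0" "emeasure N A = 0" for A
      using em True emeasure_space[of M A] emeasure_space[of N A] by (simp_all add: MD ND)
    then show ?thesis
      by (intro measure_eqI) (simp_all add: MD ND)
  next
    case False
    then have mpos: "0 < m"
      by (simp add: m_def zero_less_measure_iff)
    have *: "real_distribution (scale_measure (ennreal (1 / m)) K)"
      if "finite_borel_measure K" "measure K UNIV = m" for K
      using mpos that finite_borel_measure_scale[OF that(1), of "1 / m"]
      by (auto simp: real_distribution_def real_distribution_axioms_def space_scale_measure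
          finite_borel_measureD finite_measure.emeasure_eq_measure ennreal_mult[symmetric]
          intro!: prob_spaceI)
    have "scale_measure (ennreal (1 / m)) M = scale_measure (ennreal (1 / m)) N"
      using mpos by (intro Levy_uniqueness) (auto simp: * M N m m_def[symmetric] char_scale eq fun_eq_iff)
    then have "scale_measure (ennreal m * ennreal (1 / m)) M = scale_measure (ennreal m * ennreal (1 / m)) N"
      by (metis scale_scale_measure)
    then show ?thesis
      using mpos by (simp add: ennreal_mult[symmetric])
  qed
qed

section \<open>Linear relations between measures\<close>

text \<open>
  A list of pairs stands for a real linear combination of measures; this is its part with positive
  coefficients, which is again a measure.
\<close>

definition pos_comb :: "(real \<times> real measure) list \<Rightarrow> real measure" where
  "pos_comb xs = mixture (\<lambda>n. if n < length xs then max 0 (fst (xs ! n)) else 0)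
     (\<lambda>n. if n < length xs then snd (xs ! n) else return borel 0)"

lemma
  assumes xs: "\<And>r M. (r, M) \<in> set xs \<Longrightarrow> finite_borel_measure M"
  shows finite_borel_measure_pos_comb: "finite_borel_measure (pos_comb xs)" (is ?A)
    and measure_pos_comb: "A \<in> sets borel \<Longrightarrow>
      measure (pos_comb xs) A = (\<Sum>(r, M)\<leftarrow>xs. max 0 r * measure M A)" (is "_ \<Longrightarrow> ?B")
    and char_pos_comb:
      "char (pos_comb xs) t = (\<Sum>(r, M)\<leftarrow>xs. complex_of_real (max 0 r) * char M t)" (is ?C)
proof -
  let ?a = "\<lambda>n. if n < length xs then max 0 (fst (xs ! n)) else 0"
  let ?\<mu> = "\<lambda>n. if n < length xs then snd (xs ! n) else return borel 0"
  have fbm: "finite_borel_measure (?\<mu> n)" for n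
    using xs[of "fst (xs ! n)" "snd (xs ! n)"] by (auto simp: finite_borel_measure_return)
  have a: "0 \<le> ?a n" for n
    by simp
  have s: "summable (\<lambda>n. ?a n * measure (?\<mu> n) UNIV)"
    by (rule summable_finite[of "{..<length xs}"]) auto
  show ?A
    unfolding pos_comb_def using fbm a s by (rule finite_borel_measure_mixture)
  show ?B if A: "A \<in> sets borel"
  proof -
    have "(\<lambda>n. ?a n * measure (?\<mu> n) A) sums measure (pos_comb xs) A"
      unfolding pos_comb_def using fbm a s A by (rule measure_mixture_sums)
    moreover have "(\<lambda>n. ?a n * measure (?\<mu> n) A) sums (\<Sum>n<length xs. ?a n * measure (?\<mu> n) A)"
      by (rule sums_finite) auto
    ultimately have "measure (pos_comb xs) A = (\<Sum>n<length xs. ?a n * measure (?\<mu> n) A)"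
      by (rule sums_unique2)
    also have "\<dots> = (\<Sum>(r, M)\<leftarrow>xs. max 0 r * measure M A)"
      by (simp add: sum_list_sum_nth lessThan_atLeast0 split_beta)
    finally show ?thesis .
  qed
  show ?C
  proof -
    have "(\<lambda>n. complex_of_real (?a n) * char (?\<mu> n) t) sums char (pos_comb xs) t"
      unfolding pos_comb_def using fbm a s by (rule char_mixture_sums)
    moreover have "(\<lambda>n. complex_of_real (?a n) * char (?\<mu> n) t) sums
        (\<Sum>n<length xs. complex_of_real (?a n) * char (?\<mu> n) t)"
      by (rule sums_finite) auto
    ultimately have "char (pos_comb xs) t = (\<Sum>n<length xs. complex_of_real (?a n) * char (?\<mu> n) t)"
      by (rule sums_unique2)
    also have "\<dots> = (\<Sum>(r, M)\<leftarrow>xs. complex_of_real (max 0 r) * char M t)"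
      by (simp add: sum_list_sum_nth lessThan_atLeast0 split_beta)
    finally show ?thesis .
  qed
qed

definition neg_coeffs :: "(real \<times> real measure) list \<Rightarrow> (real \<times> real measure) list" where
  "neg_coeffs xs = map (\<lambda>(r, M). (- r, M)) xs"

lemma sum_list_pos_neg_parts:
  fixes g :: "real measure \<Rightarrow> 'b :: real_algebra_1"
  shows "(\<Sum>(r, M)\<leftarrow>xs. of_real r * g M) =
    (\<Sum>(r, M)\<leftarrow>xs. of_real (max 0 r) * g M) - (\<Sum>(r, M)\<leftarrow>neg_coeffs xs. of_real (max 0 r) * g M)"
proof (induction xs)
  case (Cons x xs)
  have "of_real (fst x) = (of_real (max 0 (fst x)) - of_real (max 0 (- fst x)) :: 'b)"
    by (simp add: max_def flip: of_real_diff)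
  then have "of_real (fst x) * g (snd x) =
      of_real (max 0 (fst x)) * g (snd x) - of_real (max 0 (- fst x)) * g (snd x)"
    by (simp only: left_diff_distrib)
  with Cons show ?case
    by (simp add: neg_coeffs_def split_beta algebra_simps)
qed (simp add: neg_coeffs_def)

text \<open>
  Moving the negative coefficients to the other side turns a linear relation into an equality of two
  positive measures, to which uniqueness of the Fourier transform applies.
\<close>

lemma lin_comb_char_iff:
  assumes xs: "\<And>r M. (r, M) \<in> set xs \<Longrightarrow> finite_borel_measure M"
  shows "(\<forall>t. (\<Sum>(r, M)\<leftarrow>xs. complex_of_real r * char M t) = 0) \<longleftrightarrow>
    (\<forall>A\<in>sets borel. (\<Sum>(r, M)\<leftarrow>xs. r * measure M A) = 0)"
proof -
  have ys: "finite_borel_measure M" if "(r, M) \<in> set (neg_coeffs xs)" for r M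
    using that xs by (auto simp: neg_coeffs_def)
  note P = finite_borel_measure_pos_comb[OF xs] and N = finite_borel_measure_pos_comb[OF ys]
  have "(\<forall>t. (\<Sum>(r, M)\<leftarrow>xs. complex_of_real r * char M t) = 0) \<longleftrightarrow>
    (\<forall>t. char (pos_comb xs) t = char (pos_comb (neg_coeffs xs)) t)"
    by (simp add: sum_list_pos_neg_parts char_pos_comb xs ys)
  also have "\<dots> \<longleftrightarrow> pos_comb xs = pos_comb (neg_coeffs xs)"
    using finite_borel_measure_eqI_char[OF P N] by auto
  also have "\<dots> \<longleftrightarrow> (\<forall>A\<in>sets borel. measure (pos_comb xs) A = measure (pos_comb (neg_coeffs xs)) A)"
  proof (intro iffI)
    assume *: "\<forall>A\<in>sets borel. measure (pos_comb xs) A = measure (pos_comb (neg_coeffs xs)) A"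
    show "pos_comb xs = pos_comb (neg_coeffs xs)"
      using * by (intro measure_eqI)
        (auto simp: finite_borel_measureD[OF P] finite_borel_measureD[OF N]
            finite_measure.emeasure_eq_measure)
  qed simp
  also have "\<dots> \<longleftrightarrow> (\<forall>A\<in>sets borel. (\<Sum>(r, M)\<leftarrow>xs. r * measure M A) = 0)"
    using sum_list_pos_neg_parts[where 'b = real, of "\<lambda>M. measure M _" xs]
    by (simp add: measure_pos_comb xs ys)
  finally show ?thesis .
qed

text \<open>
  The uniqueness step of Wiener-Hopf factorisation: on \<open>(0, \<infinity>)\<close> the second family is invisible, and
  the first one is not seen anywhere else.
\<close>

lemma lin_comb_half_lines:
  assumes xs: "\<And>r M. (r, M) \<in> set xs \<Longrightarrow> finite_borel_measure M \<and> measure M {..0} = 0"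
    and ys: "\<And>r M. (r, M) \<in> set ys \<Longrightarrow> finite_borel_measure M \<and> measure M {0<..} = 0"
    and eq: "\<And>t. (\<Sum>(r, M)\<leftarrow>xs. complex_of_real r * char M t) +
      (\<Sum>(r, M)\<leftarrow>ys. complex_of_real r * char M t) = 0"
  shows "(\<Sum>(r, M)\<leftarrow>xs. complex_of_real r * char M t) = 0"
proof -
  have "(\<Sum>(r, M)\<leftarrow>xs. r * measure M A) = 0" if A: "A \<in> sets borel" for A
  proof -
    have "measure M (A \<inter> {0<..}) = measure M A" if "(r, M) \<in> set xs" for r M
    proof -
      interpret finite_borel_measure M using xs that by auto
      have "measure M (A \<inter> {..0}) = 0"
        using finite_measure_mono[of "A \<inter> {..0}" "{..0}"] xs[OF that] A M_is_borel
        by (simp add: measure_le_0_iff)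
      moreover have "measure M A = measure M (A \<inter> {..0}) + measure M (A \<inter> {0<..})"
        using A M_is_borel
        by (subst finite_measure_Union[symmetric]) (auto intro!: arg_cong[where f = "measure M"])
      ultimately show ?thesis by simp
    qed
    then have 1: "(\<Sum>(r, M)\<leftarrow>xs. r * measure M A) = (\<Sum>(r, M)\<leftarrow>xs. r * measure M (A \<inter> {0<..}))"
      by (intro arg_cong[where f = sum_list] map_cong refl) auto
    have "measure M (A \<inter> {0<..}) = 0" if "(r, M) \<in> set ys" for r M
    proof -
      interpret finite_borel_measure M using ys that by auto
      show ?thesis
        using finite_measure_mono[of "A \<inter> {0<..}" "{0<..}"] ys[OF that] A M_is_borel
        by (simp add: measure_le_0_iff)
    qed
    then have "map (\<lambda>(r, M). r * measure M (A \<inter> {0<..})) ys = map (\<lambda>_. 0) ys"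
      by (intro map_cong refl) auto
    then have 2: "(\<Sum>(r, M)\<leftarrow>ys. r * measure M (A \<inter> {0<..})) = 0"
      by (simp only: sum_list_0)
    have "\<forall>A\<in>sets borel. (\<Sum>(r, M)\<leftarrow>xs @ ys. r * measure M A) = 0"
      by (rule lin_comb_char_iff[THEN iffD1]) (use xs ys eq in auto)
    moreover have "A \<inter> {0<..} \<in> sets borel"
      using A by simp
    ultimately have "(\<Sum>(r, M)\<leftarrow>xs @ ys. r * measure M (A \<inter> {0<..})) = 0"
      by blast
    then show ?thesis
      using 1 2 by simp
  qed
  then show ?thesis
    using lin_comb_char_iff[of xs] xs by blast
qed

section \<open>Window masses and truncation\<close>

definition nonneg_measure :: "real measure \<Rightarrow> bool" where
  "nonneg_measure M \<longleftrightarrow> finite_borel_measure M \<and> measure M {..<0} = 0"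

lemma nonneg_measureD:
  assumes "nonneg_measure M"
  shows "finite_borel_measure M" "finite_measure M" "sets M = sets borel" "space M = UNIV"
    "measure M {..<0} = 0"
  using assms finite_borel_measureD[of M] by (auto simp: nonneg_measure_def)

lemma nonneg_measure_AE: "nonneg_measure M \<Longrightarrow> AE u in M. 0 \<le> u"
  using nonneg_measureD[of M]
  by (intro AE_I[where N = "{..<0}"])
     (auto simp: finite_measure.emeasure_eq_measure)

lemma borel_measurable_loc:
  assumes "finite_borel_measure M"
  shows "loc c M \<in> borel_measurable borel"
proof (cases "0 \<le> c")
  case True
  interpret finite_borel_measure M by fact
  have "loc c M x = measure M {..x + c} - measure M {..x}" for x
  proof -
    have "measure M ({..x + c} - {..x}) = measure M {..x + c} - measure M {..x}"
      using True M_is_borel by (intro finite_measure_Diff) auto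
    moreover have "{..x + c} - {..x} = {x<..x + c}"
      by auto
    ultimately show ?thesis
      by (simp add: loc_def)
  qed
  then have "loc c M = (\<lambda>x. measure M {..x + c} - measure M {..x})"
    by (intro ext)
  moreover have "mono (\<lambda>x. measure M {..x + c})" "mono (\<lambda>x. measure M {..x})"
    by (intro monoI finite_measure_mono; simp add: M_is_borel)+
  ultimately show ?thesis
    by (simp only: borel_measurable_diff borel_measurable_mono)
next
  case False
  then have "loc c M = (\<lambda>x. 0)"
    by (auto simp: loc_def fun_eq_iff)
  then show ?thesis
    by simp
qed

lemma loc_nonneg [simp]: "0 \<le> loc c M x"
  by (simp add: loc_def)

lemma loc_le_mass:
  assumes "finite_borel_measure M"
  shows "loc c M x \<le> measure M UNIV"
proof -
  interpret finite_borel_measure M by fact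
  show ?thesis
    unfolding loc_def by (intro finite_measure_mono) (simp_all add: M_is_borel)
qed

lemma integrable_loc:
  assumes "finite_borel_measure M" "finite_borel_measure N"
  shows "integrable M (\<lambda>u. loc c N (x - u))"
proof -
  interpret M: finite_borel_measure M by fact
  have [measurable]: "loc c N \<in> borel_measurable borel"
    by (rule borel_measurable_loc) fact
  have "(\<lambda>u. loc c N (x - u)) \<in> borel_measurable borel"
    by measurable
  then show ?thesis
    using M.M_is_borel loc_le_mass[OF assms(2)]
    by (intro M.integrable_const_bound[where B = "measure N UNIV"]) (auto cong: measurable_cong_sets)
qed

lemma loc_convolution:
  assumes M: "finite_borel_measure M" and N: "finite_borel_measure N"
  shows "loc c (convolution M N) x = (\<integral>u. loc c N (x - u) \<partial>M)"
proof -
  interpret M: finite_borel_measure M by fact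
  interpret N: finite_borel_measure N by fact
  note MD = finite_borel_measureD[OF M] and ND = finite_borel_measureD[OF N]
  have eq: "{a. a + u \<in> {x<..x + c}} = {x - u<..x - u + c}" for u
    by auto
  have "emeasure (convolution M N) {x<..x + c} = (\<integral>\<^sup>+u. emeasure N {a. a + u \<in> {x<..x + c}} \<partial>M)"
    by (rule convolution_emeasure) (simp_all add: MD ND)
  also have "\<dots> = (\<integral>\<^sup>+u. ennreal (loc c N (x - u)) \<partial>M)"
    by (simp only: eq loc_def N.emeasure_eq_measure)
  also have "\<dots> = ennreal (\<integral>u. loc c N (x - u) \<partial>M)"
    using integrable_loc[OF M N] by (intro nn_integral_eq_integral) auto
  finally show ?thesis
    by (simp add: loc_def measure_def)
qed

lemma convolution_commute:
  "finite_borel_measure M \<Longrightarrow> finite_borel_measure N \<Longrightarrow> convolution M N = convolution N M"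
  by (rule convolution_commutative) (auto dest: finite_borel_measureD)

lemma measure_convolution_UNIV:
  assumes M: "finite_borel_measure M" and N: "finite_borel_measure N"
  shows "measure (convolution M N) UNIV = measure M UNIV * measure N UNIV"
proof -
  have "complex_of_real (measure (convolution M N) UNIV) =
      complex_of_real (measure M UNIV * measure N UNIV)"
    using char_convolution[OF M N, of 0] by (simp add: char_0 finite_borel_measureD[OF M] finite_borel_measureD[OF N])
  then show ?thesis
    by (simp only: of_real_eq_iff)
qed

lemma measure_convolution_eq_0:
  assumes M: "finite_borel_measure M" "A \<in> sets borel" "measure M A = 0"
    and N: "finite_borel_measure N" "B \<in> sets borel" "measure N B = 0"
    and S: "S \<in> sets borel" "\<And>u v. u \<notin> A \<Longrightarrow> v \<notin> B \<Longrightarrow> u + v \<notin> S"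
  shows "measure (convolution M N) S = 0"
proof -
  note MD = finite_borel_measureD[OF M(1)] and ND = finite_borel_measureD[OF N(1)]
  have "emeasure (convolution M N) S = (\<integral>\<^sup>+u. emeasure N {a. a + u \<in> S} \<partial>M)"
    using S(1) by (rule convolution_emeasure) (simp_all add: MD ND)
  also have "\<dots> = (\<integral>\<^sup>+u. 0 \<partial>M)"
  proof (rule nn_integral_cong_AE)
    have "AE u in M. u \<notin> A"
      using M by (intro AE_I[where N = A]) (auto simp: finite_measure.emeasure_eq_measure MD)
    then show "AE u in M. emeasure N {a. a + u \<in> S} = 0"
    proof eventually_elim
      case (elim u)
      then have "emeasure N {a. a + u \<in> S} \<le> emeasure N B"
        using S(2)[of u] N(2) by (intro emeasure_mono) (auto simp: ND add.commute)
      then show ?case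
        using N by (simp add: finite_measure.emeasure_eq_measure ND)
    qed
  qed
  finally show ?thesis
    by (simp add: measure_def)
qed

lemma nonneg_measure_convolution:
  assumes M: "nonneg_measure M" and N: "nonneg_measure N"
  shows "nonneg_measure (convolution M N)"
proof -
  note MD = nonneg_measureD[OF M] and ND = nonneg_measureD[OF N]
  have "measure (convolution M N) {..<0} = 0"
    by (rule measure_convolution_eq_0[OF MD(1) _ MD(5) ND(1) _ ND(5)]) auto
  then show ?thesis
    using finite_borel_measure_convolution[OF MD(1) ND(1)] by (simp add: nonneg_measure_def)
qed

definition trunc :: "real \<Rightarrow> real measure \<Rightarrow> real measure" where
  "trunc K M = density M (indicator {..K})"

definition tail :: "real \<Rightarrow> real measure \<Rightarrow> real measure" where
  "tail K M = density M (indicator {K<..})"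

lemma sets_trunc_tail [simp]: "sets (trunc K M) = sets M" "sets (tail K M) = sets M"
  by (simp_all add: trunc_def tail_def)

context
  fixes M :: "real measure"
  assumes M: "finite_borel_measure M"
begin

lemma measure_trunc: "A \<in> sets borel \<Longrightarrow> measure (trunc K M) A = measure M ({..K} \<inter> A)"
  and measure_tail: "A \<in> sets borel \<Longrightarrow> measure (tail K M) A = measure M ({K<..} \<inter> A)"
  by (simp_all add: trunc_def tail_def measure_def emeasure_density_const emeasure_restricted
      finite_borel_measureD[OF M])

lemma finite_borel_measure_trunc: "finite_borel_measure (trunc K M)"
  and finite_borel_measure_tail: "finite_borel_measure (tail K M)"
  using finite_borel_measureD[OF M]
  by (auto simp: finite_borel_measure_iff trunc_def tail_def emeasure_restricted
      finite_measure.emeasure_eq_measure intro!: finite_measureI)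

lemma integral_trunc_tail:
  fixes g :: "real \<Rightarrow> real"
  assumes "integrable M g"
  shows "(\<integral>u. g u \<partial>M) = (\<integral>u. g u \<partial>trunc K M) + (\<integral>u. g u \<partial>tail K M)"
proof -
  have [measurable]: "g \<in> borel_measurable M" and [measurable_cong]: "sets M = sets borel"
    using assms finite_borel_measureD[OF M] by auto
  have t: "trunc K M = density M (\<lambda>x. ennreal (indicator {..K} x))"
      "tail K M = density M (\<lambda>x. ennreal (indicator {K<..} x))"
    by (simp_all add: trunc_def tail_def ennreal_indicator)
  have "(\<integral>u. g u \<partial>trunc K M) = (\<integral>u. indicator {..K} u *\<^sub>R g u \<partial>M)"
    "(\<integral>u. g u \<partial>tail K M) = (\<integral>u. indicator {K<..} u *\<^sub>R g u \<partial>M)"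
    unfolding t by (intro integral_density; simp)+
  moreover have "integrable M (\<lambda>u. indicator {..K} u *\<^sub>R g u)"
    "integrable M (\<lambda>u. indicator {K<..} u *\<^sub>R g u)"
    using assms by (intro integrable_mult_indicator; simp add: finite_borel_measureD[OF M])+
  moreover have "(\<integral>u. g u \<partial>M) = (\<integral>u. indicator {..K} u *\<^sub>R g u + indicator {K<..} u *\<^sub>R g u \<partial>M)"
    by (intro Bochner_Integration.integral_cong) (auto simp: indicator_def)
  ultimately show ?thesis
    by simp
qed

lemma loc_convolution_trunc_tail:
  assumes N: "finite_borel_measure N"
  shows "loc c (convolution M N) x =
    loc c (convolution (trunc K M) N) x + loc c (convolution (tail K M) N) x"
  using integral_trunc_tail[OF integrable_loc[OF M N]]
  by (simp add: loc_convolution M N finite_borel_measure_trunc finite_borel_measure_tail)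

lemma loc_tail_le: "loc c (tail K M) x \<le> loc c M x"
proof -
  interpret finite_borel_measure M by (rule M)
  show ?thesis
    unfolding loc_def by (subst measure_tail) (auto simp: M M_is_borel intro!: finite_measure_mono)
qed

lemma loc_tail_eq: "K \<le> x \<Longrightarrow> loc c (tail K M) x = loc c M x"
  by (auto simp: loc_def measure_tail intro!: arg_cong[where f = "measure M"])

lemma loc_trunc_eq: "K \<le> x \<Longrightarrow> loc c (trunc K M) x = 0"
proof -
  assume "K \<le> x"
  then have "{..K} \<inter> {x<..x + c} = {}"
    by auto
  then show ?thesis
    by (simp add: loc_def measure_trunc)
qed

lemma tail_mass_tendsto_0: "((\<lambda>K. measure M {K<..}) \<longlongrightarrow> 0) at_top"
proof -
  interpret finite_borel_measure M by (rule M)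
  have "measure M {K<..} = measure M UNIV - cdf M K" for K
    using finite_measure_compl[of "{..K}"] finite_borel_measureD[OF M]
    by (simp add: cdf_def Compl_eq_Diff_UNIV[symmetric])
  moreover have "((\<lambda>K. measure M UNIV - cdf M K) \<longlongrightarrow> measure M UNIV - measure M UNIV) at_top"
    using cdf_lim_at_top finite_borel_measureD[OF M] by (intro tendsto_intros) auto
  ultimately show ?thesis
    by simp
qed

lemma measure_tail_UNIV: "measure (tail K M) UNIV = measure M {K<..}"
  by (simp add: measure_tail)

lemma measure_trunc_UNIV: "measure (trunc K M) UNIV = measure M UNIV - measure M {K<..}"
proof -
  interpret finite_borel_measure M by (rule M)
  show ?thesis
    using finite_measure_compl[of "{K<..}"] finite_borel_measureD[OF M]
    by (simp add: measure_trunc Compl_eq_Diff_UNIV[symmetric])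
qed

lemma trunc_mass_tendsto: "((\<lambda>K. measure (trunc K M) UNIV) \<longlongrightarrow> measure M UNIV) at_top"
  using tendsto_diff[OF tendsto_const tail_mass_tendsto_0]
  by (simp add: measure_trunc_UNIV)

lemma char_trunc_tail: "char M t = char (trunc K M) t + char (tail K M) t"
proof -
  interpret finite_borel_measure M by (rule M)
  have "\<forall>t. (\<Sum>(r, M)\<leftarrow>[(1, M), (-1, trunc K M), (-1, tail K M)]. complex_of_real r * char M t) = 0"
  proof (rule lin_comb_char_iff[THEN iffD2])
    show "\<forall>A\<in>sets borel. (\<Sum>(r, M)\<leftarrow>[(1, M), (-1, trunc K M), (-1, tail K M)]. r * measure M A) = 0"
    proof
      fix A :: "real set" assume A: "A \<in> sets borel"
      have "measure M A = measure M ({..K} \<inter> A) + measure M ({K<..} \<inter> A)"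
        using A M_is_borel
        by (subst finite_measure_Union[symmetric]) (auto intro!: arg_cong[where f = "measure M"])
      then show "(\<Sum>(r, M)\<leftarrow>[(1, M), (-1, trunc K M), (-1, tail K M)]. r * measure M A) = 0"
        using A by (simp add: measure_trunc measure_tail)
    qed
  qed (auto simp: M finite_borel_measure_trunc finite_borel_measure_tail)
  then have "char M t - char (trunc K M) t - char (tail K M) t = 0"
    by (simp add: algebra_simps)
  then show ?thesis
    by (simp add: algebra_simps)
qed

end

lemma nonneg_measure_trunc:
  assumes "nonneg_measure M"
  shows "nonneg_measure (trunc K M)" "nonneg_measure (tail K M)"
proof -
  note MD = nonneg_measureD[OF assms]
  interpret finite_measure M by fact
  have "measure M ({..K} \<inter> {..<0}) \<le> measure M {..<0}" "measure M ({K<..} \<inter> {..<0}) \<le> measure M {..<0}"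
    by (auto intro!: finite_measure_mono simp: MD(3))
  then show "nonneg_measure (trunc K M)" "nonneg_measure (tail K M)"
    by (simp_all add: nonneg_measure_def MD finite_borel_measure_trunc finite_borel_measure_tail
        measure_trunc measure_tail measure_le_0_iff)
qed

lemma AE_trunc: "finite_borel_measure M \<Longrightarrow> AE u in trunc K M. u \<le> K"
  unfolding trunc_def by (subst AE_density) (auto simp: finite_borel_measureD indicator_def intro!: borel_measurable_indicator)

lemma loc_convolution_trunc_trunc:
  assumes M: "finite_borel_measure M" and N: "finite_borel_measure N" and "2 * K \<le> x"
  shows "loc c (convolution (trunc K M) (trunc K N)) x = 0"
proof -
  have "(\<integral>u. loc c (trunc K N) (x - u) \<partial>trunc K M) = (\<integral>u. 0 \<partial>trunc K M)"
  proof (rule integral_cong_AE)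
    show "AE u in trunc K M. loc c (trunc K N) (x - u) = 0"
      using AE_trunc[OF M]
    proof eventually_elim
      case (elim u)
      then show ?case
        using \<open>2 * K \<le> x\<close> by (intro loc_trunc_eq N) linarith
    qed
  qed (use integrable_loc[OF finite_borel_measure_trunc[OF M] finite_borel_measure_trunc[OF N]] in auto)
  then show ?thesis
    by (simp add: loc_convolution M N finite_borel_measure_trunc)
qed

text \<open>
  A sum that exceeds \<open>2 K\<close> has a summand above \<open>K\<close>.  The three terms collect the pairs whose first
  summand is at most \<open>K\<close>, whose second summand is at most \<open>K\<close>, and whose summands both exceed \<open>K\<close>.
\<close>

lemma loc_convolution_split:
  assumes M: "finite_borel_measure M" and N: "finite_borel_measure N" and x: "2 * K \<le> x"
  shows "loc c (convolution M N) x =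
    loc c (convolution (trunc K M) N) x + loc c (convolution (trunc K N) M) x +
    loc c (convolution (tail K M) (tail K N)) x"
proof -
  note tt = finite_borel_measure_trunc finite_borel_measure_tail
  have "loc c (convolution (tail K M) N) x = loc c (convolution N (tail K M)) x"
    using M N by (simp add: convolution_commute tt)
  also have "\<dots> = loc c (convolution (trunc K N) (tail K M)) x + loc c (convolution (tail K N) (tail K M)) x"
    using M N by (intro loc_convolution_trunc_tail tt)
  also have "loc c (convolution (trunc K N) (tail K M)) x = loc c (convolution (trunc K N) M) x"
    using loc_convolution_trunc_tail[OF M finite_borel_measure_trunc[OF N, of K], where c = c and K = K and x = x]
      loc_convolution_trunc_trunc[OF M N x, of c] M N
      convolution_commute[OF tt(1)[OF N] tt(2)[OF M], of K K] convolution_commute[OF tt(1)[OF N] M, of K]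
    by simp
  also have "loc c (convolution (tail K N) (tail K M)) x = loc c (convolution (tail K M) (tail K N)) x"
    using M N by (simp add: convolution_commute tt)
  finally show ?thesis
    using loc_convolution_trunc_tail[OF M N, where c = c and K = K and x = x] by simp
qed

section \<open>Window asymptotics relative to a long-tailed distribution\<close>

text \<open>
  \<open>F\<close> is a yardstick: the window masses of other measures are compared with those of \<open>F\<close>.
\<close>

locale local_long_tail =
  fixes c :: real and F :: "real measure"
  assumes c_pos: "0 < c" and F: "nonneg_measure F" and F_mass: "measure F UNIV = 1"
    and eventually_positive: "\<forall>\<^sub>F x in at_top. 0 < loc c F x"
    and shift_pos: "\<And>y. 0 < y \<Longrightarrow> ((\<lambda>x. loc c F (x + y) / loc c F x) \<longlongrightarrow> 1) at_top"
begin

abbreviation f :: "real \<Rightarrow> real" where "f \<equiv> loc c F"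

lemma shift: "((\<lambda>x. f (x - u) / f x) \<longlongrightarrow> 1) at_top"
proof (cases u "0 :: real" rule: linorder_cases)
  case less
  then show ?thesis
    using shift_pos[of "- u"] by simp
next
  case equal
  have "\<forall>\<^sub>F x in at_top. f (x - u) / f x = 1"
    using eventually_positive by eventually_elim (simp add: equal)
  then show ?thesis
    by (rule tendsto_eventually)
next
  case greater
  have "filterlim (\<lambda>x. - u + x) at_top at_top"
    by (rule filterlim_tendsto_add_at_top[OF tendsto_const filterlim_ident])
  then have "((\<lambda>x. f ((- u + x) + u) / f (- u + x)) \<longlongrightarrow> 1) at_top"
    by (rule filterlim_compose[OF shift_pos[OF greater]])
  then have "((\<lambda>x. inverse (f ((- u + x) + u) / f (- u + x))) \<longlongrightarrow> inverse 1) at_top"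
    by (rule tendsto_inverse) simp
  then show ?thesis
    by (simp add: add.commute)
qed

lemma filterlim_minus_at_top: "filterlim (\<lambda>x::real. x - u) at_top at_top"
  using filterlim_tendsto_add_at_top[OF tendsto_const filterlim_ident, of "- u"] by simp

lemma cover_by_windows:
  assumes "finite_borel_measure M"
  shows "measure M {x - real m * c<..x + c} \<le> (\<Sum>i\<le>m. loc c M (x - real i * c))"
proof (induction m)
  case (Suc m)
  interpret finite_borel_measure M by fact
  have "measure M {x - real (Suc m) * c<..x + c} \<le>
      measure M ({x - real m * c<..x + c} \<union> {x - real (Suc m) * c<..x - real (Suc m) * c + c})"
    by (intro finite_measure_mono) (auto simp: M_is_borel algebra_simps)
  also have "\<dots> \<le> measure M {x - real m * c<..x + c} + loc c M (x - real (Suc m) * c)"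
    unfolding loc_def by (rule measure_Un_le) (auto simp: M_is_borel)
  finally show ?case
    using Suc by simp
qed (simp add: loc_def)

text \<open>
  Long-tailedness compares windows at one fixed shift at a time.  Covering a long window by finitely
  many windows of length \<open>c\<close> gives bounds that are uniform in the shift, which is what dominated
  convergence needs.
\<close>

lemma long_window_bound:
  obtains C where "0 < C" "\<forall>\<^sub>F x in at_top. measure F {x - K<..x + c} \<le> C * f x"
proof -
  obtain m :: nat where m: "K / c \<le> real m"
    using real_arch_simple by blast
  then have m': "K \<le> real m * c"
    using c_pos by (simp add: divide_le_eq)
  have "((\<lambda>x. \<Sum>i\<le>m. f (x - real i * c) / f x) \<longlongrightarrow> (\<Sum>i\<le>m. 1)) at_top"
    by (intro tendsto_sum shift)
  then have "\<forall>\<^sub>F x in at_top. (\<Sum>i\<le>m. f (x - real i * c) / f x) < real m + 2"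
    by (rule order_tendstoD) simp
  with eventually_positive have "\<forall>\<^sub>F x in at_top. measure F {x - K<..x + c} \<le> (real m + 2) * f x"
  proof eventually_elim
    case (elim x)
    interpret finite_borel_measure F
      using F by (rule nonneg_measureD)
    have "measure F {x - K<..x + c} \<le> measure F {x - real m * c<..x + c}"
      using m' by (intro finite_measure_mono) (auto simp: M_is_borel)
    also have "\<dots> \<le> (\<Sum>i\<le>m. f (x - real i * c))"
      by (rule cover_by_windows) (rule nonneg_measureD[OF F])
    also have "\<dots> \<le> (real m + 2) * f x"
      using elim by (simp add: sum_divide_distrib[symmetric] divide_less_eq)
    finally show ?case .
  qed
  then show ?thesis
    by (intro that[of "real m + 2"]) auto
qed

lemma shift_bound:
  obtains C where "0 < C" "\<forall>\<^sub>F x in at_top. \<forall>u\<in>{0..K}. f (x - u) \<le> C * f x"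
proof -
  obtain C where C: "0 < C" "\<forall>\<^sub>F x in at_top. measure F {x - K<..x + c} \<le> C * f x"
    by (rule long_window_bound)
  show ?thesis
  proof
    show "\<forall>\<^sub>F x in at_top. \<forall>u\<in>{0..K}. f (x - u) \<le> C * f x"
      using C(2)
    proof eventually_elim
      case (elim x)
      interpret finite_borel_measure F
        using F by (rule nonneg_measureD)
      show ?case
      proof
        fix u assume "u \<in> {0..K}"
        then have "f (x - u) \<le> measure F {x - K<..x + c}"
          unfolding loc_def by (intro finite_measure_mono) (auto simp: M_is_borel)
        then show "f (x - u) \<le> C * f x"
          using elim by simp
      qed
    qed
  qed fact
qed

text \<open>
  Kesten's bound compares with \<open>f\<close> on a bounded range of \<open>x\<close>, where positivity at each point does not
  exclude that \<open>f\<close> comes close to 0.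
\<close>

lemma locally_bounded_below:
  obtains N where "0 \<le> N" "\<And>x. N \<le> x \<Longrightarrow> 0 < f x" "\<And>b. \<exists>\<delta>>0. \<forall>x\<in>{N..b}. \<delta> \<le> f x"
proof -
  interpret finite_borel_measure F
    using F by (rule nonneg_measureD)
  have "\<forall>\<^sub>F x in at_top. f (x + c / 2) / f x < 2"
    using shift_pos[of "c / 2"] c_pos by (intro order_tendstoD(2)[of _ 1]) auto
  with eventually_positive have "\<forall>\<^sub>F x in at_top. 0 < f x \<and> f (x + c / 2) \<le> 2 * f x"
    by eventually_elim (simp add: divide_less_eq)
  then obtain N0 where N0: "\<And>x. N0 \<le> x \<Longrightarrow> 0 < f x \<and> f (x + c / 2) \<le> 2 * f x"
    by (auto simp: eventually_at_top_linorder)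
  define N where "N = max 0 N0"
  \<comment> \<open>The window at \<open>x\<close> together with the window at \<open>x + c / 2\<close> covers every window that starts
    in \<open>{x..x + c / 2}\<close>.\<close>
  have step: "f y \<le> 4 * f x" if "N \<le> x" "x \<le> y" "y \<le> x + c / 2" for x y
  proof -
    have "f y \<le> measure F ({x<..x + c} \<union> {x + c / 2<..x + c / 2 + c})"
      unfolding loc_def using that by (intro finite_measure_mono) (auto simp: M_is_borel)
    also have "\<dots> \<le> f x + f (x + c / 2)"
      unfolding loc_def by (rule measure_Un_le) (auto simp: M_is_borel)
    also have "\<dots> \<le> 4 * f x"
      using N0[of x] that by (simp add: N_def)
    finally show ?thesis .
  qed
  have chain: "f b \<le> 4 ^ k * f x" if "N \<le> x" "x \<le> b" "b \<le> x + real k * (c / 2)" for k x b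
    using that
  proof (induction k arbitrary: x)
    case (Suc k)
    define y where "y = min b (x + c / 2)"
    have "f b \<le> 4 ^ k * f y"
      using Suc.prems c_pos by (intro Suc.IH) (auto simp: y_def min_def algebra_simps add_divide_distrib)
    also have "\<dots> \<le> 4 ^ k * (4 * f x)"
      using Suc.prems c_pos by (intro mult_left_mono step) (auto simp: y_def)
    finally show ?case
      by (simp add: mult.assoc mult.left_commute)
  qed simp
  show ?thesis
  proof
    show "0 \<le> N" "\<And>x. N \<le> x \<Longrightarrow> 0 < f x"
      using N0 by (auto simp: N_def)
    show "\<exists>\<delta>>0. \<forall>x\<in>{N..b}. \<delta> \<le> f x" for b
    proof (cases "N \<le> b")
      case True
      obtain k :: nat where "(b - N) / (c / 2) \<le> real k"
        using real_arch_simple by blast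
      then have k: "b - N \<le> real k * (c / 2)"
        using c_pos by (simp add: divide_le_eq)
      have "f b / 4 ^ k \<le> f x" if "x \<in> {N..b}" for x
        using chain[of x b k] that k by (simp add: divide_le_eq mult.commute)
      moreover have "0 < f b / 4 ^ k"
        using N0[of b] True by (simp add: N_def)
      ultimately show ?thesis
        by blast
    qed (auto intro: exI[of _ 1])
  qed
qed

definition ratio_lim :: "real measure \<Rightarrow> real \<Rightarrow> bool" where
  "ratio_lim M a \<longleftrightarrow> ((\<lambda>x. loc c M x / f x) \<longlongrightarrow> a) at_top"

lemma ratio_lim_self: "ratio_lim F 1"
  using shift[of 0] by (simp add: ratio_lim_def)

lemma ratio_limD_le:
  assumes "ratio_lim M a" "a < b"
  shows "\<forall>\<^sub>F x in at_top. loc c M x \<le> b * f x"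
proof -
  have "\<forall>\<^sub>F x in at_top. loc c M x / f x < b"
    using assms unfolding ratio_lim_def by (rule order_tendstoD)
  with eventually_positive show ?thesis
    by eventually_elim (simp add: divide_less_eq)
qed

lemma ratio_lim_nonneg: "ratio_lim M a \<Longrightarrow> 0 \<le> a"
  unfolding ratio_lim_def
  by (rule tendsto_lowerbound) (auto intro!: always_eventually)

lemma ratio_lim_shift:
  assumes "ratio_lim M a"
  shows "((\<lambda>x. loc c M (x - u) / f x) \<longlongrightarrow> a) at_top"
proof -
  have "((\<lambda>x. loc c M (x - u) / f (x - u)) \<longlongrightarrow> a) at_top"
    using assms filterlim_compose[OF _ filterlim_minus_at_top] unfolding ratio_lim_def by blast
  then have lim: "((\<lambda>x. loc c M (x - u) / f (x - u) * (f (x - u) / f x)) \<longlongrightarrow> a * 1) at_top"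
    by (intro tendsto_mult shift)
  have "\<forall>\<^sub>F x in at_top. 0 < f (x - u)"
    using eventually_compose_filterlim[OF eventually_positive filterlim_minus_at_top] .
  then have "\<forall>\<^sub>F x in at_top. loc c M (x - u) / f (x - u) * (f (x - u) / f x) = loc c M (x - u) / f x"
    by eventually_elim simp
  then show ?thesis
    using Lim_transform_eventually[OF lim] by simp
qed

text \<open>
  Shifting by a bounded amount does not change the window masses asymptotically, and \<open>shift_bound\<close>
  dominates the ratios.
\<close>

lemma ratio_lim_convolution_bounded_support:
  assumes M: "nonneg_measure M" "measure M {K<..} = 0"
    and N: "finite_borel_measure N" "ratio_lim N a"
  shows "ratio_lim (convolution M N) (measure M UNIV * a)"
proof -
  note MD = nonneg_measureD[OF M(1)]
  interpret M: finite_borel_measure M by (rule MD)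
  have [measurable]: "loc c N \<in> borel_measurable borel"
    by (rule borel_measurable_loc) (rule N)
  obtain C where C: "0 < C" "\<forall>\<^sub>F x in at_top. \<forall>u\<in>{0..K}. f (x - u) \<le> C * f x"
    by (rule shift_bound)
  have a: "0 \<le> a"
    using N(2) by (rule ratio_lim_nonneg)
  have "AE u in M. u \<le> K"
    using M(2) by (intro AE_I[where N = "{K<..}"]) (auto simp: MD M.emeasure_eq_measure)
  then have supp: "AE u in M. u \<in> {0..K}"
    using nonneg_measure_AE[OF M(1)] by eventually_elim simp
  have "((\<lambda>x. \<integral>u. loc c N (x - u) / f x \<partial>M) \<longlongrightarrow> (\<integral>u. a \<partial>M)) at_top"
  proof (rule integral_dominated_convergence_at_top[where w = "\<lambda>_. (a + 1) * C"])
    show "(\<lambda>u. loc c N (x - u) / f x) \<in> borel_measurable M" for x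
      using MD(3) by (simp cong: measurable_cong_sets)
    show "AE u in M. ((\<lambda>x. loc c N (x - u) / f x) \<longlongrightarrow> a) at_top"
      by (intro AE_I2 ratio_lim_shift N)
    obtain y0 where y0: "\<And>y. y0 \<le> y \<Longrightarrow> loc c N y \<le> (a + 1) * f y"
      using ratio_limD_le[OF N(2), of "a + 1"] by (auto simp: eventually_at_top_linorder)
    show "\<forall>\<^sub>F x in at_top. AE u in M. norm (loc c N (x - u) / f x) \<le> (a + 1) * C"
      using C(2) eventually_positive eventually_ge_at_top[of "y0 + K"]
    proof eventually_elim
      case (elim x)
      show ?case
        using supp
      proof eventually_elim
        case (elim u)
        have "loc c N (x - u) \<le> (a + 1) * f (x - u)"
          using elim \<open>y0 + K \<le> x\<close> by (intro y0) auto
        also have "\<dots> \<le> (a + 1) * (C * f x)"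
          using a elim \<open>\<forall>u\<in>{0..K}. _\<close> by (intro mult_left_mono) auto
        finally show ?case
          using \<open>0 < f x\<close> by (simp add: divide_le_eq mult.assoc)
      qed
    qed
  qed auto
  then show ?thesis
    by (simp add: ratio_lim_def loc_convolution MD N MD(4))
qed

definition negligible_tails :: "real measure \<Rightarrow> real measure \<Rightarrow> bool" where
  "negligible_tails M N \<longleftrightarrow> (\<forall>\<epsilon>>0. \<forall>\<^sub>F K in at_top. \<forall>\<^sub>F x in at_top.
     loc c (convolution (tail K M) (tail K N)) x \<le> \<epsilon> * f x)"

lemma negligible_tails_commute:
  "finite_borel_measure M \<Longrightarrow> finite_borel_measure N \<Longrightarrow> negligible_tails M N \<Longrightarrow> negligible_tails N M"
  by (simp add: negligible_tails_def convolution_commute finite_borel_measure_tail)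

lemma loc_tends_to_0:
  assumes "finite_borel_measure M"
  shows "(loc c M \<longlongrightarrow> 0) at_top"
proof (rule tendsto_sandwich)
  interpret finite_borel_measure M by fact
  show "\<forall>\<^sub>F x in at_top. 0 \<le> loc c M x"
    by simp
  show "\<forall>\<^sub>F x in at_top. loc c M x \<le> measure M {x<..}"
    unfolding loc_def by (intro always_eventually allI finite_measure_mono) (auto simp: M_is_borel)
qed (use assms in \<open>auto intro: tail_mass_tendsto_0\<close>)

text \<open>
  For large \<open>K\<close>, the window masses of \<open>N\<close> above \<open>K\<close> are at most a multiple of those of \<open>F\<close>, so \<open>N\<close>
  may be replaced by \<open>F\<close>.  Only the windows that straddle \<open>K\<close> are left over; they contribute at most
  \<open>loc c N K * loc c M (x - K)\<close>, and \<open>loc c N K\<close> tends to 0.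
\<close>

lemma negligible_tails_transfer:
  assumes M: "nonneg_measure M" and N: "nonneg_measure N"
    and MF: "negligible_tails M F"
    and a: "ratio_lim M a" and b: "ratio_lim N b"
  shows "negligible_tails M N"
  unfolding negligible_tails_def
proof (intro allI impI)
  fix \<epsilon> :: real assume \<epsilon>: "0 < \<epsilon>"
  note MD = nonneg_measureD[OF M] and ND = nonneg_measureD[OF N] and FD = nonneg_measureD[OF F]
  have a0: "0 \<le> a" and b0: "0 \<le> b"
    using a b by (auto dest: ratio_lim_nonneg)
  define C where "C = b + 1"
  have C: "0 < C"
    using b0 by (simp add: C_def)
  have "\<forall>\<^sub>F y in at_top. loc c N y \<le> C * f y"
    using b by (rule ratio_limD_le) (simp add: C_def)
  then obtain y0 where y0: "\<And>y. y0 \<le> y \<Longrightarrow> loc c N y \<le> C * f y"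
    by (auto simp: eventually_at_top_linorder)
  have "\<forall>\<^sub>F K in at_top. \<forall>\<^sub>F x in at_top.
      loc c (convolution (tail K M) (tail K F)) x \<le> \<epsilon> / (2 * C) * f x"
    by (rule MF[unfolded negligible_tails_def, rule_format]) (use \<epsilon> C in simp)
  moreover have "\<forall>\<^sub>F K in at_top. loc c N K < \<epsilon> / (2 * (a + 1))"
    using loc_tends_to_0[OF ND(1)] \<epsilon> a0 by (intro order_tendstoD) auto
  ultimately show "\<forall>\<^sub>F K in at_top. \<forall>\<^sub>F x in at_top.
      loc c (convolution (tail K M) (tail K N)) x \<le> \<epsilon> * f x"
    using eventually_ge_at_top[of y0]
  proof eventually_elim
    case (elim K)
    note tM = finite_borel_measure_tail[OF MD(1), of K] and tN = finite_borel_measure_tail[OF ND(1), of K]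
      and tF = finite_borel_measure_tail[OF FD(1), of K]
    interpret tM: finite_borel_measure "tail K M" by (rule tM)
    interpret N: finite_borel_measure N by (rule ND)
    \<comment> \<open>A window that straddles \<open>K\<close> only sees \<open>{K<..K + c}\<close>, which accounts for the second term.\<close>
    have pointwise: "loc c (tail K N) (x - u) \<le>
        C * loc c (tail K F) (x - u) + loc c N K * indicator {x - K<..x - K + c} u" for x u
    proof (cases "K \<le> x - u")
      case True
      then have "loc c (tail K N) (x - u) \<le> C * loc c (tail K F) (x - u)"
        using y0[of "x - u"] elim(3) by (simp add: loc_tail_eq ND FD)
      then show ?thesis
        by (simp add: add_increasing2)
    next
      case False
      show ?thesis
      proof (cases "x - u + c \<le> K")
        case True
        then have "{K<..} \<inter> {x - u<..x - u + c} = {}"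
          by auto
        then have "loc c (tail K N) (x - u) = 0"
          by (simp add: loc_def measure_tail ND)
        then show ?thesis
          using C by simp
      next
        case no: False
        have "loc c (tail K N) (x - u) \<le> loc c N K"
          using False no unfolding loc_def
          by (subst measure_tail) (auto simp: ND(1) N.M_is_borel intro!: N.finite_measure_mono)
        moreover have "indicator {x - K<..x - K + c} u = (1 :: real)"
          using False no by (simp add: indicator_def)
        ultimately show ?thesis
          using C by (simp add: add_increasing)
      qed
    qed
    have ind: "integrable (tail K M) (indicator {x - K<..x - K + c} :: real \<Rightarrow> real)" for x
      using tM.M_is_borel by (intro integrable_real_indicator) (auto simp: tM.emeasure_eq_measure)
    have bound: "loc c (convolution (tail K M) (tail K N)) x \<le>
        C * loc c (convolution (tail K M) (tail K F)) x + loc c N K * loc c M (x - K)" for x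
    proof -
      have "loc c (convolution (tail K M) (tail K N)) x \<le> (\<integral>u. C * loc c (tail K F) (x - u) +
          loc c N K * indicator {x - K<..x - K + c} u \<partial>tail K M)"
        unfolding loc_convolution[OF tM tN] using ind
        by (intro integral_mono pointwise Bochner_Integration.integrable_add
            integrable_mult_right integrable_loc tM tN tF)
      also have "\<dots> = C * loc c (convolution (tail K M) (tail K F)) x +
          loc c N K * loc c (tail K M) (x - K)"
        using ind integrable_loc[OF tM tF] tM.M_is_borel finite_borel_measureD(3)[OF tM]
        by (subst Bochner_Integration.integral_add)
           (simp_all add: loc_convolution[OF tM tF], simp add: loc_def)
      also have "\<dots> \<le> C * loc c (convolution (tail K M) (tail K F)) x + loc c N K * loc c M (x - K)"
        by (intro add_left_mono mult_left_mono loc_tail_le MD loc_nonneg)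
      finally show ?thesis .
    qed
    have "\<forall>\<^sub>F x in at_top. loc c M (x - K) / f x < a + 1"
      using ratio_lim_shift[OF a] by (rule order_tendstoD) simp
    with elim(1) eventually_positive show ?case
    proof eventually_elim
      case (elim x)
      have "C * loc c (convolution (tail K M) (tail K F)) x \<le> C * (\<epsilon> / (2 * C) * f x)"
        using elim C by (intro mult_left_mono) auto
      also have "\<dots> = \<epsilon> / 2 * f x"
        using C by simp
      finally have 1: "C * loc c (convolution (tail K M) (tail K F)) x \<le> \<epsilon> / 2 * f x" .
      have "loc c N K * loc c M (x - K) \<le> (\<epsilon> / (2 * (a + 1))) * ((a + 1) * f x)"
        using elim \<open>loc c N K < _\<close> \<epsilon> a0 by (intro mult_mono) (auto simp: divide_less_eq)
      also have "\<dots> = \<epsilon> / 2 * f x"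
        using a0 by (simp add: field_simps)
      finally show ?case
        using 1 bound[of x] by (simp add: algebra_simps)
    qed
  qed
qed

lemma ratio_lim_trunc_convolution:
  assumes M: "nonneg_measure M" and N: "finite_borel_measure N" "ratio_lim N b"
  shows "ratio_lim (convolution (trunc K M) N) (measure (trunc K M) UNIV * b)"
proof (rule ratio_lim_convolution_bounded_support)
  have "{..K} \<inter> {K<..} = {}"
    by auto
  then show "measure (trunc K M) {K<..} = 0"
    by (simp add: measure_trunc nonneg_measureD[OF M])
qed (use assms in \<open>auto simp: nonneg_measure_trunc\<close>)

text \<open>
  The principle of a single big jump: if two large summands are negligible, one summand is
  large and the other one is of order 1 and only contributes its mass.
\<close>

lemma ratio_lim_convolution:
  assumes M: "nonneg_measure M" and N: "nonneg_measure N"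
    and MN: "negligible_tails M N"
    and a: "ratio_lim M a" and b: "ratio_lim N b"
  shows "ratio_lim (convolution M N) (a * measure N UNIV + b * measure M UNIV)"
  unfolding ratio_lim_def
proof (rule tendstoI)
  fix e :: real assume e: "0 < e"
  note MD = nonneg_measureD[OF M] and ND = nonneg_measureD[OF N]
  let ?L = "a * measure N UNIV + b * measure M UNIV"
  let ?T = "\<lambda>K. measure (trunc K M) UNIV * b + measure (trunc K N) UNIV * a"
  have "(?T \<longlongrightarrow> measure M UNIV * b + measure N UNIV * a) at_top"
    by (intro tendsto_intros trunc_mass_tendsto MD ND)
  then have "\<forall>\<^sub>F K in at_top. dist (?T K) (measure M UNIV * b + measure N UNIV * a) < e / 3"
    using e by (intro tendstoD) auto
  moreover have "\<forall>\<^sub>F K in at_top. \<forall>\<^sub>F x in at_top.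
      loc c (convolution (tail K M) (tail K N)) x \<le> (e / 3) * f x"
    by (rule MN[unfolded negligible_tails_def, rule_format]) (use e in simp)
  ultimately have "\<forall>\<^sub>F K in at_top. dist (?T K) (measure M UNIV * b + measure N UNIV * a) < e / 3 \<and>
      (\<forall>\<^sub>F x in at_top. loc c (convolution (tail K M) (tail K N)) x \<le> (e / 3) * f x)"
    by eventually_elim simp
  then obtain K where K: "dist (?T K) (measure M UNIV * b + measure N UNIV * a) < e / 3"
      "\<forall>\<^sub>F x in at_top. loc c (convolution (tail K M) (tail K N)) x \<le> (e / 3) * f x"
    using eventually_happens'[OF trivial_limit_at_top_linorder] by blast
  let ?g = "\<lambda>x. loc c (convolution (trunc K M) N) x / f x + loc c (convolution (trunc K N) M) x / f x"
  have "(?g \<longlongrightarrow> ?T K) at_top"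
    using ratio_lim_trunc_convolution[OF M ND(1) b, of K] ratio_lim_trunc_convolution[OF N MD(1) a, of K]
    unfolding ratio_lim_def by (rule tendsto_add)
  then have "\<forall>\<^sub>F x in at_top. dist (?g x) (?T K) < e / 3"
    using e by (intro tendstoD) auto
  then show "\<forall>\<^sub>F x in at_top. dist (loc c (convolution M N) x / f x) ?L < e"
    using K(2) eventually_positive eventually_ge_at_top[of "2 * K"]
  proof eventually_elim
    case (elim x)
    let ?J = "loc c (convolution (tail K M) (tail K N)) x / f x"
    have "loc c (convolution M N) x / f x = ?g x + ?J"
      using loc_convolution_split[OF MD(1) ND(1), of K x c] elim by (simp add: add_divide_distrib)
    moreover have "0 \<le> ?J" "?J \<le> e / 3"
      using elim by (auto simp: divide_le_eq)
    ultimately have "\<bar>loc c (convolution M N) x / f x - (measure M UNIV * b + measure N UNIV * a)\<bar> < e"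
      using elim(1) K(1) unfolding dist_real_def by linarith
    then show ?case
      by (simp add: dist_real_def mult.commute add.commute)
  qed
qed

section \<open>Convolution powers: lower bounds and the converse for mixtures\<close>

lemma FD: "finite_borel_measure F" "finite_measure F" "sets F = sets borel" "space F = UNIV"
  using F by (auto dest: nonneg_measureD)

lemma nonneg_measure_conv_power: "nonneg_measure (conv_power n F)"
proof (induction n)
  case 0
  then show ?case
    by (simp add: nonneg_measure_def finite_borel_measure_return measure_return)
next
  case (Suc n)
  then show ?case
    by (simp add: nonneg_measure_convolution F)
qed

lemma mass_conv_power: "measure (conv_power n F) UNIV = 1"
  by (simp add: measure_conv_power_UNIV FD F_mass)

lemma loc_conv_power_0: "0 \<le> x \<Longrightarrow> loc c (conv_power 0 F) x = 0"
  by (simp add: loc_def measure_return indicator_def)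

text \<open>
  Each of the \<open>n\<close> summands may be the large one.  The event that two of them are large is discarded,
  so that long-tailedness suffices.
\<close>

lemma conv_power_lower_bound:
  assumes "b < real n"
  shows "\<forall>\<^sub>F x in at_top. b * f x \<le> loc c (conv_power n F) x"
  using assms
proof (induction n arbitrary: b)
  case 0
  show ?case
    using eventually_ge_at_top[of 0]
  proof eventually_elim
    case (elim x)
    then show ?case
      using 0 by (simp add: loc_conv_power_0 mult_nonpos_nonneg del: conv_power.simps)
  qed
next
  case (Suc n)
  let ?G = "conv_power n F"
  define e where "e = (real (Suc n) - b) / 3"
  have e: "0 < e" "b = real n + 1 - 3 * e"
    using Suc.prems by (auto simp: e_def field_simps)
  have G: "nonneg_measure ?G" "finite_borel_measure ?G"
    by (rule nonneg_measure_conv_power finite_borel_measure_conv_power[OF FD(1)])+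
  have "((\<lambda>K. measure (trunc K F) UNIV * (real n - e)) \<longlongrightarrow> measure F UNIV * (real n - e)) at_top"
    by (intro tendsto_intros trunc_mass_tendsto FD)
  then have "\<forall>\<^sub>F K in at_top. measure (trunc K F) UNIV * (real n - e) > real n - e - e / 2"
    using e by (intro order_tendstoD) (auto simp: F_mass)
  moreover have "\<forall>\<^sub>F K in at_top. measure (trunc K ?G) UNIV > 1 - e / 2"
    using trunc_mass_tendsto[OF G(2)] e by (intro order_tendstoD) (auto simp: mass_conv_power)
  ultimately have "\<forall>\<^sub>F K in at_top. measure (trunc K F) UNIV * (real n - e) > real n - e - e / 2 \<and>
      measure (trunc K ?G) UNIV > 1 - e / 2"
    by eventually_elim simp
  then obtain K where K: "measure (trunc K F) UNIV * (real n - e) > real n - e - e / 2"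
      "measure (trunc K ?G) UNIV > 1 - e / 2"
    using eventually_happens'[OF trivial_limit_at_top_linorder] by blast
  have "\<forall>\<^sub>F x in at_top. (real n - e) * f x \<le> loc c ?G x"
    using e by (intro Suc.IH) auto
  then obtain y0 where y0: "\<And>y. y0 \<le> y \<Longrightarrow> (real n - e) * f y \<le> loc c ?G y"
    by (auto simp: eventually_at_top_linorder)
  note tF = finite_borel_measure_trunc[OF FD(1), of K]
  have 1: "((\<lambda>x. (real n - e) * (loc c (convolution (trunc K F) F) x / f x) +
        loc c (convolution (trunc K ?G) F) x / f x) \<longlongrightarrow>
      (real n - e) * (measure (trunc K F) UNIV * 1) + measure (trunc K ?G) UNIV * 1) at_top"
    using ratio_lim_trunc_convolution[OF F FD(1) ratio_lim_self, of K]
      ratio_lim_trunc_convolution[OF G(1) FD(1) ratio_lim_self, of K]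
    unfolding ratio_lim_def by (intro tendsto_intros)
  have "(real n - e) * (measure (trunc K F) UNIV * 1) + measure (trunc K ?G) UNIV * 1 > b"
    using K e by (simp add: algebra_simps)
  from order_tendstoD(1)[OF 1 this] eventually_positive eventually_ge_at_top[of "y0 + K"]
    eventually_ge_at_top[of "2 * K"]
  show ?case
  proof eventually_elim
    case (elim x)
    have "(real n - e) * loc c (convolution (trunc K F) F) x =
        (\<integral>u. (real n - e) * f (x - u) \<partial>trunc K F)"
      by (simp add: loc_convolution[OF tF FD(1)])
    also have "\<dots> \<le> (\<integral>u. loc c ?G (x - u) \<partial>trunc K F)"
    proof (rule integral_mono_AE)
      show "AE u in trunc K F. (real n - e) * f (x - u) \<le> loc c ?G (x - u)"
        using AE_trunc[OF FD(1), of K]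
      proof eventually_elim
        case (elim u)
        then show ?case
          using \<open>y0 + K \<le> x\<close> by (intro y0) linarith
      qed
    qed (auto intro!: integrable_mult_right integrable_loc tF FD G)
    also have "\<dots> = loc c (convolution (trunc K F) ?G) x"
      by (rule loc_convolution[OF tF G(2), symmetric])
    finally have 2: "(real n - e) * loc c (convolution (trunc K F) F) x \<le>
        loc c (convolution (trunc K F) ?G) x" .
    have "b * f x < (real n - e) * loc c (convolution (trunc K F) F) x +
        loc c (convolution (trunc K ?G) F) x"
      using elim by (simp add: add_divide_distrib[symmetric] less_divide_eq)
    also have "\<dots> \<le> loc c (convolution F ?G) x"
      using 2 loc_convolution_split[OF FD(1) G(2) elim(4), of c]
        loc_nonneg[of c "convolution (tail K F) (tail K ?G)" x] by linarith
    finally show ?case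
      by simp
  qed
qed

text \<open>
  The \<open>n\<close>-th term contributes asymptotically at least \<open>n * a n\<close> times \<open>f\<close>.  As the total equals the sum
  of these lower bounds, no term can exceed its own; the term \<open>n = 2\<close> is the one of interest.
\<close>

lemma ratio_lim_mixture_imp_square:
  assumes a: "\<And>n. 0 \<le> a n" "0 < a 2" and summ: "summable (\<lambda>n. real n * a n)" "summable a"
    and lim: "ratio_lim (mixture a (\<lambda>n. conv_power n F)) (\<Sum>n. real n * a n)"
  shows "ratio_lim (convolution F F) 2"
proof -
  let ?\<Phi> = "mixture a (\<lambda>n. conv_power n F)" and ?m = "\<Sum>n. real n * a n"
  let ?h = "\<lambda>n x. loc c (conv_power n F) x"
  have summ': "summable (\<lambda>n. a n * measure (conv_power n F) UNIV)"
    using summ by (simp add: mass_conv_power)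
  have sums: "(\<lambda>n. a n * ?h n x) sums loc c ?\<Phi> x" for x
    unfolding loc_def using a(1) summ' finite_borel_measure_conv_power[OF FD(1)]
    by (intro measure_mixture_sums) auto
  have sq: "conv_power 2 F = convolution F F"
  proof -
    have "convolution F (return borel 0) = F"
      by (intro finite_borel_measure_eqI_char)
         (simp_all add: finite_borel_measure_convolution FD finite_borel_measure_return
           char_convolution, simp add: char_def integral_return)
    then show ?thesis
      by (simp add: numeral_2_eq_2)
  qed
  have upper: "\<forall>\<^sub>F x in at_top. ?h 2 x \<le> (2 + e) * f x" if e: "0 < e" for e
  proof -
    \<comment> \<open>The total, the cut-off of the series and the lower bounds of the other terms each cost an
      error \<open>d\<close>; \<open>A\<close> bounds the sum of the weights over which the last error is distributed.\<close>
    define d where "d = e * a 2 / 4"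
    have d: "0 < d"
      using e a by (simp add: d_def)
    have "(\<lambda>N. \<Sum>n<N. real n * a n) \<longlonglongrightarrow> ?m"
      using summ by (simp add: summable_LIMSEQ)
    then have "\<forall>\<^sub>F N in sequentially. (\<Sum>n<N. real n * a n) > ?m - d"
      using d by (intro order_tendstoD) auto
    then have "\<forall>\<^sub>F N in sequentially. (\<Sum>n<N. real n * a n) > ?m - d \<and> 3 \<le> N"
      using eventually_ge_at_top[of "3 :: nat"] by eventually_elim simp
    then obtain N where N: "(\<Sum>n<N. real n * a n) > ?m - d" "3 \<le> N"
      using eventually_happens'[OF trivial_limit_sequentially] by blast
    define A where "A = (\<Sum>n\<in>{..<N} - {2}. a n) + 1"
    have A: "0 < A"
      using a(1) by (simp add: A_def add_nonneg_pos sum_nonneg)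
    have "\<forall>\<^sub>F x in at_top. \<forall>n\<in>{..<N} - {2}. (real n - d / A) * f x \<le> ?h n x"
      using d A by (intro eventually_ball_finite ballI conv_power_lower_bound) auto
    moreover have "\<forall>\<^sub>F x in at_top. loc c ?\<Phi> x \<le> (?m + d) * f x"
      using lim d by (intro ratio_limD_le) auto
    ultimately show ?thesis
      using eventually_positive
    proof eventually_elim
      case (elim x)
      have "(\<Sum>n<N. a n * ?h n x) \<le> loc c ?\<Phi> x"
        unfolding sums_unique[OF sums[of x]] using a(1)
        by (intro sum_le_suminf sums_summable[OF sums[of x]]) auto
      moreover have "(\<Sum>n<N. a n * ?h n x) = a 2 * ?h 2 x + (\<Sum>n\<in>{..<N} - {2}. a n * ?h n x)"
        using N(2) by (subst sum.remove[of _ 2]) auto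
      moreover have "(\<Sum>n\<in>{..<N} - {2}. a n * ((real n - d / A) * f x)) \<le>
          (\<Sum>n\<in>{..<N} - {2}. a n * ?h n x)"
        using elim a(1) by (intro sum_mono mult_left_mono) auto
      moreover have "(\<Sum>n\<in>{..<N} - {2}. a n * ((real n - d / A) * f x)) =
          ((\<Sum>n<N. real n * a n) - 2 * a 2 - d / A * (A - 1)) * f x"
      proof -
        have "(\<Sum>n<N. real n * a n) = 2 * a 2 + (\<Sum>n\<in>{..<N} - {2}. real n * a n)"
          using N(2) by (subst sum.remove[of _ 2]) auto
        then show ?thesis
          by (simp add: A_def sum_subtractf sum_distrib_left sum_distrib_right sum_divide_distrib algebra_simps)
      qed
      ultimately have "a 2 * ?h 2 x + ((\<Sum>n<N. real n * a n) - 2 * a 2 - d / A * (A - 1)) * f x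
          \<le> (?m + d) * f x"
        using elim by linarith
      moreover have "((\<Sum>n<N. real n * a n) - 2 * a 2 - d / A * (A - 1)) * f x \<ge> (?m - d - 2 * a 2 - d) * f x"
      proof (intro mult_right_mono)
        have "d / A * (A - 1) \<le> d"
          using d A by (simp add: field_simps)
        then show "?m - d - 2 * a 2 - d \<le> (\<Sum>n<N. real n * a n) - 2 * a 2 - d / A * (A - 1)"
          using N(1) by linarith
      qed (use elim(3) in simp)
      ultimately have "a 2 * ?h 2 x \<le> (2 * a 2 + 3 * d) * f x"
        by (simp add: algebra_simps)
      also have "\<dots> \<le> a 2 * ((2 + e) * f x)"
        using e a elim(3) by (simp add: d_def algebra_simps)
      finally show ?case
        using a(2) by simp
    qed
  qed
  show ?thesis
    unfolding ratio_lim_def sq[symmetric]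
  proof (rule tendstoI)
    fix e :: real assume e: "0 < e"
    have "\<forall>\<^sub>F x in at_top. (2 - e / 2) * f x \<le> ?h 2 x"
      using e by (intro conv_power_lower_bound) auto
    with upper[OF half_gt_zero[OF e]] eventually_positive
    show "\<forall>\<^sub>F x in at_top. dist (?h 2 x / f x) 2 < e"
    proof eventually_elim
      case (elim x)
      then have "2 - e / 2 \<le> ?h 2 x / f x" "?h 2 x / f x \<le> 2 + e / 2"
        by (simp_all add: divide_le_eq le_divide_eq)
      then show ?case
        using e unfolding dist_real_def by linarith
    qed
  qed
qed

end

section \<open>Local subexponentiality\<close>

locale local_subexponential = local_long_tail +
  assumes square: "ratio_lim (convolution F F) 2"
begin

text \<open>
  By \<open>square\<close> the whole convolution has ratio 2, and the part with a bounded summand has ratio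
  \<open>F {..K}\<close>.
\<close>

lemma tail_convolution_ratio:
  "((\<lambda>x. loc c (convolution F (tail K F)) x / f x) \<longlongrightarrow> 1 + measure F {K<..}) at_top"
proof -
  have "((\<lambda>x. loc c (convolution F F) x / f x - loc c (convolution (trunc K F) F) x / f x)
      \<longlongrightarrow> 2 - measure (trunc K F) UNIV * 1) at_top"
    using ratio_lim_trunc_convolution[OF F FD(1) ratio_lim_self] square
    unfolding ratio_lim_def by (intro tendsto_diff)
  moreover have "loc c (convolution F (tail K F)) x =
      loc c (convolution F F) x - loc c (convolution (trunc K F) F) x" for x
    using loc_convolution_trunc_tail[OF FD(1) FD(1), where c = c and K = K and x = x]
    by (simp add: convolution_commute FD finite_borel_measure_tail)
  ultimately show ?thesis
    by (simp add: measure_trunc_UNIV FD F_mass diff_divide_distrib)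
qed

lemma negligible_tails_self: "negligible_tails F F"
  unfolding negligible_tails_def
proof (intro allI impI)
  fix e :: real assume e: "0 < e"
  have "\<forall>\<^sub>F K in at_top. measure F {K<..} < e / 2"
    using tail_mass_tendsto_0[OF FD(1)] e by (intro order_tendstoD) auto
  then show "\<forall>\<^sub>F K in at_top. \<forall>\<^sub>F x in at_top. loc c (convolution (tail K F) (tail K F)) x \<le> e * f x"
  proof eventually_elim
    case (elim K)
    have "((\<lambda>x. loc c (convolution F (tail K F)) x / f x - loc c (convolution (trunc K F) F) x / f x)
        \<longlongrightarrow> 1 + measure F {K<..} - measure (trunc K F) UNIV * 1) at_top"
      using ratio_lim_trunc_convolution[OF F FD(1) ratio_lim_self] tail_convolution_ratio
      unfolding ratio_lim_def by (intro tendsto_diff)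
    moreover have "1 + measure F {K<..} - measure (trunc K F) UNIV * 1 < e"
      using elim by (simp add: measure_trunc_UNIV FD F_mass)
    ultimately have "\<forall>\<^sub>F x in at_top. loc c (convolution F (tail K F)) x / f x -
        loc c (convolution (trunc K F) F) x / f x < e"
      by (rule order_tendstoD)
    with eventually_positive eventually_ge_at_top[of "2 * K"] show ?case
    proof eventually_elim
      case (elim x)
      have "loc c (convolution F (tail K F)) x = loc c (convolution F F) x - loc c (convolution (trunc K F) F) x"
        using loc_convolution_trunc_tail[OF FD(1) FD(1), where c = c and K = K and x = x]
        by (simp add: convolution_commute FD finite_borel_measure_tail)
      then have "loc c (convolution (tail K F) (tail K F)) x =
          loc c (convolution F (tail K F)) x - loc c (convolution (trunc K F) F) x"
        using loc_convolution_split[OF FD(1) FD(1), of K x c] elim by simp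
      then show ?case
        using elim by (simp add: diff_divide_distrib[symmetric] divide_less_eq)
    qed
  qed
qed

lemma ratio_lim_conv:
  assumes M: "nonneg_measure M" "ratio_lim M a" and N: "nonneg_measure N" "ratio_lim N b"
  shows "ratio_lim (convolution M N) (a * measure N UNIV + b * measure M UNIV)"
proof -
  have "negligible_tails F M"
    using F M(1) negligible_tails_self ratio_lim_self M(2) by (rule negligible_tails_transfer)
  then have "negligible_tails M F"
    by (rule negligible_tails_commute[rotated 2]) (auto intro: nonneg_measureD(1)[OF M(1)] simp: FD)
  with M(1) N(1) have "negligible_tails M N"
    by (rule negligible_tails_transfer) (fact M N)+
  then show ?thesis
    by (rule ratio_lim_convolution[OF M(1) N(1) _ M(2) N(2)])
qed

lemma ratio_lim_return: "ratio_lim (return borel 0) 0"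
  unfolding ratio_lim_def
proof (rule tendsto_eventually)
  show "\<forall>\<^sub>F x in at_top. loc c (return borel 0) x / f x = 0"
    using eventually_ge_at_top[of 0] by eventually_elim (simp add: loc_def measure_return indicator_def)
qed

lemma ratio_lim_conv_power: "ratio_lim (conv_power n F) (real n)"
proof (induction n)
  case 0
  then show ?case
    by (simp add: ratio_lim_return)
next
  case (Suc n)
  then have "ratio_lim (convolution F (conv_power n F)) (1 * measure (conv_power n F) UNIV + real n * measure F UNIV)"
    by (intro ratio_lim_conv F ratio_lim_self nonneg_measure_conv_power)
  then show ?case
    by (simp add: mass_conv_power F_mass add.commute)
qed

text \<open>
  Induction on \<open>n\<close>, conditioning on the first summand \<open>u\<close>.  If \<open>u \<le> x - K\<close>, the induction hypothesis
  applies at \<open>x - u \<ge> K\<close> and costs the factor \<open>1 + e\<close> by \<open>tail_convolution_ratio\<close>.  If \<open>u > x - K\<close>, then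
  \<open>u\<close> lies in a window of length \<open>K + c\<close>, which costs an additive term \<open>C * f x\<close> not depending on \<open>n\<close>.
  The growth rate \<open>1 + 2 e\<close> absorbs this term.
\<close>

lemma kesten_bound:
  assumes z: "1 < z"
  obtains D x0 where "0 < D" "\<And>n x. x0 \<le> x \<Longrightarrow> loc c (conv_power n F) x \<le> D * z ^ n * f x"
proof -
  define e where "e = (z - 1) / 2"
  have e: "0 < e" "z = 1 + 2 * e"
    using z by (auto simp: e_def field_simps)
  obtain N where N: "0 \<le> N" "\<And>x. N \<le> x \<Longrightarrow> 0 < f x" "\<And>b. \<exists>\<delta>>0. \<forall>x\<in>{N..b}. \<delta> \<le> f x"
    using locally_bounded_below by blast
  have "\<forall>\<^sub>F K in at_top. measure F {K<..} < e"
    using tail_mass_tendsto_0[OF FD(1)] e by (intro order_tendstoD) auto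
  then have "\<forall>\<^sub>F K in at_top. measure F {K<..} < e \<and> N \<le> K"
    using eventually_ge_at_top[of N] by eventually_elim simp
  then obtain K where K: "measure F {K<..} < e" "N \<le> K"
    using eventually_happens'[OF trivial_limit_at_top_linorder] by blast
  obtain C where C: "0 < C" "\<forall>\<^sub>F x in at_top. measure F {x - K<..x + c} \<le> C * f x"
    by (rule long_window_bound)
  have "\<forall>\<^sub>F x in at_top. loc c (convolution F (tail K F)) x / f x < 1 + e"
    using tail_convolution_ratio K(1) by (intro order_tendstoD) auto
  with eventually_positive have "\<forall>\<^sub>F x in at_top. loc c (convolution F (tail K F)) x \<le> (1 + e) * f x"
    by eventually_elim (simp add: divide_less_eq)
  with C(2) have "\<forall>\<^sub>F x in at_top. loc c (convolution F (tail K F)) x \<le> (1 + e) * f x \<and>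
      measure F {x - K<..x + c} \<le> C * f x"
    by eventually_elim simp
  then obtain x1 where x1: "\<And>x. x1 \<le> x \<Longrightarrow> loc c (convolution F (tail K F)) x \<le> (1 + e) * f x"
      "\<And>x. x1 \<le> x \<Longrightarrow> measure F {x - K<..x + c} \<le> C * f x"
    unfolding eventually_at_top_linorder by blast
  obtain \<delta> where \<delta>: "0 < \<delta>" "\<And>x. x \<in> {N..x1} \<Longrightarrow> \<delta> \<le> f x"
    using N(3)[of x1] by blast
  define D where "D = max (C / e) (1 / \<delta>)"
  have D: "0 < D" "C \<le> D * e" "1 \<le> D * \<delta>"
    using C(1) \<delta>(1) e by (auto simp: D_def max_def field_simps)
  interpret F: finite_borel_measure F by (rule FD)
  have "loc c (conv_power n F) x \<le> D * z ^ n * f x" if "K \<le> x" for n x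
    using that
  proof (induction n arbitrary: x)
    case 0
    have "loc c (conv_power 0 F) x = 0"
      using 0 K(2) N(1) by (intro loc_conv_power_0) linarith
    then show ?case
      using D(1) by (simp del: conv_power.simps)
  next
    case (Suc n)
    let ?G = "conv_power n F"
    note G = finite_borel_measure_conv_power[OF FD(1), of n]
    have zn: "1 \<le> z ^ n" "1 \<le> z ^ Suc n"
      using z by (auto intro!: one_le_power simp del: power_Suc)
    show ?case
    proof (cases "x1 \<le> x")
      case False
      have "loc c (conv_power (Suc n) F) x \<le> 1"
        using loc_le_mass[OF finite_borel_measure_conv_power[OF FD(1)]] mass_conv_power by metis
      also have "1 \<le> D * f x"
      proof -
        have "D * \<delta> \<le> D * f x"
          using D(1) \<delta>(2)[of x] False Suc.prems K(2) by (intro mult_left_mono) auto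
        then show ?thesis
          using D(3) by linarith
      qed
      also have "\<dots> \<le> z ^ Suc n * (D * f x)"
        using zn(2) D(1) mult_right_mono[of 1 "z ^ Suc n" "D * f x"] by simp
      finally show ?thesis
        by (simp add: mult_ac)
    next
      case True
      have "loc c ?G (x - u) \<le> D * z ^ n * loc c (tail K F) (x - u) + indicator {x - K<..x + c} u" for u
      proof (cases "u \<le> x - K")
        case True
        then have "loc c ?G (x - u) \<le> D * z ^ n * loc c (tail K F) (x - u)"
          using Suc.IH[of "x - u"] by (simp add: loc_tail_eq FD)
        then show ?thesis
          by (simp add: add_increasing2)
      next
        case no: False
        show ?thesis
        proof (cases "u \<le> x + c")
          case True
          have "loc c ?G (x - u) \<le> 1"
            using loc_le_mass[OF G] mass_conv_power by metis
          then show ?thesis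
            using no True D(1) zn(1) by (simp add: add_increasing)
        next
          case False
          have "measure ?G {x - u<..x - u + c} \<le> measure ?G {..<0}"
            using False finite_borel_measureD[OF G]
            by (intro finite_measure.finite_measure_mono) auto
          then have "loc c ?G (x - u) \<le> 0"
            using nonneg_measureD(5)[OF nonneg_measure_conv_power[of n]] by (simp add: loc_def)
          then show ?thesis
            using D(1) zn(1) by (intro order_trans[OF \<open>loc c ?G (x - u) \<le> 0\<close>] add_nonneg_nonneg) auto
        qed
      qed
      moreover have ind: "integrable F (indicator {x - K<..x + c} :: real \<Rightarrow> real)"
        by (intro integrable_real_indicator) (auto simp: F.emeasure_eq_measure F.M_is_borel)
      ultimately have "loc c (conv_power (Suc n) F) x \<le>
          (\<integral>u. D * z ^ n * loc c (tail K F) (x - u) + indicator {x - K<..x + c} u \<partial>F)"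
        unfolding conv_power.simps loc_convolution[OF FD(1) G]
        by (intro integral_mono Bochner_Integration.integrable_add integrable_mult_right
            integrable_loc FD G finite_borel_measure_tail)
      also have "\<dots> = D * z ^ n * loc c (convolution F (tail K F)) x + measure F {x - K<..x + c}"
        using ind integrable_loc[OF FD(1) finite_borel_measure_tail[OF FD(1)]]
        by (subst Bochner_Integration.integral_add)
           (simp_all add: loc_convolution FD finite_borel_measure_tail)
      also have "\<dots> \<le> D * z ^ n * ((1 + e) * f x) + C * f x"
        using x1 True D(1) zn(1) by (intro add_mono mult_left_mono) auto
      also have "C * f x \<le> D * z ^ n * (e * f x)"
      proof -
        have "C * f x \<le> D * e * f x"
          using D(2) by (intro mult_right_mono) auto
        also have "\<dots> \<le> z ^ n * (D * e * f x)"
          using zn(1) D(1) e(1) mult_right_mono[of 1 "z ^ n" "D * e * f x"] by simp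
        finally show ?thesis
          by (simp add: mult_ac)
      qed
      finally show ?thesis
        by (simp add: e(2) algebra_simps)
    qed
  qed
  with D(1) show ?thesis
    by (rule that)
qed

text \<open>
  The terms converge one by one, and Kesten's bound is the majorant for Tannery's theorem.
\<close>

lemma ratio_lim_mixture:
  assumes a: "\<And>n. 0 \<le> a n" and z: "1 < z" "summable (\<lambda>n. a n * z ^ n)"
  shows "ratio_lim (mixture a (\<lambda>n. conv_power n F)) (\<Sum>n. real n * a n)"
proof -
  let ?\<Phi> = "mixture a (\<lambda>n. conv_power n F)"
  have le: "a n \<le> a n * z ^ n" for n
    using mult_left_mono[OF one_le_power[of z n] a[of n]] z by simp
  have "summable a"
    by (rule summable_comparison_test'[OF z(2), of 0]) (use a le in auto)
  then have summ': "summable (\<lambda>n. a n * measure (conv_power n F) UNIV)"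
    by (simp add: mass_conv_power)
  have sums: "(\<lambda>n. a n * loc c (conv_power n F) x) sums loc c ?\<Phi> x" for x
    unfolding loc_def using a summ' finite_borel_measure_conv_power[OF FD(1)]
    by (intro measure_mixture_sums) auto
  obtain D x0 where D: "0 < D" "\<And>n x. x0 \<le> x \<Longrightarrow> loc c (conv_power n F) x \<le> D * z ^ n * f x"
    using kesten_bound[OF z(1)] by blast
  have "((\<lambda>x. \<Sum>n. a n * (loc c (conv_power n F) x / f x)) \<longlongrightarrow> (\<Sum>n. a n * real n)) at_top"
  proof (rule tannerys_theorem[THEN conjunct2, THEN conjunct2])
    show "((\<lambda>x. a n * (loc c (conv_power n F) x / f x)) \<longlongrightarrow> a n * real n) at_top" for n
      using ratio_lim_conv_power[of n] unfolding ratio_lim_def by (intro tendsto_intros)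
    show "summable (\<lambda>n. D * (a n * z ^ n))"
      using z(2) by (rule summable_mult)
    have "\<forall>\<^sub>F x in at_top. \<forall>n. norm (a n * (loc c (conv_power n F) x / f x)) \<le> D * (a n * z ^ n)"
      using eventually_ge_at_top[of x0] eventually_positive
    proof eventually_elim
      case (elim x)
      show ?case
      proof
        fix n
        have "loc c (conv_power n F) x / f x \<le> D * z ^ n"
          using D(2)[OF elim(1), of n] elim(2) by (simp add: divide_le_eq)
        then have "a n * (loc c (conv_power n F) x / f x) \<le> a n * (D * z ^ n)"
          using a by (rule mult_left_mono)
        then show "norm (a n * (loc c (conv_power n F) x / f x)) \<le> D * (a n * z ^ n)"
          using a by (simp add: mult_ac)
      qed
    qed
    then show "\<forall>\<^sub>F (n, x) in at_top \<times>\<^sub>F at_top. norm (a n * (loc c (conv_power n F) x / f x)) \<le> D * (a n * z ^ n)"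
      unfolding eventually_prod_filter
      by (intro exI[of _ "\<lambda>_. True"] exI[of _ "\<lambda>x. \<forall>n. norm (a n * (loc c (conv_power n F) x / f x)) \<le> D * (a n * z ^ n)"]) auto
  qed simp
  moreover have "(\<Sum>n. a n * (loc c (conv_power n F) x / f x)) = loc c ?\<Phi> x / f x" for x
    using sums_divide[OF sums[of x], of "f x"] by (simp add: sums_iff)
  ultimately show ?thesis
    by (simp add: ratio_lim_def mult.commute)
qed


section \<open>Inverting a geometric compound\<close>

text \<open>
  Cut \<open>L = S + T\<close> at a level \<open>K\<close> so high that \<open>\<rho> = T * F / q\<close>, with \<open>q = 1 - p\<close>, has mass \<open>r < 1\<close>.  The
  relation \<open>F * (\<delta>\<^sub>0 - L) = q \<delta>\<^sub>0\<close> becomes \<open>T * (\<delta>\<^sub>0 + \<rho>) = \<rho> * (\<delta>\<^sub>0 - S)\<close>.  As \<open>S\<close> has bounded support,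
  the right-hand side has known window asymptotics, and the Neumann series of \<open>\<delta>\<^sub>0 + \<rho>\<close> solves for \<open>T\<close>.
  
  The series is run by hand.  Let \<open>A n\<close> be the window mass of \<open>T * \<rho>\<^sup>n\<close>.  The relation gives the
  limit of \<open>(A n + A (n + 1)) / f\<close>, and also \<open>A n \<le> loc c (\<rho>\<^sup>n\<^sup>+\<^sup>1)\<close>, which is asymptotically
  \<open>(n + 1) r\<^sup>n (1 + r)\<close> times \<open>f\<close> and hence small for large \<open>n\<close>.  So the deviation \<open>d n\<close> of \<open>A n / f\<close> from
  its expected limit alternates in sign along \<open>n\<close> up to vanishing errors, and is small for large
  \<open>n\<close>; therefore \<open>d 0\<close> tends to 0.
\<close>

lemma ratio_lim_geometric_root:
  assumes L: "nonneg_measure L" and p: "p = measure L UNIV" "p < 1"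
    and geom: "\<And>t. char F t * (1 - char L t) = complex_of_real (1 - p)"
  shows "ratio_lim L (1 - p)"
proof -
  note LD = nonneg_measureD[OF L]
  have "\<forall>\<^sub>F K in at_top. measure L {K<..} < 1 - p"
    using tail_mass_tendsto_0[OF LD(1)] p by (intro order_tendstoD) auto
  then obtain K where K: "measure L {K<..} < 1 - p"
    using eventually_happens'[OF trivial_limit_at_top_linorder] by blast
  define q where "q = 1 - p"
  have q: "0 < q"
    using p by (simp add: q_def)
  let ?S = "trunc K L" and ?T = "tail K L"
  have S: "nonneg_measure ?S" "finite_borel_measure ?S" and T: "nonneg_measure ?T" "finite_borel_measure ?T"
    by (simp_all add: nonneg_measure_trunc L finite_borel_measure_trunc finite_borel_measure_tail LD)
  define \<rho> where "\<rho> = scale_measure (ennreal (1 / q)) (convolution ?T F)"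
  have TF: "finite_borel_measure (convolution ?T F)"
    by (intro finite_borel_measure_convolution T FD)
  have \<rho>_fbm: "finite_borel_measure \<rho>"
    unfolding \<rho>_def using TF by (rule finite_borel_measure_scale)
  have \<rho>_meas: "measure \<rho> A = measure (convolution ?T F) A / q" for A
    using q by (simp add: \<rho>_def)
  have \<rho>_char: "char \<rho> t = char ?T t * char F t / q" for t
    using q by (simp add: \<rho>_def char_scale TF char_convolution T FD)
  have \<rho>: "nonneg_measure \<rho>"
    using \<rho>_fbm nonneg_measure_convolution[OF T(1) F] \<rho>_meas[of "{..<0}"]
    by (simp add: nonneg_measure_def)
  define r where "r = measure \<rho> UNIV"
  have r: "r = measure L {K<..} / q" "0 \<le> r" "r < 1"
    using K q by (simp_all add: r_def \<rho>_meas measure_convolution_UNIV T FD F_mass measure_tail_UNIV LD q_def)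
  have mT: "measure ?T UNIV = q * r" and mS: "measure ?S UNIV = 1 - q * (1 + r)"
    using r(1) q by (simp_all add: measure_tail_UNIV measure_trunc_UNIV LD p(1)[symmetric] distrib_left)
      (simp add: q_def)
  note fb = S(2) T(2) \<rho>_fbm FD(1) finite_borel_measure_return
  \<comment> \<open>The window masses of \<open>\<rho>\<close> are found from \<open>q \<rho> + q \<delta>\<^sub>0 + S * F = F\<close>.\<close>
  have "ratio_lim \<rho> (1 + r)"
  proof -
    let ?xs = "[(q, \<rho>), (q, return borel 0), (1, convolution ?S F), (- 1, F)]"
    have char0: "char (return borel (0::real)) t = 1" for t
      by (simp add: char_def integral_return)
    have "\<forall>t. (\<Sum>(r, M)\<leftarrow>?xs. complex_of_real r * char M t) = 0"
    proof
      fix t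
      have "char F t * (1 - char ?S t - char ?T t) = q"
        using geom[of t] char_trunc_tail[OF LD(1), of t K] by (simp add: q_def diff_diff_eq)
      then show "(\<Sum>(r, M)\<leftarrow>?xs. complex_of_real r * char M t) = 0"
        using q by (simp add: \<rho>_char char_convolution fb char0 algebra_simps)
    qed
    then have "\<forall>A\<in>sets borel. (\<Sum>(r, M)\<leftarrow>?xs. r * measure M A) = 0"
      by (subst (asm) lin_comb_char_iff) (auto simp: fb finite_borel_measure_convolution)
    then have eq: "loc c \<rho> x = (loc c F x - q * loc c (return borel 0) x - loc c (convolution ?S F) x) / q" for x
      using q by (simp add: loc_def field_simps)
    have "((\<lambda>x. (loc c F x / f x - q * (loc c (return borel 0) x / f x) - loc c (convolution ?S F) x / f x) / q)
        \<longlongrightarrow> (1 - q * 0 - measure ?S UNIV * 1) / q) at_top"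
      using ratio_lim_self ratio_lim_return ratio_lim_trunc_convolution[OF L FD(1) ratio_lim_self, of K] q
      unfolding ratio_lim_def by (intro tendsto_intros) auto
    moreover have "(1 - q * 0 - measure ?S UNIV * 1) / q = 1 + r"
      using q by (simp add: mS)
    moreover have "(loc c F x / f x - q * (loc c (return borel 0) x / f x) - loc c (convolution ?S F) x / f x) / q
        = loc c \<rho> x / f x" for x
      unfolding eq by (simp only: times_divide_eq_right diff_divide_distrib[symmetric]
          divide_divide_eq_left mult.commute)
    ultimately show ?thesis
      by (simp only: ratio_lim_def)
  qed
  define R where "R n = conv_power n \<rho>" for n
  have R: "nonneg_measure (R n)" "finite_borel_measure (R n)" "measure (R n) UNIV = r ^ n"
      "ratio_lim (R n) (real n * r ^ (n - 1) * (1 + r))" for n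
  proof -
    have "nonneg_measure (R n) \<and> measure (R n) UNIV = r ^ n \<and> ratio_lim (R n) (real n * r ^ (n - 1) * (1 + r))"
    proof (induction n)
      case 0
      then show ?case
        by (simp add: R_def nonneg_measure_def finite_borel_measure_return measure_return ratio_lim_return)
    next
      case (Suc n)
      then have "ratio_lim (convolution \<rho> (R n)) ((1 + r) * measure (R n) UNIV +
          real n * r ^ (n - 1) * (1 + r) * measure \<rho> UNIV)"
        by (intro ratio_lim_conv \<rho> \<open>ratio_lim \<rho> (1 + r)\<close>) auto
      moreover have "(1 + r) * r ^ n + real n * r ^ (n - 1) * (1 + r) * r = (real n + 1) * r ^ n * (1 + r)"
        by (cases n) (simp_all add: algebra_simps)
      ultimately show ?case
        using Suc \<rho> by (simp add: R_def nonneg_measure_convolution measure_convolution_UNIV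
            nonneg_measureD r_def[symmetric] add.commute)
    qed
    then show "nonneg_measure (R n)" "measure (R n) UNIV = r ^ n"
        "ratio_lim (R n) (real n * r ^ (n - 1) * (1 + r))"
      by auto
    then show "finite_borel_measure (R n)"
      by (intro nonneg_measureD)
  qed
  have R_char: "char (R n) t = char \<rho> t ^ n" for n t
    by (simp add: R_def char_conv_power \<rho>_fbm)
  define A where "A n x = loc c (convolution ?T (R n)) x" for n x
  have A_rec: "A n x + A (Suc n) x = loc c (R (Suc n)) x - loc c (convolution ?S (R (Suc n))) x" for n x
  proof -
    let ?xs = "[(1, convolution ?T (R n)), (1, convolution ?T (R (Suc n))),
      (1, convolution ?S (R (Suc n))), (- 1, R (Suc n))]"
    have "\<forall>t. (\<Sum>(r, M)\<leftarrow>?xs. complex_of_real r * char M t) = 0"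
    proof
      fix t
      have "char F t * (1 - char ?S t - char ?T t) = q"
        using geom[of t] char_trunc_tail[OF LD(1), of t K] by (simp add: q_def diff_diff_eq)
      moreover have "char \<rho> t * (1 - char ?S t - char ?T t) =
          char ?T t * (char F t * (1 - char ?S t - char ?T t)) / q"
        by (simp add: \<rho>_char)
      ultimately have "char \<rho> t * (1 - char ?S t - char ?T t) = char ?T t"
        using q by simp
      then have "char \<rho> t ^ n * (char \<rho> t * (1 - char ?S t - char ?T t)) = char \<rho> t ^ n * char ?T t"
        by (rule arg_cong)
      moreover have "(\<Sum>(r, M)\<leftarrow>?xs. complex_of_real r * char M t) =
          char \<rho> t ^ n * char ?T t - char \<rho> t ^ n * (char \<rho> t * (1 - char ?S t - char ?T t))"
        by (simp add: char_convolution fb R R_char algebra_simps)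
      ultimately show "(\<Sum>(r, M)\<leftarrow>?xs. complex_of_real r * char M t) = 0"
        by (simp only: diff_self)
    qed
    then have "\<forall>A\<in>sets borel. (\<Sum>(r, M)\<leftarrow>?xs. r * measure M A) = 0"
      by (subst (asm) lin_comb_char_iff) (auto simp: fb R finite_borel_measure_convolution)
    then show ?thesis
      by (simp add: A_def loc_def algebra_simps)
  qed
  \<comment> \<open>The limit of \<open>A n / f\<close> to be expected if \<open>A 0 / f\<close> has the limit \<open>q\<close>: the product rule for the
    window masses of \<open>T * \<rho>\<^sup>n\<close>, where \<open>T\<close> has mass \<open>q r\<close>.\<close>
  define l where "l n = q * (r ^ n + real n * r ^ n * (1 + r))" for n
  define d where "d n x = A n x / f x - l n" for n x
  have d_pair: "((\<lambda>x. d n x + d (Suc n) x) \<longlongrightarrow> 0) at_top" for n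
  proof -
    have "((\<lambda>x. loc c (R (Suc n)) x / f x - loc c (convolution ?S (R (Suc n))) x / f x - (l n + l (Suc n)))
        \<longlongrightarrow> real (Suc n) * r ^ (Suc n - 1) * (1 + r)
          - measure ?S UNIV * (real (Suc n) * r ^ (Suc n - 1) * (1 + r)) - (l n + l (Suc n))) at_top"
      using R(4)[of "Suc n"] ratio_lim_trunc_convolution[OF L R(2) R(4), of K "Suc n"]
      unfolding ratio_lim_def by (intro tendsto_intros)
    also have "real (Suc n) * r ^ (Suc n - 1) * (1 + r)
        - measure ?S UNIV * (real (Suc n) * r ^ (Suc n - 1) * (1 + r)) - (l n + l (Suc n)) = 0"
      by (simp add: mS l_def algebra_simps)
    finally show ?thesis
      by (simp add: d_def A_rec[symmetric] diff_divide_distrib[symmetric] add_divide_distrib algebra_simps)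
  qed
  have d_0: "((\<lambda>x. d 0 x - (- 1) ^ n * d n x) \<longlongrightarrow> 0) at_top" for n
  proof (induction n)
    case (Suc n)
    have "((\<lambda>x. (d 0 x - (- 1) ^ n * d n x) + (- 1) ^ n * (d n x + d (Suc n) x)) \<longlongrightarrow> 0 + (- 1) ^ n * 0) at_top"
      by (intro tendsto_add tendsto_mult tendsto_const Suc d_pair)
    then show ?case
      by (simp add: algebra_simps)
  qed simp
  have d_small: "\<forall>\<^sub>F x in at_top. \<bar>d n x\<bar> \<le> real (Suc n) * r ^ n * (1 + r) + l n + l (Suc n) + inverse (real (Suc n))" for n
  proof -
    have l0: "0 \<le> l n" for n
      using q r by (simp add: l_def)
    have "\<forall>\<^sub>F x in at_top. loc c (R (Suc n)) x \<le> (real (Suc n) * r ^ n * (1 + r) + inverse (real (Suc n))) * f x"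
      by (intro ratio_limD_le[OF R(4)]) simp
    with eventually_positive show ?thesis
    proof eventually_elim
      case (elim x)
      have A0: "0 \<le> A n x" "0 \<le> A (Suc n) x"
        by (simp_all add: A_def)
      have "A n x \<le> loc c (R (Suc n)) x"
        using A_rec[of n x] A0 loc_nonneg[of c "convolution ?S (R (Suc n))" x] by linarith
      also note elim(2)
      finally have "0 \<le> A n x / f x" "A n x / f x \<le> real (Suc n) * r ^ n * (1 + r) + inverse (real (Suc n))"
        using A0 elim by (simp_all add: divide_le_eq)
      then show ?case
        using l0[of n] l0[of "Suc n"] unfolding d_def by linarith
    qed
  qed
  define e where "e n = real (Suc n) * r ^ n * (1 + r) + l n + l (Suc n) + inverse (real (Suc n))" for n
  have e_lim: "e \<longlonglongrightarrow> 0"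
  proof -
    have 1: "(\<lambda>n. r ^ n) \<longlonglongrightarrow> 0"
      using r by (intro LIMSEQ_power_zero) auto
    have 2: "(\<lambda>n. real n * r ^ n) \<longlonglongrightarrow> 0"
      using r by (intro powser_times_n_limit_0) auto
    have l: "l \<longlonglongrightarrow> q * (0 + 0 * (1 + r))"
      unfolding l_def by (intro tendsto_intros 1 2)
    then have l': "(\<lambda>n. l (Suc n)) \<longlonglongrightarrow> q * (0 + 0 * (1 + r))"
      by (rule LIMSEQ_Suc)
    have "(\<lambda>n. (real n * r ^ n + r ^ n) * (1 + r) + l n + l (Suc n) + inverse (real (Suc n))) \<longlonglongrightarrow>
        (0 + 0) * (1 + r) + q * (0 + 0 * (1 + r)) + q * (0 + 0 * (1 + r)) + 0"
      by (intro tendsto_intros 1 2 l l' LIMSEQ_inverse_real_of_nat)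
    then show ?thesis
      by (simp add: e_def[abs_def] algebra_simps)
  qed
  have "(d 0 \<longlongrightarrow> 0) at_top"
  proof (rule tendstoI)
    fix \<epsilon> :: real assume \<epsilon>: "0 < \<epsilon>"
    have "\<forall>\<^sub>F n in sequentially. e n < \<epsilon> / 2"
      using e_lim \<epsilon> by (intro order_tendstoD) auto
    then obtain n where n: "e n < \<epsilon> / 2"
      using eventually_happens'[OF trivial_limit_sequentially] by blast
    have "\<forall>\<^sub>F x in at_top. dist (d 0 x - (- 1) ^ n * d n x) 0 < \<epsilon> / 2"
      using d_0 \<epsilon> by (intro tendstoD) auto
    with d_small[of n] show "\<forall>\<^sub>F x in at_top. dist (d 0 x) 0 < \<epsilon>"
    proof eventually_elim
      case (elim x)
      have "\<bar>d 0 x\<bar> \<le> \<bar>d 0 x - (- 1) ^ n * d n x\<bar> + \<bar>(- 1) ^ n * d n x\<bar>"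
        by linarith
      also have "\<bar>(- 1) ^ n * d n x\<bar> = \<bar>d n x\<bar>"
        by (simp add: abs_mult power_abs)
      finally show ?case
        using elim n by (simp add: e_def)
    qed
  qed
  then have "((\<lambda>x. d 0 x + q) \<longlongrightarrow> 0 + q) at_top"
    by (intro tendsto_intros)
  moreover have "\<forall>\<^sub>F x in at_top. d 0 x + q = loc c L x / f x"
    using eventually_ge_at_top[of K]
  proof eventually_elim
    case (elim x)
    have "convolution ?T (return borel 0) = ?T"
      by (intro finite_borel_measure_eqI_char)
         (simp_all add: finite_borel_measure_convolution fb char_convolution,
          simp add: char_def integral_return)
    then have "A 0 x = loc c L x"
      using elim by (simp add: A_def R_def loc_tail_eq LD)
    then show ?case
      by (simp add: d_def l_def)
  qed
  ultimately show ?thesis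
    unfolding ratio_lim_def q_def[symmetric] by (simp add: tendsto_cong)
qed

end

section \<open>Wiener-Hopf factorisation as a recursion\<close>

text \<open>
  \<open>H n\<close> is the law of the walk at time \<open>n\<close> as long as it has not become positive, and \<open>L n\<close> the law of its
  position if it becomes positive at time \<open>n\<close>.  In generating functions, \<open>step\<close> reads
  \<open>H(z) (1 - z G) = 1 - L(z)\<close>.
\<close>

locale killed_walk =
  fixes G :: "real measure" and H L :: "nat \<Rightarrow> real measure"
  assumes G: "real_distribution G"
    and H: "finite_borel_measure (H n)" "measure (H n) {0<..} = 0"
    and L: "finite_borel_measure (L n)" "measure (L n) {..0} = 0"
    and H_0: "char (H 0) t = 1"
    and step: "char (H n) t * char G t = char (H (Suc n)) t + char (L (Suc n)) t"
begin

lemma G_fbm: "finite_borel_measure G"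
proof -
  interpret real_distribution G by (rule G)
  show ?thesis
    by (rule finite_borel_measure_axioms)
qed

definition U :: "nat \<Rightarrow> real measure" where "U n = tail 0 (conv_power n G)"
definition V :: "nat \<Rightarrow> real measure" where "V n = trunc 0 (conv_power n G)"

lemma U: "finite_borel_measure (U n)" "measure (U n) {..0} = 0"
proof -
  have "{0<..} \<inter> {..0::real} = {}"
    by auto
  then show "finite_borel_measure (U n)" "measure (U n) {..0} = 0"
    by (simp_all add: U_def finite_borel_measure_conv_power G_fbm finite_borel_measure_tail measure_tail)
qed

lemma V: "finite_borel_measure (V n)" "measure (V n) {0<..} = 0"
proof -
  have "{..0} \<inter> {0::real<..} = {}"
    by auto
  then show "finite_borel_measure (V n)" "measure (V n) {0<..} = 0"
    by (simp_all add: V_def finite_borel_measure_conv_power G_fbm finite_borel_measure_trunc measure_trunc)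
qed

lemma char_U_V: "char (U n) t + char (V n) t = char G t ^ n"
  using char_trunc_tail[OF finite_borel_measure_conv_power[OF G_fbm], of n t 0] by (simp add: U_def V_def char_conv_power G_fbm)

text \<open>
  The hypothesis is the relation \<open>z H' = H V\<close> between generating functions in degree \<open>m\<close>, where the sum
  defining \<open>V\<close> starts in degree 1.  Multiplied
  by \<open>G\<close> and combined with \<open>step\<close>, it yields a relation in degree \<open>m + 1\<close> whose terms live on either
  of the two half lines, except for \<open>G\<^sup>m\<^sup>+\<^sup>1 = U (m + 1) + V (m + 1)\<close>.
\<close>

lemma wiener_hopf_step:
  assumes IH: "of_nat m * char (H m) t = (\<Sum>k<m. char (H k) t * char (V (m - k)) t)"
  shows "of_nat (Suc m) * (char (H (Suc m)) t + char (L (Suc m)) t) +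
      (\<Sum>k<m. char (L (Suc k)) t * char (U (m - k)) t) =
    char G t ^ Suc m + (\<Sum>k<m. char (H (Suc k)) t * char (V (m - k)) t)"
proof -
  let ?g = "char G t"
  let ?h = "\<lambda>n. char (H n) t" and ?l = "\<lambda>n. char (L n) t"
  let ?u = "\<lambda>n. char (U n) t" and ?v = "\<lambda>n. char (V n) t"
  \<comment> \<open>A free path up to time \<open>m + 1\<close> is either still nonpositive at time \<open>m\<close> or has entered the
    positive half line at some time \<open>k + 1 \<le> m\<close>.\<close>
  have tele: "?h m * ?g + (\<Sum>k<m. ?l (Suc k) * ?g ^ (m - k)) = ?g ^ Suc m"
  proof -
    have "(\<Sum>k<m. ?l (Suc k) * ?g ^ (m - k)) =
        (\<Sum>k<m. ?h k * ?g ^ (Suc m - k) - ?h (Suc k) * ?g ^ (Suc m - Suc k))"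
    proof (rule sum.cong)
      fix k assume "k \<in> {..<m}"
      then have "Suc m - k = Suc (m - k)"
        by auto
      moreover have "?l (Suc k) = ?h k * ?g - ?h (Suc k)"
        by (simp add: step)
      ultimately show "?l (Suc k) * ?g ^ (m - k) = ?h k * ?g ^ (Suc m - k) - ?h (Suc k) * ?g ^ (Suc m - Suc k)"
        by (simp only: left_diff_distrib power_Suc diff_Suc_Suc mult.assoc)
    qed simp
    also have "\<dots> = ?h 0 * ?g ^ (Suc m - 0) - ?h m * ?g ^ (Suc m - m)"
      by (rule sum_lessThan_telescope')
    finally show ?thesis
      by (simp add: H_0)
  qed
  have "of_nat (Suc m) * (?h (Suc m) + ?l (Suc m)) = ?h m * ?g + (of_nat m * ?h m) * ?g"
    by (simp add: step[symmetric] algebra_simps)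
  also have "(of_nat m * ?h m) * ?g = (\<Sum>k<m. (?h (Suc k) + ?l (Suc k)) * ?v (m - k))"
    unfolding IH step[symmetric] by (simp add: sum_distrib_left mult_ac)
  finally have "of_nat (Suc m) * (?h (Suc m) + ?l (Suc m)) + (\<Sum>k<m. ?l (Suc k) * ?u (m - k)) =
      ?h m * ?g + (\<Sum>k<m. ?l (Suc k) * (?u (m - k) + ?v (m - k))) + (\<Sum>k<m. ?h (Suc k) * ?v (m - k))"
    by (simp add: algebra_simps sum.distrib)
  also have "?h m * ?g + (\<Sum>k<m. ?l (Suc k) * (?u (m - k) + ?v (m - k))) = ?g ^ Suc m"
    unfolding char_U_V by (rule tele)
  finally show ?thesis .
qed

text \<open>
  The terms on \<open>(0, \<infinity>)\<close> must balance among themselves: \<open>U = z L' + L U\<close> in degree \<open>m + 1\<close>.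
\<close>

lemma wiener_hopf_split:
  assumes IH: "\<And>t. of_nat m * char (H m) t = (\<Sum>k<m. char (H k) t * char (V (m - k)) t)"
  shows "char (U (Suc m)) t = of_nat (Suc m) * char (L (Suc m)) t +
    (\<Sum>k<m. char (L (Suc k)) t * char (U (m - k)) t)"
proof -
  let ?xs = "(real (Suc m), L (Suc m)) # (- 1, U (Suc m)) #
    map (\<lambda>k. (1, convolution (L (Suc k)) (U (m - k)))) [0..<m]"
  let ?ys = "(real (Suc m), H (Suc m)) # (- 1, V (Suc m)) #
    map (\<lambda>k. (- 1, convolution (H (Suc k)) (V (m - k)))) [0..<m]"
  have xs: "(\<Sum>(r, M)\<leftarrow>?xs. complex_of_real r * char M t) = of_nat (Suc m) * char (L (Suc m)) t
      - char (U (Suc m)) t + (\<Sum>k<m. char (L (Suc k)) t * char (U (m - k)) t)" for t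
    by (simp add: char_convolution L U o_def interv_sum_list_conv_sum_set_nat lessThan_atLeast0)
  have ys: "(\<Sum>(r, M)\<leftarrow>?ys. complex_of_real r * char M t) = of_nat (Suc m) * char (H (Suc m)) t
      - char (V (Suc m)) t - (\<Sum>k<m. char (H (Suc k)) t * char (V (m - k)) t)" for t
    by (simp add: char_convolution H V o_def interv_sum_list_conv_sum_set_nat lessThan_atLeast0 sum_negf)
  have "(\<Sum>(r, M)\<leftarrow>?xs. complex_of_real r * char M t) = 0"
  proof (rule lin_comb_half_lines[where ys = ?ys])
    have "measure (convolution (L (Suc k)) (U (m - k))) {..0} = 0" for k
      by (rule measure_convolution_eq_0[OF L(1) _ L(2) U(1) _ U(2)]) auto
    then show "finite_borel_measure M \<and> measure M {..0} = 0" if "(r, M) \<in> set ?xs" for r M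
      using that by (auto simp: L U finite_borel_measure_convolution)
    have "measure (convolution (H (Suc k)) (V (m - k))) {0<..} = 0" for k
      by (rule measure_convolution_eq_0[OF H(1) _ H(2) V(1) _ V(2)]) auto
    then show "finite_borel_measure M \<and> measure M {0<..} = 0" if "(r, M) \<in> set ?ys" for r M
      using that by (auto simp: H V finite_borel_measure_convolution)
    show "(\<Sum>(r, M)\<leftarrow>?xs. complex_of_real r * char M t) +
        (\<Sum>(r, M)\<leftarrow>?ys. complex_of_real r * char M t) = 0" for t
      unfolding xs ys using wiener_hopf_step[OF IH, of t] char_U_V[of "Suc m" t]
      by (simp only: distrib_left) (simp add: algebra_simps)
  qed
  then show ?thesis
    unfolding xs by (simp add: algebra_simps)
qed

text \<open>
  The terms on \<open>(-\<infinity>, 0]\<close> balance as well, which carries the induction from \<open>m\<close> to \<open>m + 1\<close>.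
\<close>

lemma descending_recursion: "of_nat m * char (H m) t = (\<Sum>k<m. char (H k) t * char (V (m - k)) t)"
proof (induction m arbitrary: t)
  case (Suc m)
  let ?n = "of_nat (Suc m) :: complex"
  let ?S = "\<Sum>k<m. char (L (Suc k)) t * char (U (m - k)) t"
    and ?T = "\<Sum>k<m. char (H (Suc k)) t * char (V (m - k)) t"
  have "?n * char (H (Suc m)) t =
      (?n * (char (H (Suc m)) t + char (L (Suc m)) t) + ?S) - (?n * char (L (Suc m)) t + ?S)"
    by (simp only: distrib_left add_diff_cancel_right add_diff_cancel)
  also have "\<dots> = (char G t ^ Suc m + ?T) - char (U (Suc m)) t"
    by (simp only: wiener_hopf_step[OF Suc.IH] wiener_hopf_split[OF Suc.IH])
  also have "\<dots> = char (V (Suc m)) t + ?T"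
    by (simp only: char_U_V[symmetric]) simp
  finally have "?n * char (H (Suc m)) t = char (V (Suc m)) t + ?T" .
  then show ?case
    by (subst sum.lessThan_Suc_shift) (simp add: H_0)
qed simp

lemma ascending_recursion:
  "char (U (Suc m)) t = of_nat (Suc m) * char (L (Suc m)) t +
    (\<Sum>k<m. char (L (Suc k)) t * char (U (m - k)) t)"
  using descending_recursion by (rule wiener_hopf_split)

lemma norm_char_U: "norm (char (U n) t) \<le> 1"
proof -
  have "measure (conv_power n G) UNIV = 1"
    using prob_space.prob_space[OF real_distribution.axioms(1)[OF G]] finite_borel_measureD(3)[OF G_fbm]
    by (simp add: measure_conv_power_UNIV G_fbm)
  then show ?thesis
    using norm_char_le[OF U(1)[of n], of t]
      finite_measure.finite_measure_mono[OF finite_borel_measureD(1)[OF finite_borel_measure_conv_power[OF G_fbm]], of "{0<..}" UNIV n]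
    by (simp add: U_def measure_tail finite_borel_measure_conv_power G_fbm finite_borel_measureD)
qed

end

section \<open>Spitzer's identity\<close>

text \<open>
  The recursion says \<open>F' = K' + K F'\<close> for \<open>K(z) = \<Sum>n. l n z\<^sup>n\<close> and \<open>F(z) = \<Sum>n. u n / n z\<^sup>n\<close>.  Hence
  \<open>F + Ln (1 - K)\<close> has derivative 0 on the unit disc, and it vanishes at 0.  The term \<open>n = 0\<close> of \<open>F\<close> is
  0 because of \<open>u 0 / 0 = 0\<close>.
\<close>

lemma log_power_series:
  fixes l u :: "nat \<Rightarrow> complex"
  assumes l0: "l 0 = 0"
    and rec: "\<And>n. u (Suc n) = of_nat (Suc n) * l (Suc n) + (\<Sum>k<n. l (Suc k) * u (n - k))"
    and u: "\<And>n. norm (u n) \<le> 1"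
    and l: "\<And>n. norm (l n) \<le> bd n" "bd sums p" "p < 1" and z: "norm z < 1"
  shows "(\<lambda>n. u n / of_nat n * z ^ n) sums (- Ln (1 - (\<Sum>n. l n * z ^ n)))"
    and "norm (\<Sum>n. l n * z ^ n) \<le> p"
proof -
  define F where "F = Abs_fps (\<lambda>n. u n / of_nat n)"
  define K where "K = Abs_fps l"
  have radius: "1 \<le> fps_conv_radius (Abs_fps a)" if "\<And>n. norm (a n) \<le> 1" for a :: "nat \<Rightarrow> complex"
    unfolding fps_conv_radius_def
  proof (rule conv_radius_geI_ex')
    fix r :: real assume r: "0 < r" "ereal r < 1"
    have b: "norm (a n * of_real r ^ n) \<le> r ^ n" for n
      using mult_right_mono[OF that[of n], of "r ^ n"] r by (simp add: norm_mult norm_power)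
    have "summable (\<lambda>n. r ^ n)"
      using r by (intro summable_geometric) simp
    then show "summable (\<lambda>n. fps_nth (Abs_fps a) n * of_real r ^ n)"
      unfolding fps_nth_Abs_fps using b by (rule summable_comparison_test')
  qed
  have "bd n \<le> p" for n
    using sum_le_suminf[OF sums_summable[OF l(2)], of "{n}"] order_trans[OF norm_ge_zero l(1)] l(2)
    by (simp add: sums_iff)
  then have "norm (l n) \<le> 1" for n
    using l(1)[of n] l(3) by (meson less_imp_le order_trans)
  then have rK: "1 \<le> fps_conv_radius K"
    unfolding K_def by (rule radius)
  have "norm (u n / of_nat n) \<le> 1" for n
    using u[of n] by (cases "n = 0") (auto simp: norm_divide divide_le_eq)
  then have rF: "1 \<le> fps_conv_radius F"
    unfolding F_def by (rule radius)
  have eq: "fps_deriv F = fps_deriv K + K * fps_deriv F"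
  proof (rule fps_ext)
    fix n
    have "(\<Sum>k=0..n. l k * u (Suc n - k)) = (\<Sum>k<n. l (Suc k) * u (n - k))"
      by (simp add: l0 atLeast0AtMost lessThan_Suc_atMost[symmetric] sum.lessThan_Suc_shift del: sum.lessThan_Suc)
    moreover have "(\<Sum>k=0..n. l k * u (Suc n - k)) = (\<Sum>k=0..n. l k * u (Suc (n - k)))"
      by (intro sum.cong refl) (simp add: Suc_diff_le)
    moreover have "u (Suc m) / of_nat (Suc m) * of_nat (Suc m) = u (Suc m)" for m
      by (simp del: of_nat_Suc)
    ultimately show "fps_nth (fps_deriv F) n = fps_nth (fps_deriv K + K * fps_deriv F) n"
      using rec[of n] by (simp add: F_def K_def fps_mult_nth mult.commute del: of_nat_Suc)
  qed
  have norm_K: "norm (eval_fps K w) \<le> p" if "norm w < 1" for w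
  proof -
    have b: "norm (l n * w ^ n) \<le> bd n" for n
    proof -
      have "norm (l n) * norm w ^ n \<le> norm (l n) * 1"
        using that by (intro mult_left_mono power_le_one) auto
      then show ?thesis
        using l(1)[of n] by (simp add: norm_mult norm_power)
    qed
    have "norm (\<Sum>n. l n * w ^ n) \<le> (\<Sum>n. bd n)"
      using b sums_summable[OF l(2)] by (rule norm_suminf_le)
    then show ?thesis
      using l(2) by (simp add: sums_iff eval_fps_def K_def)
  qed
  have deriv: "((\<lambda>w. eval_fps F w + Ln (1 - eval_fps K w)) has_field_derivative 0) (at w within ball 0 1)"
    if w: "w \<in> ball 0 1" for w
  proof -
    have w1: "ereal (norm w) < 1"
      using w by simp
    have wF: "ereal (norm w) < fps_conv_radius F" and wK: "ereal (norm w) < fps_conv_radius K"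
      by (rule order.strict_trans2[OF w1 rF] order.strict_trans2[OF w1 rK])+
    have wF': "ereal (norm w) < fps_conv_radius (fps_deriv F)" and wK': "ereal (norm w) < fps_conv_radius (fps_deriv K)"
      using wF wK fps_conv_radius_deriv less_le_trans by blast+
    have "ereal (norm w) < fps_conv_radius (K * fps_deriv F)"
      using wK wF' fps_conv_radius_mult[of K "fps_deriv F"] by (meson less_le_trans min_less_iff_conj)
    then have e: "eval_fps (fps_deriv F) w = eval_fps (fps_deriv K) w + eval_fps K w * eval_fps (fps_deriv F) w"
      by (subst eq) (simp add: eval_fps_add eval_fps_mult wK wF' wK')
    have re: "0 < Re (1 - eval_fps K w)"
      using complex_Re_le_cmod[of "eval_fps K w"] norm_K[of w] w l(3) by simp
    then have nz: "1 - eval_fps K w \<notin> \<real>\<^sub>\<le>\<^sub>0" "1 - eval_fps K w \<noteq> 0"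
      by (auto simp: complex_nonpos_Reals_iff complex_eq_iff)
    have "((\<lambda>w. eval_fps F w + Ln (1 - eval_fps K w)) has_field_derivative
        eval_fps (fps_deriv F) w + inverse (1 - eval_fps K w) * (0 - eval_fps (fps_deriv K) w)) (at w within ball 0 1)"
      by (intro DERIV_add has_field_derivative_eval_fps DERIV_chain2[OF has_field_derivative_Ln]
          DERIV_diff DERIV_const wF wK nz)
    moreover have "eval_fps (fps_deriv F) w + inverse (1 - eval_fps K w) * (0 - eval_fps (fps_deriv K) w) = 0"
    proof -
      have "eval_fps (fps_deriv K) w = eval_fps (fps_deriv F) w * (1 - eval_fps K w)"
        using e by (simp add: algebra_simps)
      then show ?thesis
        using nz(2) by simp
    qed
    ultimately show ?thesis
      by simp
  qed
  then obtain C where "\<And>w. w \<in> ball 0 1 \<Longrightarrow> eval_fps F w + Ln (1 - eval_fps K w) = C"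
    using has_field_derivative_zero_constant[of "ball 0 1" "\<lambda>w. eval_fps F w + Ln (1 - eval_fps K w)"] by auto
  from this[of 0] this[of z] have "eval_fps F z + Ln (1 - eval_fps K z) = 0"
    using z l0 by (simp add: eval_fps_at_0 F_def K_def)
  then have "eval_fps F z = - Ln (1 - eval_fps K z)"
    by (simp add: eq_neg_iff_add_eq_0)
  moreover have "ereal (norm z) < fps_conv_radius F"
    using z rF by (intro less_le_trans[OF _ rF]) simp
  then have "(\<lambda>n. fps_nth F n * z ^ n) sums eval_fps F z"
    by (rule sums_eval_fps)
  ultimately show "(\<lambda>n. u n / of_nat n * z ^ n) sums (- Ln (1 - (\<Sum>n. l n * z ^ n)))"
    by (simp add: F_def K_def eval_fps_def)
  show "norm (\<Sum>n. l n * z ^ n) \<le> p"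
    using norm_K[OF z] by (simp add: K_def eval_fps_def)
qed

lemma power_series_tendsto_at_left_1:
  fixes a :: "nat \<Rightarrow> complex"
  assumes "\<And>n. norm (a n) \<le> M n" "summable M"
  shows "((\<lambda>t. \<Sum>n. a n * complex_of_real t ^ n) \<longlongrightarrow> (\<Sum>n. a n)) (at_left (1 :: real))"
proof (rule tannerys_theorem[THEN conjunct2, THEN conjunct2])
  show "((\<lambda>t. a n * complex_of_real t ^ n) \<longlongrightarrow> a n) (at_left (1 :: real))" for n
  proof -
    have "((\<lambda>t. a n * complex_of_real t ^ n) \<longlongrightarrow> a n * complex_of_real 1 ^ n) (at_left (1 :: real))"
      by (intro tendsto_intros)
    then show ?thesis
      by simp
  qed
  have "\<forall>\<^sub>F t in at_left (1 :: real). 0 < t \<and> t < 1"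
    using eventually_at_left_real[of 0 1] by (auto elim: eventually_mono)
  then have "\<forall>\<^sub>F t in at_left (1 :: real). \<forall>n. norm (a n * complex_of_real t ^ n) \<le> M n"
  proof eventually_elim
    case (elim t)
    show ?case
    proof
      fix n
      have "norm (a n) * t ^ n \<le> norm (a n) * 1"
        using elim by (intro mult_left_mono power_le_one) auto
      then show "norm (a n * complex_of_real t ^ n) \<le> M n"
        using assms(1)[of n] elim by (simp add: norm_mult norm_power)
    qed
  qed
  then show "\<forall>\<^sub>F (n, t) in at_top \<times>\<^sub>F at_left 1. norm (a n * complex_of_real t ^ n) \<le> M n"
    unfolding eventually_prod_filter
    by (intro exI[of _ "\<lambda>_. True"] exI[of _ "\<lambda>t. \<forall>n. norm (a n * complex_of_real t ^ n) \<le> M n"]) auto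
qed (use assms in auto)

locale transient_killed_walk = killed_walk +
  fixes p :: real
  assumes L_0: "measure (L 0) UNIV = 0" and p: "(\<lambda>n. measure (L n) UNIV) sums p" "p < 1"
begin

lemma char_L_0: "char (L 0) t = 0"
  using norm_char_le[OF L(1)[of 0], of t] L_0 by simp

lemma log_series_at:
  assumes "norm z < 1"
  shows "(\<lambda>n. char (U n) t / of_nat n * z ^ n) sums (- Ln (1 - (\<Sum>n. char (L n) t * z ^ n)))"
    and "norm (\<Sum>n. char (L n) t * z ^ n) \<le> p"
  using log_power_series[OF char_L_0 ascending_recursion norm_char_U norm_char_le[OF L(1)] p assms]
  by simp_all

lemma char_at_0: "char (U n) 0 = complex_of_real (measure (U n) UNIV)"
    "char (L n) 0 = complex_of_real (measure (L n) UNIV)"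
  by (simp_all add: char_0 finite_borel_measureD[OF U(1)] finite_borel_measureD[OF L(1)])

text \<open>
  At \<open>t = 0\<close> all transforms are masses.  The partial sums of the identity at \<open>z < 1\<close> are bounded by
  \<open>- ln (1 - p)\<close>, and so are their limits for \<open>z\<close> increasing to 1.
\<close>

lemma summable_U: "summable (\<lambda>n. measure (U n) UNIV / real n)"
proof (rule summableI_nonneg_bounded)
  fix N :: nat
  have "\<forall>\<^sub>F t in at_left (1 :: real). 0 < t \<and> t < 1"
    using eventually_at_left_real[of 0 1] by (auto elim: eventually_mono)
  then have "\<forall>\<^sub>F t in at_left (1 :: real). (\<Sum>n<N. measure (U n) UNIV / real n * t ^ n) \<le> - ln (1 - p)"
  proof eventually_elim
    case (elim t)
    then have nt: "norm (complex_of_real t) < 1"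
      by simp
    have sl: "summable (\<lambda>n. measure (L n) UNIV * t ^ n)"
    proof (rule summable_comparison_test'[OF sums_summable[OF p(1)], of 0])
      show "norm (measure (L n) UNIV * t ^ n) \<le> measure (L n) UNIV" for n
        using elim power_le_one[of t n] by (simp add: mult_left_le)
    qed
    define w where "w = (\<Sum>n. measure (L n) UNIV * t ^ n)"
    have cw: "(\<Sum>n. char (L n) 0 * complex_of_real t ^ n) = complex_of_real w"
      using suminf_of_real[OF sl, where 'a = complex] by (simp add: char_at_0 w_def)
    then have wp: "w \<le> p"
      using log_series_at(2)[OF nt, of 0] by simp
    have "1 - complex_of_real w = complex_of_real (1 - w)"
      by simp
    then have Ln: "Ln (1 - complex_of_real w) = complex_of_real (ln (1 - w))"
      using wp p(2) by (simp only: Ln_of_real)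
    have "(\<lambda>n. char (U n) 0 / of_nat n * complex_of_real t ^ n) sums (- complex_of_real (ln (1 - w)))"
      using log_series_at(1)[OF nt, of 0] by (simp only: cw Ln)
    moreover have "char (U n) 0 / of_nat n * complex_of_real t ^ n =
        complex_of_real (measure (U n) UNIV / real n * t ^ n)" for n
      by (simp add: char_at_0)
    ultimately have "(\<lambda>n. complex_of_real (measure (U n) UNIV / real n * t ^ n)) sums complex_of_real (- ln (1 - w))"
      by (simp only: of_real_minus)
    then have sm: "(\<lambda>n. measure (U n) UNIV / real n * t ^ n) sums (- ln (1 - w))"
      by (simp only: sums_of_real_iff)
    have "(\<Sum>n<N. measure (U n) UNIV / real n * t ^ n) \<le> - ln (1 - w)"
      unfolding sums_unique[OF sm] using elim
      by (intro sum_le_suminf sums_summable[OF sm]) auto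
    also have "\<dots> \<le> - ln (1 - p)"
      using wp p(2) by simp
    finally show ?case .
  qed
  moreover have "((\<lambda>t. \<Sum>n<N. measure (U n) UNIV / real n * t ^ n) \<longlongrightarrow>
      (\<Sum>n<N. measure (U n) UNIV / real n * 1 ^ n)) (at_left (1 :: real))"
    by (intro tendsto_intros)
  ultimately show "(\<Sum>n<N. measure (U n) UNIV / real n) \<le> - ln (1 - p)"
    using tendsto_upperbound[OF _ _ trivial_limit_at_left_real] by fastforce
qed simp

text \<open>
  Both sides of \<open>log_series_at\<close> are continuous up to \<open>z = 1\<close>.
\<close>

lemma spitzer_char: "(\<lambda>n. char (U n) t / of_nat n) sums (- Ln (1 - (\<Sum>n. char (L n) t)))"
proof -
  have bU: "norm (char (U n) t / of_nat n) \<le> measure (U n) UNIV / real n" for n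
    using norm_char_le[OF U(1)[of n], of t] by (simp add: norm_divide divide_right_mono)
  have "\<forall>\<^sub>F s in at_left (1 :: real). 0 < s \<and> s < 1"
    using eventually_at_left_real[of 0 1] by (auto elim: eventually_mono)
  then have ev: "\<forall>\<^sub>F s in at_left (1 :: real). - Ln (1 - (\<Sum>n. char (L n) t * complex_of_real s ^ n)) =
      (\<Sum>n. char (U n) t / of_nat n * complex_of_real s ^ n)"
  proof eventually_elim
    case (elim s)
    then show ?case
      using log_series_at(1)[of "complex_of_real s" t] by (simp add: sums_iff)
  qed
  have "norm (\<Sum>n. char (L n) t) \<le> (\<Sum>n. measure (L n) UNIV)"
    using norm_char_le[OF L(1)] sums_summable[OF p(1)] by (rule norm_suminf_le)
  then have re: "0 < Re (1 - (\<Sum>n. char (L n) t))"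
    using complex_Re_le_cmod[of "\<Sum>n. char (L n) t"] p by (simp add: sums_iff)
  have "((\<lambda>s. - Ln (1 - (\<Sum>n. char (L n) t * complex_of_real s ^ n))) \<longlongrightarrow> - Ln (1 - (\<Sum>n. char (L n) t)))
      (at_left (1 :: real))"
    using re by (intro tendsto_intros power_series_tendsto_at_left_1[OF norm_char_le[OF L(1)] sums_summable[OF p(1)]])
      (auto simp: complex_nonpos_Reals_iff)
  then have "((\<lambda>s. \<Sum>n. char (U n) t / of_nat n * complex_of_real s ^ n) \<longlongrightarrow> - Ln (1 - (\<Sum>n. char (L n) t)))
      (at_left (1 :: real))"
    using ev by (rule Lim_transform_eventually)
  moreover have "((\<lambda>s. \<Sum>n. char (U n) t / of_nat n * complex_of_real s ^ n) \<longlongrightarrow> (\<Sum>n. char (U n) t / of_nat n))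
      (at_left (1 :: real))"
    by (rule power_series_tendsto_at_left_1[OF bU summable_U])
  ultimately have "(\<Sum>n. char (U n) t / of_nat n) = - Ln (1 - (\<Sum>n. char (L n) t))"
    using tendsto_unique trivial_limit_at_left_real by blast
  moreover have "summable (\<lambda>n. char (U n) t / of_nat n)"
    by (rule summable_comparison_test'[OF summable_U, of 0]) (use bU in auto)
  ultimately show ?thesis
    by (simp add: sums_iff)
qed

end

section \<open>Paths and their first entrance into the positive half line\<close>

definition psum :: "nat \<Rightarrow> (nat \<Rightarrow> real) \<Rightarrow> real" where
  "psum n y = (\<Sum>i<n. y i)"

definition stays_nonpos :: "nat \<Rightarrow> (nat \<Rightarrow> real) \<Rightarrow> bool" where
  "stays_nonpos n y \<longleftrightarrow> (\<forall>k\<le>n. psum k y \<le> 0)"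

definition enters_pos :: "nat \<Rightarrow> (nat \<Rightarrow> real) \<Rightarrow> bool" where
  "enters_pos n y \<longleftrightarrow> (\<forall>k<n. psum k y \<le> 0) \<and> 0 < psum n y"

lemma psum_0 [simp]: "psum 0 y = 0"
  by (simp add: psum_def)

lemma psum_comb_seq_le: "k \<le> n \<Longrightarrow> psum k (comb_seq n y y') = psum k y"
  by (simp add: psum_def comb_seq_def)

lemma psum_comb_seq_add: "psum (n + m) (comb_seq n y y') = psum n y + psum m y'"
proof -
  have "psum (n + m) (comb_seq n y y') = (\<Sum>i<n. comb_seq n y y' i) + (\<Sum>i<m. comb_seq n y y' (n + i))"
    unfolding psum_def by (induction m) simp_all
  then show ?thesis
    by (simp add: psum_def comb_seq_def)
qed

lemma stays_nonpos_comb_seq: "stays_nonpos n (comb_seq n y y') = stays_nonpos n y"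
  by (simp add: stays_nonpos_def psum_comb_seq_le)

lemma enters_pos_comb_seq: "enters_pos n (comb_seq n y y') = enters_pos n y"
  by (simp add: enters_pos_def psum_comb_seq_le)

lemma stays_nonpos_step: "stays_nonpos n y \<longleftrightarrow> stays_nonpos (Suc n) y \<or> enters_pos (Suc n) y"
  by (auto simp: stays_nonpos_def enters_pos_def le_Suc_eq less_Suc_eq_le not_le)

lemma not_stays_and_enters: "\<not> (stays_nonpos n y \<and> enters_pos n y)"
  by (auto simp: stays_nonpos_def enters_pos_def)

lemma enters_pos_unique: "enters_pos m y \<Longrightarrow> enters_pos n y \<Longrightarrow> m = n"
  by (metis enters_pos_def linorder_neqE_nat not_less)

lemma ex_enters_pos_iff: "(\<exists>n. enters_pos n y) \<longleftrightarrow> (\<exists>k. 0 < psum k y)"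
proof
  assume "\<exists>k. 0 < psum k y"
  then obtain k where "0 < psum k y" "\<And>j. j < k \<Longrightarrow> \<not> 0 < psum j y"
    using exists_least_iff[of "\<lambda>k. 0 < psum k y"] by blast
  then show "\<exists>n. enters_pos n y"
    by (auto simp: enters_pos_def not_less)
qed (auto simp: enters_pos_def)

definition run_max :: "(nat \<Rightarrow> real) \<Rightarrow> ereal" where
  "run_max y = (SUP n. ereal (psum n y))"

lemma run_max_nonneg: "0 \<le> run_max y"
  unfolding run_max_def by (rule SUP_upper2[of 0]) auto

text \<open>
  After the first entrance the path starts afresh from \<open>psum n y > 0\<close>, and all earlier values are at
  most 0.
\<close>

lemma run_max_comb_seq:
  assumes "enters_pos n y"
  shows "run_max (comb_seq n y y') = ereal (psum n y) + run_max y'"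
proof (rule antisym)
  show "run_max (comb_seq n y y') \<le> ereal (psum n y) + run_max y'"
    unfolding run_max_def[of "comb_seq n y y'"]
  proof (rule SUP_least)
    fix k
    show "ereal (psum k (comb_seq n y y')) \<le> ereal (psum n y) + run_max y'"
    proof (cases "n \<le> k")
      case True
      then obtain m where k: "k = n + m"
        by (auto simp: le_iff_add)
      have "ereal (psum m y') \<le> run_max y'"
        unfolding run_max_def by (rule SUP_upper) simp
      then show ?thesis
        unfolding k psum_comb_seq_add plus_ereal.simps(1)[symmetric] by (rule add_left_mono)
    next
      case False
      then have "psum k y \<le> 0" "0 < psum n y"
        using assms by (auto simp: enters_pos_def)
      then have "psum k (comb_seq n y y') \<le> psum n y"
        using False by (simp add: psum_comb_seq_le)
      then have "ereal (psum k (comb_seq n y y')) + 0 \<le> ereal (psum n y) + run_max y'"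
        by (intro add_mono run_max_nonneg) simp
      then show ?thesis
        by simp
    qed
  qed
  have "ereal (psum n y) + run_max y' = (SUP m. ereal (psum n y) + ereal (psum m y'))"
    unfolding run_max_def by (rule SUP_ereal_add_right[symmetric]) auto
  also have "\<dots> \<le> run_max (comb_seq n y y')"
  proof (rule SUP_least)
    fix m
    have "ereal (psum n y) + ereal (psum m y') = ereal (psum (n + m) (comb_seq n y y'))"
      by (simp add: psum_comb_seq_add)
    also have "\<dots> \<le> run_max (comb_seq n y y')"
      unfolding run_max_def by (rule SUP_upper) simp
    finally show "ereal (psum n y) + ereal (psum m y') \<le> run_max (comb_seq n y y')" .
  qed
  finally show "ereal (psum n y) + run_max y' \<le> run_max (comb_seq n y y')" .
qed

lemma run_max_eq_0: "\<nexists>n. enters_pos n y \<Longrightarrow> run_max y = 0"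
  unfolding ex_enters_pos_iff
  by (intro antisym run_max_nonneg) (auto simp: run_max_def not_less intro!: SUP_least)

text \<open>
  The maximum of the first \<open>n + 1\<close> partial sums, computed by Lindley's recursion from the first step;
  this form is the one that the maximal ergodic lemma uses.
\<close>

fun fin_max :: "nat \<Rightarrow> (nat \<Rightarrow> real) \<Rightarrow> real" where
  "fin_max 0 y = 0"
| "fin_max (Suc n) y = max 0 (y 0 + fin_max n (\<lambda>i. y (Suc i)))"

lemma psum_Suc_shift: "psum (Suc n) y = y 0 + psum n (\<lambda>i. y (Suc i))"
  unfolding psum_def by (rule sum.lessThan_Suc_shift)

lemma fin_max_mono: "fin_max n y \<le> fin_max (Suc n) y"
proof (induction n arbitrary: y)
  case (Suc n)
  have "fin_max (Suc n) y = max 0 (y 0 + fin_max n (\<lambda>i. y (Suc i)))"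
    by simp
  also have "\<dots> \<le> max 0 (y 0 + fin_max (Suc n) (\<lambda>i. y (Suc i)))"
    using Suc[of "\<lambda>i. y (Suc i)"] by (intro max.mono add_left_mono) auto
  finally show ?case
    by simp
qed simp

lemma fin_max_nonneg: "0 \<le> fin_max n y"
  by (cases n) auto

lemma psum_le_fin_max: "k \<le> n \<Longrightarrow> psum k y \<le> fin_max n y"
proof (induction n arbitrary: k y)
  case (Suc n)
  then show ?case
  proof (cases k)
    case (Suc j)
    then show ?thesis
      using Suc.IH[of j "\<lambda>i. y (Suc i)"] Suc.prems by (simp add: psum_Suc_shift le_max_iff_disj)
  qed (simp add: le_max_iff_disj)
qed simp

lemma fin_max_le: "fin_max n y \<le> (\<Sum>i<n. \<bar>y i\<bar>)"
proof (induction n arbitrary: y)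
  case (Suc n)
  have "y 0 + fin_max n (\<lambda>i. y (Suc i)) \<le> \<bar>y 0\<bar> + (\<Sum>i<n. \<bar>y (Suc i)\<bar>)"
    using Suc by (intro add_mono) auto
  also have "\<dots> = (\<Sum>i<Suc n. \<bar>y i\<bar>)"
    by (rule sum.lessThan_Suc_shift[symmetric])
  finally show ?case
    by (simp add: sum_nonneg del: sum.lessThan_Suc)
qed simp

text \<open>
  Garsia's inequality.  Where the maximum is positive it equals the first step plus the maximum of
  the shifted path over a shorter time.
\<close>

lemma maximal_ineq_pointwise:
  "fin_max (Suc n) y - fin_max (Suc n) (\<lambda>i. y (Suc i)) \<le> (if 0 < fin_max (Suc n) y then y 0 else 0)"
  using fin_max_mono[of n "\<lambda>i. y (Suc i)"] fin_max_nonneg[of "Suc n" "\<lambda>i. y (Suc i)"]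
  by (auto simp: max_def)

section \<open>Independent steps\<close>

locale step_law =
  fixes G :: "real measure"
  assumes G: "real_distribution G"
begin

sublocale G: real_distribution G
  by (rule G)

sublocale sequence_space G
proof (unfold sequence_space_def, rule product_prob_spaceI)
  show "prob_space G" by (rule G.prob_space_axioms)
qed

sublocale SS: pair_prob_space S S ..

lemma space_S: "space S = UNIV"
  by (simp add: space_PiM PiE_UNIV_domain)

lemma coord_measurable: "(\<lambda>y. y i) \<in> borel_measurable S"
proof -
  have "(\<lambda>y. y i) \<in> measurable S G"
    by (rule measurable_component_singleton) simp
  then show ?thesis
    using measurable_cong_sets[OF refl G.events_eq_borel] by blast
qed

lemma psum_measurable [measurable]: "psum n \<in> borel_measurable S"
  unfolding psum_def[abs_def] by (intro borel_measurable_sum coord_measurable)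

lemma stays_nonpos_measurable [measurable]: "Measurable.pred S (stays_nonpos n)"
  unfolding stays_nonpos_def[abs_def] by measurable

lemma enters_pos_measurable [measurable]: "Measurable.pred S (enters_pos n)"
  unfolding enters_pos_def[abs_def] by measurable

lemma run_max_measurable [measurable]: "run_max \<in> borel_measurable S"
  unfolding run_max_def[abs_def] by measurable

lemma shift_measurable: "(\<lambda>y i. y (Suc i)) \<in> measurable S S"
proof (rule measurable_PiM_single')
  show "(\<lambda>y. y (Suc i)) \<in> measurable S G" for i
    by (rule measurable_component_singleton) simp
qed (auto simp: space_PiM PiE_UNIV_domain)

lemma fin_max_measurable [measurable]: "fin_max n \<in> borel_measurable S"
proof (induction n)
  case (Suc n)
  have "(\<lambda>y. fin_max n (\<lambda>i. y (Suc i))) \<in> borel_measurable S"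
    using measurable_compose[OF shift_measurable Suc] .
  then have "(\<lambda>y. max 0 (y 0 + fin_max n (\<lambda>i. y (Suc i)))) \<in> borel_measurable S"
    by (intro borel_measurable_max borel_measurable_add coord_measurable borel_measurable_const)
  moreover have "fin_max (Suc n) = (\<lambda>y. max 0 (y 0 + fin_max n (\<lambda>i. y (Suc i))))"
    by (simp add: fun_eq_iff)
  ultimately show ?case
    by (simp only:)
qed simp

lemma distr_shift: "distr S S (\<lambda>y i. y (Suc i)) = S"
  using distr_PiM_reindex[of UNIV "\<lambda>_. G" Suc UNIV] G.prob_space_axioms
  by (simp add: restrict_def)

lemma distr_coord: "distr S borel (\<lambda>y. y i) = G"
proof -
  have "distr S G (\<lambda>y. y i) = G"
    by (rule PiM_component) simp
  moreover have "distr S borel (\<lambda>y. y i) = distr S G (\<lambda>y. y i)"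
    by (rule distr_cong) simp_all
  ultimately show ?thesis
    by simp
qed

text \<open>
  Independence of past and future: a path of length \<open>n\<close> followed by an independent path is again
  distributed as a path.  The exceptional set of futures is needed because the maximum of a path
  may be infinite.
\<close>

lemma integral_comb_seq:
  fixes g a b :: "(nat \<Rightarrow> real) \<Rightarrow> complex"
  assumes meas: "g \<in> borel_measurable S" "a \<in> borel_measurable S" "b \<in> borel_measurable S"
    and bound: "\<And>y. norm (g y) \<le> 1"
    and good: "AE y' in S. Q y'" and eq: "\<And>y y'. Q y' \<Longrightarrow> g (comb_seq n y y') = a y * b y'"
  shows "(\<integral>y. g y \<partial>S) = (\<integral>y. a y \<partial>S) * (\<integral>y. b y \<partial>S)"
proof -
  note [measurable] = meas
  have gm: "(\<lambda>(y, y'). g (comb_seq n y y')) \<in> borel_measurable (S \<Otimes>\<^sub>M S)"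
    by measurable
  have "(\<integral>y. g y \<partial>S) = (\<integral>y. g y \<partial>distr (S \<Otimes>\<^sub>M S) S (\<lambda>(y, y'). comb_seq n y y'))"
    by (simp only: PiM_comb_seq)
  also have "\<dots> = (\<integral>(y, y'). g (comb_seq n y y') \<partial>(S \<Otimes>\<^sub>M S))"
    by (subst integral_distr[OF measurable_comb_seq meas(1)]) (simp add: case_prod_unfold)
  also have "\<dots> = (\<integral>y. \<integral>y'. g (comb_seq n y y') \<partial>S \<partial>S)"
    by (rule SS.integral_fst[symmetric], rule SS.integrable_const_bound[where B = 1])
       (use gm bound in \<open>auto simp: split_beta\<close>)
  also have "\<dots> = (\<integral>y. \<integral>y'. a y * b y' \<partial>S \<partial>S)"
  proof (rule Bochner_Integration.integral_cong[OF refl])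
    fix y assume "y \<in> space S"
    show "(\<integral>y'. g (comb_seq n y y') \<partial>S) = (\<integral>y'. a y * b y' \<partial>S)"
    proof (rule integral_cong_AE)
      show "AE y' in S. g (comb_seq n y y') = a y * b y'"
        using good by eventually_elim (rule eq)
    qed (use \<open>y \<in> space S\<close> in measurable)
  qed
  finally show ?thesis
    by simp
qed

definition part_law :: "((nat \<Rightarrow> real) \<Rightarrow> bool) \<Rightarrow> nat \<Rightarrow> real measure" where
  "part_law Q n = distr (density S (indicator {y. Q y})) borel (psum n)"

context
  fixes Q :: "(nat \<Rightarrow> real) \<Rightarrow> bool"
  assumes Q: "Measurable.pred S Q"
begin

lemma event_sets: "{y. Q y} \<in> sets S"
  using Q by (simp add: pred_def space_S)

lemma emeasure_part_law:
  assumes A: "A \<in> sets borel"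
  shows "emeasure (part_law Q n) A = emeasure S {y. Q y \<and> psum n y \<in> A}"
proof -
  have inv: "psum n -` A \<in> sets S"
    using measurable_sets[OF psum_measurable A] by (simp add: space_S)
  have "psum n \<in> borel_measurable (density S (indicator {y. Q y}))"
    unfolding measurable_density_eq1 by (rule psum_measurable)
  then have "emeasure (part_law Q n) A = emeasure (density S (indicator {y. Q y})) (psum n -` A)"
    unfolding part_law_def using A by (subst emeasure_distr) (simp_all only: space_density space_S Int_UNIV_right)
  also have "\<dots> = emeasure S ({y. Q y} \<inter> psum n -` A)"
    using event_sets inv by (rule emeasure_restricted)
  also have "{y. Q y} \<inter> psum n -` A = {y. Q y \<and> psum n y \<in> A}"
    by auto
  finally show ?thesis .
qed

lemma finite_borel_measure_part_law: "finite_borel_measure (part_law Q n)"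
proof -
  have sp: "space (part_law Q n) = UNIV" "sets (part_law Q n) = sets borel"
    by (simp_all add: part_law_def)
  have "emeasure (part_law Q n) (space (part_law Q n)) \<noteq> \<infinity>"
    unfolding sp by (subst emeasure_part_law) simp_all
  then have "finite_measure (part_law Q n)"
    by (rule finite_measureI)
  then show ?thesis
    by (simp add: finite_borel_measure_iff sp)
qed

lemma measure_part_law: "A \<in> sets borel \<Longrightarrow> measure (part_law Q n) A = measure S {y. Q y \<and> psum n y \<in> A}"
  by (simp add: measure_def emeasure_part_law)

lemma char_part_law: "char (part_law Q n) t = (\<integral>y. (if Q y then iexp (t * psum n y) else 0) \<partial>S)"
proof -
  have m: "psum n \<in> borel_measurable (density S (indicator {y. Q y}))"
    unfolding measurable_density_eq1 by (rule psum_measurable)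
  have "char (part_law Q n) t = (\<integral>y. iexp (t * psum n y) \<partial>density S (indicator {y. Q y}))"
    unfolding char_def part_law_def by (rule integral_distr[OF m]) simp
  also have "\<dots> = (\<integral>y. iexp (t * psum n y) \<partial>density S (\<lambda>y. ennreal (indicator {y. Q y} y)))"
    by (simp only: ennreal_indicator)
  also have "\<dots> = (\<integral>y. indicator {y. Q y} y *\<^sub>R iexp (t * psum n y) \<partial>S)"
  proof (rule integral_density)
    show "(\<lambda>y. iexp (t * psum n y)) \<in> borel_measurable S"
      by measurable
    show "indicator {y. Q y} \<in> borel_measurable S"
      using event_sets by (rule borel_measurable_indicator)
  qed simp
  also have "\<dots> = (\<integral>y. (if Q y then iexp (t * psum n y) else 0) \<partial>S)"
    by (intro Bochner_Integration.integral_cong) auto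
  finally show ?thesis .
qed

end

definition H :: "nat \<Rightarrow> real measure" where "H n = part_law (stays_nonpos n) n"
definition L :: "nat \<Rightarrow> real measure" where "L n = part_law (enters_pos n) n"

lemma char_G: "char G t = (\<integral>y. iexp (t * y i) \<partial>S)"
proof -
  have "char G t = char (distr S borel (\<lambda>y. y i)) t"
    by (simp add: distr_coord)
  also have "\<dots> = (\<integral>y. iexp (t * y i) \<partial>S)"
    unfolding char_def by (rule integral_distr[OF coord_measurable]) simp
  finally show ?thesis .
qed

lemma iexp_measurable:
  "(\<lambda>y. iexp (t * psum n y)) \<in> borel_measurable S" "(\<lambda>y. iexp (t * y n)) \<in> borel_measurable S"
proof -
  have "(\<lambda>x :: real. iexp (t * x)) \<in> borel_measurable borel"
    by measurable
  then show "(\<lambda>y. iexp (t * psum n y)) \<in> borel_measurable S" "(\<lambda>y. iexp (t * y n)) \<in> borel_measurable S"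
    by (rule measurable_compose[OF psum_measurable] measurable_compose[OF coord_measurable])+
qed

lemma restricted_measurable:
  fixes g :: "(nat \<Rightarrow> real) \<Rightarrow> complex"
  assumes "Measurable.pred S Q" "g \<in> borel_measurable S"
  shows "(\<lambda>y. if Q y then g y else 0) \<in> borel_measurable S"
  using assms by (intro measurable_If borel_measurable_const) (auto simp: pred_def)

sublocale killed_walk G H L
proof (unfold killed_walk_def, intro conjI allI)
  show "real_distribution G" by (rule G)
  have "{y. stays_nonpos n y \<and> psum n y \<in> {0<..}} = {}" for n
    by (auto simp: stays_nonpos_def not_le[symmetric])
  then show "finite_borel_measure (H n)" "measure (H n) {0<..} = 0" for n
    by (simp_all only: H_def finite_borel_measure_part_law stays_nonpos_measurable measure_part_law
        borel_open open_greaterThan measure_empty)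
  have "{y. enters_pos n y \<and> psum n y \<in> {..0}} = {}" for n
    by (auto simp: enters_pos_def)
  then show "finite_borel_measure (L n)" "measure (L n) {..0} = 0" for n
    by (simp_all only: L_def finite_borel_measure_part_law enters_pos_measurable measure_part_law
        borel_closed closed_atMost measure_empty)
  have "stays_nonpos 0 y" for y
    by (simp add: stays_nonpos_def)
  then show "char (H 0) t = 1" for t
    by (simp add: H_def char_part_law P.prob_space)
  show "char (H n) t * char G t = char (H (Suc n)) t + char (L (Suc n)) t" for n t
  proof -
    let ?i = "\<lambda>y. iexp (t * psum (Suc n) y)"
    have "(\<integral>y. (if stays_nonpos n y then ?i y else 0) \<partial>S) =
        (\<integral>y. (if stays_nonpos n y then iexp (t * psum n y) else 0) \<partial>S) * (\<integral>y. iexp (t * y 0) \<partial>S)"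
    proof (rule integral_comb_seq[where Q = "\<lambda>_. True" and n = n])
      show "(\<lambda>y. if stays_nonpos n y then ?i y else 0) \<in> borel_measurable S"
        "(\<lambda>y. if stays_nonpos n y then iexp (t * psum n y) else 0) \<in> borel_measurable S"
        "(\<lambda>y. iexp (t * y 0)) \<in> borel_measurable S"
        by (intro restricted_measurable stays_nonpos_measurable iexp_measurable)+
      fix y y' :: "nat \<Rightarrow> real"
      have "psum (Suc n) (comb_seq n y y') = psum n y + y' 0"
        using psum_comb_seq_add[of n 1 y y'] by (simp add: psum_def)
      then show "(if stays_nonpos n (comb_seq n y y') then ?i (comb_seq n y y') else 0) =
          (if stays_nonpos n y then iexp (t * psum n y) else 0) * iexp (t * y' 0)"
        by (simp add: stays_nonpos_comb_seq exp_add[symmetric] algebra_simps)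
    qed simp_all
    also have "\<dots> = char (H n) t * char G t"
      by (simp only: H_def char_part_law stays_nonpos_measurable char_G[of t 0])
    finally have 1: "char (H n) t * char G t = (\<integral>y. (if stays_nonpos n y then ?i y else 0) \<partial>S)" ..
    have i: "integrable S (\<lambda>y. if Q y then ?i y else 0)" if "Measurable.pred S Q" for Q
      by (rule P.integrable_const_bound[where B = 1])
         (use restricted_measurable[OF that iexp_measurable(1)] in auto)
    have "(\<integral>y. (if stays_nonpos n y then ?i y else 0) \<partial>S) =
        (\<integral>y. (if stays_nonpos (Suc n) y then ?i y else 0) + (if enters_pos (Suc n) y then ?i y else 0) \<partial>S)"
      using not_stays_and_enters[of "Suc n"] stays_nonpos_step[of n]
      by (intro Bochner_Integration.integral_cong) auto
    also have "\<dots> = char (H (Suc n)) t + char (L (Suc n)) t"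
      unfolding H_def L_def char_part_law[OF stays_nonpos_measurable] char_part_law[OF enters_pos_measurable]
      by (intro Bochner_Integration.integral_add i stays_nonpos_measurable enters_pos_measurable)
    finally show ?thesis
      unfolding 1 .
  qed
qed

lemma measure_L_UNIV: "measure (L n) UNIV = measure S {y. enters_pos n y}"
  by (simp add: L_def measure_part_law)

definition p :: real where "p = measure S {y. \<exists>n. enters_pos n y}"

lemma enters_pos_sets: "{y. enters_pos n y} \<in> sets S"
  by (rule event_sets) measurable

lemma disjoint_enters_pos: "disjoint_family (\<lambda>n. {y. enters_pos n y})"
  by (auto simp: disjoint_family_on_def dest: enters_pos_unique)

lemma L_sums: "(\<lambda>n. measure (L n) UNIV) sums p"
proof -
  have "(\<lambda>n. measure S {y. enters_pos n y}) sums measure S (\<Union>n. {y. enters_pos n y})"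
    using enters_pos_sets disjoint_enters_pos by (intro P.finite_measure_UNION) auto
  also have "(\<Union>n. {y. enters_pos n y}) = {y. \<exists>n. enters_pos n y}"
    by auto
  finally show ?thesis
    by (simp add: measure_L_UNIV p_def)
qed

lemma integral_over_entrance:
  fixes g :: "(nat \<Rightarrow> real) \<Rightarrow> complex"
  assumes g [measurable]: "g \<in> borel_measurable S" and bound: "\<And>y. norm (g y) \<le> 1"
  shows "(\<lambda>n. \<integral>y. (if enters_pos n y then g y else 0) \<partial>S) sums
    (\<integral>y. (if \<exists>n. enters_pos n y then g y else 0) \<partial>S)"
proof -
  let ?f = "\<lambda>n y. if enters_pos n y then g y else 0"
  have eq: "(\<lambda>n. ?f n y) sums (if \<exists>n. enters_pos n y then g y else 0)" for y
  proof (cases "\<exists>n. enters_pos n y")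
    case True
    then obtain m where m: "enters_pos m y"
      by auto
    then have "enters_pos n y \<longleftrightarrow> n = m" for n
      by (blast dest: enters_pos_unique)
    then show ?thesis
      using sums_single[of m "\<lambda>_. g y"] by simp
  qed simp
  have int: "integrable S (?f n)" for n
    using bound by (intro P.integrable_const_bound[where B = 1]) auto
  have "(\<lambda>n. \<integral>y. ?f n y \<partial>S) sums (\<integral>y. (\<Sum>n. ?f n y) \<partial>S)"
  proof (rule sums_integral[OF int])
    show "AE y in S. summable (\<lambda>n. norm (?f n y))"
    proof (rule AE_I2)
      fix y
      show "summable (\<lambda>n. norm (?f n y))"
      proof (cases "\<exists>n. enters_pos n y")
        case True
        then obtain m where "enters_pos m y"
          by auto
        then show ?thesis
          by (intro summable_finite[of "{m}"]) (auto dest: enters_pos_unique)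
      qed simp
    qed
    have "(\<integral>y. norm (?f n y) \<partial>S) \<le> measure (L n) UNIV" for n
    proof -
      have "(\<integral>y. norm (?f n y) \<partial>S) \<le> (\<integral>y. indicator {y. enters_pos n y} y \<partial>S)"
        using bound enters_pos_sets
        by (intro integral_mono integrable_norm int integrable_real_indicator) (auto simp: P.emeasure_eq_measure)
      then show ?thesis
        using enters_pos_sets by (simp add: measure_L_UNIV space_S)
    qed
    then show "summable (\<lambda>n. \<integral>y. norm (?f n y) \<partial>S)"
      by (intro summable_comparison_test'[OF sums_summable[OF L_sums], of 0]) auto
  qed
  then show ?thesis
    using eq by (simp add: sums_iff)
qed

end

section \<open>Negative drift\<close>

locale negative_drift = step_law +
  assumes integrable_G: "integrable G (\<lambda>x. x)" and mean_neg: "(\<integral>x. x \<partial>G) < 0"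
begin

lemma integrable_coord: "integrable S (\<lambda>y. y i)"
proof -
  have "integrable (distr S borel (\<lambda>y. y i)) (\<lambda>x. x)"
    by (simp only: distr_coord integrable_G)
  then show ?thesis
    by (subst (asm) integrable_distr_eq[OF coord_measurable]) simp_all
qed

lemma integral_coord: "(\<integral>y. y i \<partial>S) = (\<integral>x. x \<partial>G)"
proof -
  have "(\<integral>x. x \<partial>distr S borel (\<lambda>y. y i)) = (\<integral>y. y i \<partial>S)"
    by (rule integral_distr[OF coord_measurable]) simp
  then show ?thesis
    by (simp only: distr_coord)
qed

lemma integrable_fin_max: "integrable S (fin_max n)"
proof (rule Bochner_Integration.integrable_bound[OF _ fin_max_measurable])
  show "integrable S (\<lambda>y. \<Sum>i<n. \<bar>y i\<bar>)"
    by (intro Bochner_Integration.integrable_sum integrable_abs integrable_coord)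
  show "AE y in S. norm (fin_max n y) \<le> norm (\<Sum>i<n. \<bar>y i\<bar>)"
    using fin_max_nonneg fin_max_le by (intro AE_I2) (simp add: sum_nonneg)
qed

lemma fin_max_pos_measurable: "(\<lambda>y. if 0 < fin_max n y then y 0 else 0) \<in> borel_measurable S"
  by (intro measurable_If coord_measurable borel_measurable_const)
     (use borel_measurable_less[OF borel_measurable_const fin_max_measurable] in \<open>simp add: space_S\<close>)

text \<open>
  Integrate \<open>maximal_ineq_pointwise\<close>: the path and its shift have the same law, so the left-hand side
  has integral 0.
\<close>

lemma maximal_ergodic: "0 \<le> (\<integral>y. (if 0 < fin_max (Suc n) y then y 0 else 0) \<partial>S)"
proof -
  have "integrable (distr S S (\<lambda>y i. y (Suc i))) (fin_max (Suc n))"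
    by (simp only: distr_shift integrable_fin_max)
  then have i: "integrable S (\<lambda>y. fin_max (Suc n) (\<lambda>i. y (Suc i)))"
    by (simp only: integrable_distr_eq[OF shift_measurable fin_max_measurable])
  have "(\<integral>y. fin_max (Suc n) (\<lambda>i. y (Suc i)) \<partial>S) = (\<integral>y. fin_max (Suc n) y \<partial>distr S S (\<lambda>y i. y (Suc i)))"
    by (rule integral_distr[OF shift_measurable fin_max_measurable, symmetric])
  then have "(\<integral>y. fin_max (Suc n) y \<partial>S) - (\<integral>y. fin_max (Suc n) (\<lambda>i. y (Suc i)) \<partial>S) = 0"
    by (simp only: distr_shift diff_self)
  then have "0 = (\<integral>y. fin_max (Suc n) y - fin_max (Suc n) (\<lambda>i. y (Suc i)) \<partial>S)"
    using Bochner_Integration.integral_diff[OF integrable_fin_max i] by (simp del: fin_max.simps)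
  also have "\<dots> \<le> (\<integral>y. (if 0 < fin_max (Suc n) y then y 0 else 0) \<partial>S)"
  proof (rule integral_mono)
    show "integrable S (\<lambda>y. fin_max (Suc n) y - fin_max (Suc n) (\<lambda>i. y (Suc i)))"
      by (intro Bochner_Integration.integrable_diff integrable_fin_max i)
    have "(\<lambda>y. if 0 < fin_max (Suc n) y then y 0 else 0) \<in> borel_measurable S"
      by (rule fin_max_pos_measurable)
    then show "integrable S (\<lambda>y. if 0 < fin_max (Suc n) y then y 0 else 0)"
      by (rule Bochner_Integration.integrable_bound[OF integrable_coord[of 0]]) (intro AE_I2, simp)
  qed (rule maximal_ineq_pointwise)
  finally show ?thesis .
qed

text \<open>
  If the walk became positive almost surely, the event in \<open>maximal_ergodic\<close> would exhaust the space
  and the mean step would be nonnegative.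
\<close>

lemma p_less_1: "p < 1"
proof (rule ccontr)
  assume "\<not> p < 1"
  then have "p = 1"
    using P.prob_le_1[of "{y. \<exists>n. enters_pos n y}"] by (simp add: p_def)
  have "{y. \<exists>n. enters_pos n y} = (\<Union>n. {y. enters_pos n y})"
    by auto
  then have "{y. \<exists>n. enters_pos n y} \<in> sets S"
    using enters_pos_sets by auto
  then have ae: "AE y in S. \<exists>n. enters_pos n y"
    using P.AE_in_set_eq_1[of "{y. \<exists>n. enters_pos n y}"] \<open>p = 1\<close> by (simp add: p_def)
  have "(\<lambda>n. \<integral>y. (if 0 < fin_max (Suc n) y then y 0 else 0) \<partial>S) \<longlonglongrightarrow> (\<integral>y. y 0 \<partial>S)"
  proof (rule integral_dominated_convergence[where w = "\<lambda>y. \<bar>y 0\<bar>"])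
    show "(\<lambda>y. if 0 < fin_max (Suc n) y then y 0 else 0) \<in> borel_measurable S" for n
      by (rule fin_max_pos_measurable)
    show "AE y in S. (\<lambda>n. if 0 < fin_max (Suc n) y then y 0 else 0) \<longlonglongrightarrow> y 0"
      using ae
    proof eventually_elim
      case (elim y)
      then obtain k where k: "0 < psum k y"
        unfolding ex_enters_pos_iff by blast
      have "\<forall>\<^sub>F n in sequentially. (if 0 < fin_max (Suc n) y then y 0 else 0) = y 0"
        using eventually_ge_at_top[of k]
      proof eventually_elim
        case (elim n)
        then have "0 < fin_max (Suc n) y"
          using psum_le_fin_max[of k "Suc n" y] k by simp
        then show ?case
          by simp
      qed
      then show ?case
        by (rule tendsto_eventually)
    qed
  qed (auto intro: coord_measurable integrable_abs integrable_coord)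
  then have "0 \<le> (\<integral>y. y 0 \<partial>S)"
    by (rule LIMSEQ_le_const) (use maximal_ergodic in blast)
  then show False
    using mean_neg by (simp add: integral_coord)
qed

sublocale transient_killed_walk G H L p
proof unfold_locales
  have "{y. enters_pos 0 y} = {}"
    by (auto simp: enters_pos_def)
  then show "measure (L 0) UNIV = 0"
    by (simp add: measure_L_UNIV)
qed (fact L_sums p_less_1)+

lemma run_max_pred:
  "Measurable.pred S (\<lambda>y. run_max y = \<infinity>)" "Measurable.pred S (\<lambda>y. \<exists>n. enters_pos n y)"
  by measurable

text \<open>
  The maximum is infinite exactly if the walk enters the positive half line and the maximum after
  that is infinite.  So the probability \<open>q\<close> of this event satisfies \<open>q = p q\<close>, and \<open>p < 1\<close>.
\<close>

lemma AE_run_max_finite: "AE y in S. run_max y \<noteq> \<infinity>"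
proof -
  let ?b = "\<lambda>y. if run_max y = \<infinity> then (1 :: complex) else 0"
  define q where "q = (\<integral>y. ?b y \<partial>S)"
  have bm: "?b \<in> borel_measurable S"
    by (intro restricted_measurable run_max_pred borel_measurable_const)
  have "(\<integral>y. (if enters_pos n y then ?b y else 0) \<partial>S) = (\<integral>y. (if enters_pos n y then 1 else 0) \<partial>S) * q" for n
    unfolding q_def
  proof (rule integral_comb_seq[where Q = "\<lambda>_. True" and n = n])
    show "(\<lambda>y. if enters_pos n y then ?b y else 0) \<in> borel_measurable S"
      "(\<lambda>y. if enters_pos n y then 1 else 0 :: complex) \<in> borel_measurable S"
      by (intro restricted_measurable enters_pos_measurable bm borel_measurable_const)+
    show "(if enters_pos n (comb_seq n y y') then ?b (comb_seq n y y') else 0) =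
        (if enters_pos n y then 1 else 0) * ?b y'" for y y'
      by (auto simp: enters_pos_comb_seq run_max_comb_seq)
  qed (use bm in auto)
  moreover have "(\<integral>y. (if enters_pos n y then 1 else 0) \<partial>S) = complex_of_real (measure (L n) UNIV)" for n
  proof -
    have "(\<integral>y. (if enters_pos n y then 1 else 0) \<partial>S) = char (L n) 0"
      by (simp add: L_def char_part_law[OF enters_pos_measurable] cong: if_cong)
    then show ?thesis
      by (simp only: char_at_0)
  qed
  ultimately have "(\<lambda>n. complex_of_real (measure (L n) UNIV) * q) sums
      (\<integral>y. (if \<exists>n. enters_pos n y then ?b y else 0) \<partial>S)"
    using integral_over_entrance[OF bm] by simp
  moreover have "(\<lambda>n. complex_of_real (measure (L n) UNIV) * q) sums (complex_of_real p * q)"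
    using p(1) by (intro sums_mult2) (simp only: sums_of_real_iff)
  moreover have "(\<integral>y. (if \<exists>n. enters_pos n y then ?b y else 0) \<partial>S) = q"
    unfolding q_def by (intro Bochner_Integration.integral_cong) (auto simp: run_max_eq_0)
  ultimately have "complex_of_real p * q = q"
    using sums_unique2 by metis
  then have q0: "q = 0"
    using p(2) by (auto simp: mult_cancel_right1)
  have sets: "{y. run_max y = \<infinity>} \<in> sets S"
    using run_max_pred(1) by (simp add: pred_def space_S)
  have "q = (\<integral>y. complex_of_real (indicator {y. run_max y = \<infinity>} y) \<partial>S)"
    unfolding q_def by (intro Bochner_Integration.integral_cong) auto
  also have "\<dots> = complex_of_real (measure S {y. run_max y = \<infinity>})"
    using sets by (simp add: space_S)
  finally have "measure S {y. run_max y = \<infinity>} = 0"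
    using q0 by simp
  then show ?thesis
    using sets by (intro AE_I[where N = "{y. run_max y = \<infinity>}"]) (auto simp: P.emeasure_eq_measure)
qed

definition max_law :: "real measure" where
  "max_law = distr S borel (\<lambda>y. real_of_ereal (run_max y))"

lemma real_run_max_measurable: "(\<lambda>y. real_of_ereal (run_max y)) \<in> borel_measurable S"
  by measurable

lemma real_distribution_max_law: "real_distribution max_law"
  unfolding max_law_def real_distribution_def real_distribution_axioms_def
  using P.prob_space_distr[OF real_run_max_measurable] by simp

lemma nonneg_max_law: "nonneg_measure max_law"
proof -
  interpret m: real_distribution max_law
    by (rule real_distribution_max_law)
  have "(\<lambda>y. real_of_ereal (run_max y)) -` {..<0} \<inter> space S = {}"
    using real_of_ereal_pos[OF run_max_nonneg] by (auto simp: not_le[symmetric])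
  then have "measure max_law {..<0} = 0"
    unfolding max_law_def using real_run_max_measurable by (subst measure_distr) simp_all
  then show ?thesis
    by (simp add: nonneg_measure_def m.finite_borel_measure_axioms)
qed

text \<open>
  The maximum is 0 if the walk never becomes positive; otherwise it is the first positive value plus
  an independent copy of the maximum.
\<close>

lemma char_max_law: "char max_law t * (1 - (\<Sum>n. char (L n) t)) = complex_of_real (1 - p)"
proof -
  let ?g = "\<lambda>y. iexp (t * real_of_ereal (run_max y))"
  have gm: "?g \<in> borel_measurable S"
  proof -
    have "(\<lambda>x :: real. iexp (t * x)) \<in> borel_measurable borel"
      by measurable
    then show ?thesis
      by (rule measurable_compose[OF real_run_max_measurable])
  qed
  have cm: "char max_law t = (\<integral>y. ?g y \<partial>S)"
    unfolding char_def max_law_def by (rule integral_distr[OF real_run_max_measurable]) simp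
  have fac: "(\<integral>y. (if enters_pos n y then ?g y else 0) \<partial>S) = char (L n) t * char max_law t" for n
  proof -
    have "(\<integral>y. (if enters_pos n y then ?g y else 0) \<partial>S) =
        (\<integral>y. (if enters_pos n y then iexp (t * psum n y) else 0) \<partial>S) * (\<integral>y. ?g y \<partial>S)"
    proof (rule integral_comb_seq[where Q = "\<lambda>y. run_max y \<noteq> \<infinity>" and n = n])
      show "(\<lambda>y. if enters_pos n y then ?g y else 0) \<in> borel_measurable S"
        "(\<lambda>y. if enters_pos n y then iexp (t * psum n y) else 0) \<in> borel_measurable S"
        by (intro restricted_measurable enters_pos_measurable gm iexp_measurable)+
      fix y y' assume "run_max y' \<noteq> \<infinity>"
      moreover have "run_max y' \<noteq> - \<infinity>"
        using run_max_nonneg[of y'] by auto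
      ultimately obtain r where r: "run_max y' = ereal r"
        by (cases "run_max y'") auto
      show "(if enters_pos n (comb_seq n y y') then ?g (comb_seq n y y') else 0) =
          (if enters_pos n y then iexp (t * psum n y) else 0) * ?g y'"
        by (simp add: enters_pos_comb_seq run_max_comb_seq r exp_add[symmetric] algebra_simps)
    qed (use gm AE_run_max_finite in auto)
    then show ?thesis
      by (simp only: L_def char_part_law[OF enters_pos_measurable] cm)
  qed
  have i: "integrable S (\<lambda>y. if Q y then ?g y else 0)" if "Measurable.pred S Q" for Q
    by (rule P.integrable_const_bound[where B = 1])
       (use restricted_measurable[OF that gm] in auto)
  have sets: "{y. \<not> (\<exists>n. enters_pos n y)} \<in> sets S"
    using pred_intros_logic(2)[OF run_max_pred(2)] by (simp add: pred_def space_S)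
  have "char max_law t = (\<integral>y. (if \<exists>n. enters_pos n y then ?g y else 0) +
      complex_of_real (indicator {y. \<not> (\<exists>n. enters_pos n y)} y) \<partial>S)"
    unfolding cm by (intro Bochner_Integration.integral_cong) (auto simp: run_max_eq_0)
  also have "\<dots> = (\<integral>y. (if \<exists>n. enters_pos n y then ?g y else 0) \<partial>S) +
      (\<integral>y. complex_of_real (indicator {y. \<not> (\<exists>n. enters_pos n y)} y) \<partial>S)"
    using sets by (intro Bochner_Integration.integral_add i run_max_pred integrable_of_real integrable_real_indicator)
      (auto simp: P.emeasure_eq_measure)
  also have "(\<integral>y. (if \<exists>n. enters_pos n y then ?g y else 0) \<partial>S) = (\<Sum>n. char (L n) t * char max_law t)"
    using integral_over_entrance[OF gm] by (simp add: fac sums_iff)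
  also have "\<dots> = (\<Sum>n. char (L n) t) * char max_law t"
    by (rule suminf_mult2[symmetric])
       (rule summable_comparison_test'[OF sums_summable[OF p(1)] norm_char_le[OF L(1)]])
  also have "(\<integral>y. complex_of_real (indicator {y. \<not> (\<exists>n. enters_pos n y)} y) \<partial>S) = complex_of_real (1 - p)"
  proof -
    have "{y. \<not> (\<exists>n. enters_pos n y)} = space S - {y. \<exists>n. enters_pos n y}"
      by (auto simp: space_S)
    moreover have "{y. \<exists>n. enters_pos n y} \<in> sets S"
      using run_max_pred(2) by (simp add: pred_def space_S)
    ultimately have "measure S {y. \<not> (\<exists>n. enters_pos n y)} = 1 - p"
      by (simp only: P.prob_compl p_def)
    then show ?thesis
      using sets by (simp add: space_S)
  qed
  finally show ?thesis
    by (simp add: algebra_simps)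
qed

definition ladder_law :: "real measure" where
  "ladder_law = mixture (\<lambda>_. 1) L"

lemma
  shows finite_borel_measure_ladder_law: "finite_borel_measure ladder_law"
    and mass_ladder_law: "measure ladder_law UNIV = p"
    and nonneg_ladder_law: "nonneg_measure ladder_law"
    and char_ladder_law: "char ladder_law t = (\<Sum>n. char (L n) t)"
proof -
  have s: "summable (\<lambda>n. 1 * measure (L n) UNIV)"
    using p(1) by (simp add: sums_iff)
  show f: "finite_borel_measure ladder_law"
    unfolding ladder_law_def using L(1) _ s by (rule finite_borel_measure_mixture) simp
  have m: "(\<lambda>n. 1 * measure (L n) A) sums measure ladder_law A" if "A \<in> sets borel" for A
    unfolding ladder_law_def using L(1) _ s that by (rule measure_mixture_sums) simp
  show "measure ladder_law UNIV = p"
    using m[of UNIV] p(1) by (simp add: sums_iff)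
  have "measure (L n) {..<0} = 0" for n
  proof -
    have "measure (L n) {..<0} \<le> measure (L n) {..0}"
      using finite_borel_measureD[OF L(1)] by (intro finite_measure.finite_measure_mono) auto
    then show ?thesis
      by (simp add: L(2) measure_le_0_iff)
  qed
  then show "nonneg_measure ladder_law"
    using m[of "{..<0}"] f by (simp add: nonneg_measure_def sums_iff)
  have "(\<lambda>n. complex_of_real 1 * char (L n) t) sums char ladder_law t"
    unfolding ladder_law_def using L(1) _ s by (rule char_mixture_sums) simp
  then show "char ladder_law t = (\<Sum>n. char (L n) t)"
    by (simp add: sums_iff)
qed

text \<open>
  The mixture starts at \<open>n = 0\<close>, where the weight \<open>1 / 0\<close> is 0.
\<close>

lemma harmonic_eq: "harmonic G = mixture (\<lambda>n. 1 / real n) U"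
proof (rule measure_eqI)
  fix A assume "A \<in> sets (harmonic G)"
  then have A: "A \<in> sets borel"
    by simp
  have eU: "emeasure (U n) A = emeasure (conv_power n G) (A \<inter> {0<..})" for n
    using A by (simp add: U_def tail_def emeasure_restricted Int_commute)
  let ?f = "\<lambda>n. ennreal (1 / real n) * emeasure (U n) A"
  have "emeasure (mixture (\<lambda>n. 1 / real n) U) A = (\<Sum>n. ?f n)"
    using A finite_borel_measureD(2)[OF U(1)] by (simp add: emeasure_mixture)
  also have "\<dots> = (\<Sum>n. ?f (n + 1))"
    using suminf_offset[OF summableI, of ?f 1] by simp
  also have "\<dots> = emeasure (harmonic G) A"
    using A by (simp add: emeasure_harmonic eU)
  finally show "emeasure (harmonic G) A = emeasure (mixture (\<lambda>n. 1 / real n) U) A" ..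
qed simp

lemma
  shows finite_borel_measure_harmonic: "finite_borel_measure (harmonic G)"
    and char_harmonic: "char (harmonic G) t = - Ln (1 - char ladder_law t)"
    and measure_harmonic_nonpos: "measure (harmonic G) {..0} = 0"
proof -
  have s: "summable (\<lambda>n. 1 / real n * measure (U n) UNIV)"
    using summable_U by simp
  show "finite_borel_measure (harmonic G)"
    unfolding harmonic_eq using U(1) _ s by (rule finite_borel_measure_mixture) simp
  have "(\<lambda>n. complex_of_real (1 / real n) * char (U n) t) sums char (harmonic G) t"
    unfolding harmonic_eq using U(1) _ s by (rule char_mixture_sums) simp
  then show "char (harmonic G) t = - Ln (1 - char ladder_law t)"
    using sums_unique2[OF _ spitzer_char[of t]] by (simp add: char_ladder_law)
  have "(\<lambda>n. 1 / real n * measure (U n) {..0}) sums measure (harmonic G) {..0}"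
    unfolding harmonic_eq using U(1) _ s by (rule measure_mixture_sums) simp_all
  then show "measure (harmonic G) {..0} = 0"
    by (simp add: U(2) sums_iff)
qed

end

section \<open>The classes of local distributions in terms of ratios\<close>

lemma asymp_equiv_scaled_iff:
  fixes g h :: "real \<Rightarrow> real"
  assumes g: "\<forall>\<^sub>F x in at_top. 0 < g x" and a: "0 < a"
  shows "h \<sim>[at_top] (\<lambda>x. a * g x) \<longleftrightarrow> ((\<lambda>x. h x / g x) \<longlongrightarrow> a) at_top"
proof
  assume "h \<sim>[at_top] (\<lambda>x. a * g x)"
  then have lim: "((\<lambda>x. if h x = 0 \<and> a * g x = 0 then 1 else h x / (a * g x)) \<longlongrightarrow> 1) at_top"
    by (rule asymp_equivD)
  have "\<forall>\<^sub>F x in at_top. a * (if h x = 0 \<and> a * g x = 0 then 1 else h x / (a * g x)) = h x / g x"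
    using g by eventually_elim (use a in auto)
  with tendsto_mult[OF tendsto_const lim, of a] show "((\<lambda>x. h x / g x) \<longlongrightarrow> a) at_top"
    by (simp add: tendsto_cong)
next
  assume "((\<lambda>x. h x / g x) \<longlongrightarrow> a) at_top"
  then have "((\<lambda>x. h x / g x / a) \<longlongrightarrow> a / a) at_top"
    by (rule tendsto_divide) (use a in auto)
  then show "h \<sim>[at_top] (\<lambda>x. a * g x)"
    using a by (intro asymp_equivI') (simp add: mult.commute)
qed

lemma class_L_iff:
  assumes c: "0 < c" and F: "nonneg_measure F"
  shows "class_L c F \<longleftrightarrow> local_long_tail c F"
proof
  assume *: "class_L c F"
  interpret F: real_distribution F
    using * by (simp add: class_L_def)
  have lt: "long_tailed (loc c F)"
    using * by (simp add: class_L_def)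
  have pos: "\<forall>\<^sub>F x in at_top. 0 < loc c F x"
    using lt by (auto simp: long_tailed_def eventually_at_top_linorder)
  show "local_long_tail c F"
  proof
    show "measure F UNIV = 1"
      using F.prob_space by simp
    fix y :: real assume "0 < y"
    then have "(\<lambda>x. loc c F (x + y)) \<sim>[at_top] loc c F"
      using lt by (simp add: long_tailed_def)
    then show "((\<lambda>x. loc c F (x + y) / loc c F x) \<longlongrightarrow> 1) at_top"
      using asymp_equiv_scaled_iff[OF pos, of 1] by simp
  qed fact+
next
  assume "local_long_tail c F"
  then interpret local_long_tail c F .
  have "real_distribution F"
  proof (unfold real_distribution_def real_distribution_axioms_def, intro conjI prob_spaceI)
    show "emeasure F (space F) = 1"
      using F_mass by (simp add: FD(4) finite_measure.emeasure_eq_measure[OF FD(2)])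
  qed (rule FD)
  moreover have "long_tailed (loc c F)"
    unfolding long_tailed_def
  proof (intro conjI allI impI)
    obtain x0 where "\<And>x. x0 \<le> x \<Longrightarrow> 0 < loc c F x"
      using eventually_positive by (auto simp: eventually_at_top_linorder)
    then show "\<exists>x0>0. \<forall>x\<ge>x0. 0 < loc c F x"
      by (intro exI[of _ "max 1 x0"]) auto
    fix y :: real assume "0 < y"
    then show "(\<lambda>x. loc c F (x + y)) \<sim>[at_top] loc c F"
      by (intro asymp_equivI' shift_pos)
  qed (auto intro: borel_measurable_loc FD)
  ultimately show "class_L c F"
    by (simp add: class_L_def)
qed

lemma class_S_iff:
  assumes c: "0 < c" and F: "nonneg_measure F"
  shows "class_S c F \<longleftrightarrow> local_subexponential c F"
proof (cases "local_long_tail c F")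
  case True
  then interpret local_long_tail c F .
  show ?thesis
    using True asymp_equiv_scaled_iff[OF eventually_positive, of 2]
    by (simp add: class_S_def class_L_iff[OF c F] local_subexponential_def
        local_subexponential_axioms_def ratio_lim_def)
next
  case False
  then show ?thesis
    by (simp add: class_S_def class_L_iff[OF c F] local_subexponential_def)
qed

context local_subexponential
begin

text \<open>
  Dividing by \<open>loc c M / f\<close>, which has a positive limit, exchanges the yardstick.
\<close>

lemma local_subexponential_transfer:
  assumes M: "nonneg_measure M" "measure M UNIV = 1" and a: "ratio_lim M a" "0 < a"
  shows "local_subexponential c M"
proof -
  have pos: "\<forall>\<^sub>F x in at_top. 0 < loc c M x"
  proof -
    have "\<forall>\<^sub>F x in at_top. 0 < loc c M x / f x"
      using a unfolding ratio_lim_def by (intro order_tendstoD)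
    with eventually_positive show ?thesis
      by eventually_elim (simp add: zero_less_divide_iff)
  qed
  have quot: "((\<lambda>x. g x / loc c M x) \<longlongrightarrow> b / a) at_top" if "((\<lambda>x. g x / f x) \<longlongrightarrow> b) at_top" for g b
  proof -
    have lim: "((\<lambda>x. (g x / f x) / (loc c M x / f x)) \<longlongrightarrow> b / a) at_top"
      using that a unfolding ratio_lim_def by (intro tendsto_divide) auto
    have "\<forall>\<^sub>F x in at_top. (g x / f x) / (loc c M x / f x) = g x / loc c M x"
      using eventually_positive by eventually_elim simp
    then show ?thesis
      by (rule Lim_transform_eventually[OF lim])
  qed
  interpret M: local_long_tail c M
  proof
    fix y :: real assume "0 < y"
    have "((\<lambda>x. loc c M (x + y) / f x) \<longlongrightarrow> a) at_top"
      using ratio_lim_shift[OF a(1), of "- y"] by simp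
    from quot[OF this] show "((\<lambda>x. loc c M (x + y) / loc c M x) \<longlongrightarrow> 1) at_top"
      using a by simp
  qed (fact c_pos M pos)+
  have "ratio_lim (convolution M M) (a * measure M UNIV + a * measure M UNIV)"
    by (intro ratio_lim_conv M a)
  then have "M.ratio_lim (convolution M M) ((a * measure M UNIV + a * measure M UNIV) / a)"
    unfolding ratio_lim_def M.ratio_lim_def by (rule quot)
  then have "M.ratio_lim (convolution M M) 2"
    using a M by simp
  then show ?thesis
    by unfold_locales
qed

end

lemma loc_scale: "0 \<le> r \<Longrightarrow> loc c (scale_measure (ennreal r) M) x = r * loc c M x"
  by (simp add: loc_def)

lemma nonneg_measure_scale: "nonneg_measure M \<Longrightarrow> 0 \<le> r \<Longrightarrow> nonneg_measure (scale_measure (ennreal r) M)"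
  by (simp add: nonneg_measure_def finite_borel_measure_scale)

lemma mixture_conv_power_eqI:
  assumes F: "finite_borel_measure F" "measure F UNIV = 1" and M: "finite_borel_measure M"
    and a: "\<And>n. 0 \<le> a n" "summable a"
    and eq: "\<And>t. (\<lambda>n. complex_of_real (a n) * char F t ^ n) sums char M t"
  shows "mixture a (\<lambda>n. conv_power n F) = M"
proof (rule finite_borel_measure_eqI_char)
  have s: "summable (\<lambda>n. a n * measure (conv_power n F) UNIV)"
    using a by (simp add: measure_conv_power_UNIV F)
  note cp = finite_borel_measure_conv_power[OF F(1)]
  show "finite_borel_measure (mixture a (\<lambda>n. conv_power n F))"
    using cp a(1) s by (rule finite_borel_measure_mixture)
  show "char (mixture a (\<lambda>n. conv_power n F)) t = char M t" for t
  proof -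
    have "(\<lambda>n. complex_of_real (a n) * char (conv_power n F) t) sums char (mixture a (\<lambda>n. conv_power n F)) t"
      using cp a(1) s by (rule char_mixture_sums)
    then show ?thesis
      using eq[of t] sums_unique2 by (simp add: char_conv_power F) blast
  qed
qed (rule M)

section \<open>The five conditions for a ladder height distribution\<close>

text \<open>
  The analytic content of the random walk: \<open>\<Lambda>\<close> is the defective ladder height distribution, \<open>\<pi>\<close> the law
  of the maximum and \<open>\<nu>\<close> the harmonic measure.
\<close>

locale ladder_triple =
  fixes c :: real and \<pi> \<nu> \<Lambda> :: "real measure" and p :: real
  assumes c: "0 < c" and \<pi>: "nonneg_measure \<pi>" "measure \<pi> UNIV = 1"
    and \<Lambda>: "nonneg_measure \<Lambda>" "measure \<Lambda> UNIV = p" and p: "0 < p" "p < 1"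
    and \<nu>: "nonneg_measure \<nu>"
    and char_\<pi>: "char \<pi> t * (1 - char \<Lambda> t) = complex_of_real (1 - p)"
    and char_\<nu>: "char \<nu> t = - Ln (1 - char \<Lambda> t)"
begin

definition B :: real where "B = - ln (1 - p)"
definition G0 :: "real measure" where "G0 = scale_measure (ennreal (1 / p)) \<Lambda>"
definition \<nu>1 :: "real measure" where "\<nu>1 = scale_measure (ennreal (1 / B)) \<nu>"

lemma B_pos: "0 < B"
  using p by (simp add: B_def)

lemma norm_char_\<Lambda>: "norm (char \<Lambda> t) < 1"
  using norm_char_le[OF nonneg_measureD(1)[OF \<Lambda>(1)], of t] \<Lambda>(2) p by simp

lemma mass_\<nu>: "measure \<nu> UNIV = B"
proof -
  have "1 - complex_of_real p = complex_of_real (1 - p)"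
    by simp
  then have "Ln (1 - complex_of_real p) = complex_of_real (ln (1 - p))"
    using p by (simp only: Ln_of_real)
  then have "complex_of_real (measure \<nu> UNIV) = complex_of_real B"
    using char_\<nu>[of 0] by (simp add: char_0 nonneg_measureD(4)[OF \<nu>] nonneg_measureD(4)[OF \<Lambda>(1)] \<Lambda>(2) B_def)
  then show ?thesis
    by (simp only: of_real_eq_iff)
qed

lemma G0: "nonneg_measure G0" "measure G0 UNIV = 1" "char G0 t = char \<Lambda> t / p" "loc c G0 x = loc c \<Lambda> x / p"
  using p by (simp_all add: G0_def nonneg_measure_scale \<Lambda> char_scale nonneg_measureD[OF \<Lambda>(1)] loc_scale)

lemma \<nu>1: "nonneg_measure \<nu>1" "measure \<nu>1 UNIV = 1" "char \<nu>1 t = char \<nu> t / B" "loc c \<nu>1 x = loc c \<nu> x / B"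
  using B_pos by (simp_all add: \<nu>1_def nonneg_measure_scale \<nu> char_scale nonneg_measureD[OF \<nu>] loc_scale mass_\<nu>)

lemma char_\<pi>_eq: "char \<pi> t = complex_of_real (1 - p) / (1 - char \<Lambda> t)" and char_\<Lambda>_neq_1: "1 - char \<Lambda> t \<noteq> 0"
proof -
  show "1 - char \<Lambda> t \<noteq> 0"
    using norm_char_\<Lambda>[of t] by auto
  then show "char \<pi> t = complex_of_real (1 - p) / (1 - char \<Lambda> t)"
    using char_\<pi>[of t] by (simp add: eq_divide_eq)
qed

text \<open>
  The next three representations are the expansions of \<open>1 / (1 - w)\<close>, \<open>- Ln (1 - w)\<close> and \<open>exp w\<close>.
\<close>

lemma \<pi>_geometric: "\<pi> = mixture (\<lambda>n. (1 - p) * p ^ n) (\<lambda>n. conv_power n G0)"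
proof (rule mixture_conv_power_eqI[symmetric])
  show "summable (\<lambda>n. (1 - p) * p ^ n)"
    using p by (intro summable_mult summable_geometric) auto
  fix t
  have "(\<lambda>n. complex_of_real (1 - p) * char \<Lambda> t ^ n) sums (complex_of_real (1 - p) * (1 / (1 - char \<Lambda> t)))"
    by (intro sums_mult geometric_sums norm_char_\<Lambda>)
  then show "(\<lambda>n. complex_of_real ((1 - p) * p ^ n) * char G0 t ^ n) sums char \<pi> t"
    using p by (simp add: G0 power_divide char_\<pi>_eq)
qed (use p in \<open>auto simp: G0 \<pi> nonneg_measureD\<close>)

lemma \<nu>_log: "\<nu> = mixture (\<lambda>n. p ^ n / real n) (\<lambda>n. conv_power n G0)"
proof (rule mixture_conv_power_eqI[symmetric])
  have "p ^ n / real n \<le> p ^ n" for n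
    using p by (cases "n = 0") (auto simp: divide_le_eq mult_le_cancel_left1)
  then show "summable (\<lambda>n. p ^ n / real n)"
    using p by (intro summable_comparison_test'[OF summable_geometric, of p 0]) auto
  fix t
  have "(\<lambda>n. - (- ((- (- char \<Lambda> t)) ^ n) / of_nat n)) sums (- Ln (1 + - char \<Lambda> t))"
    by (intro sums_minus Ln_series') (simp add: norm_char_\<Lambda>)
  then show "(\<lambda>n. complex_of_real (p ^ n / real n) * char G0 t ^ n) sums char \<nu> t"
    using p by (simp add: G0 power_divide char_\<nu>)
qed (use p in \<open>auto simp: G0 \<nu> nonneg_measureD\<close>)

lemma \<pi>_exp: "\<pi> = mixture (\<lambda>n. exp (- B) * (B ^ n / fact n)) (\<lambda>n. conv_power n \<nu>1)"
proof (rule mixture_conv_power_eqI[symmetric])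
  show "summable (\<lambda>n. exp (- B) * (B ^ n / fact n))"
    using summable_exp[of B] by (intro summable_mult) (simp add: field_simps)
  fix t
  have "(\<lambda>n. complex_of_real (exp (- B)) * (char \<nu> t ^ n /\<^sub>R fact n)) sums
      (complex_of_real (exp (- B)) * exp (char \<nu> t))"
    by (intro sums_mult exp_converges)
  also have "complex_of_real (exp (- B)) * exp (char \<nu> t) = char \<pi> t"
    using p char_\<Lambda>_neq_1[of t] by (simp add: char_\<nu> exp_minus B_def char_\<pi>_eq divide_inverse)
  finally have "(\<lambda>n. complex_of_real (exp (- B)) * (char \<nu> t ^ n /\<^sub>R fact n)) sums char \<pi> t" .
  moreover have "complex_of_real (exp (- B)) * (char \<nu> t ^ n /\<^sub>R fact n) =
      complex_of_real (exp (- B) * (B ^ n / fact n)) * char \<nu>1 t ^ n" for n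
    using B_pos by (simp add: \<nu>1 power_divide scaleR_conv_of_real field_simps)
  ultimately show "(\<lambda>n. complex_of_real (exp (- B) * (B ^ n / fact n)) * char \<nu>1 t ^ n) sums char \<pi> t"
    by simp
qed (use B_pos in \<open>auto simp: \<nu>1 \<pi> nonneg_measureD\<close>)

lemma sum_geometric: "(\<Sum>n. real n * ((1 - p) * p ^ n)) = p / (1 - p)" "summable (\<lambda>n. real n * ((1 - p) * p ^ n))"
proof -
  have "(\<lambda>n. real (Suc n) * p ^ n) sums (1 / (1 - p)\<^sup>2)"
    using geometric_deriv_sums[of p] p by simp
  from sums_mult[OF this, of "(1 - p) * p"]
  have "(\<lambda>n. real (Suc n) * ((1 - p) * p ^ Suc n)) sums ((1 - p) * p * (1 / (1 - p)\<^sup>2))"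
    by (simp add: algebra_simps)
  then have "(\<lambda>n. real n * ((1 - p) * p ^ n)) sums ((1 - p) * p * (1 / (1 - p)\<^sup>2))"
    using sums_Suc_iff[of "\<lambda>n. real n * ((1 - p) * p ^ n)"] by simp
  also have "(1 - p) * p * (1 / (1 - p)\<^sup>2) = p / (1 - p)"
    using p by (simp add: power2_eq_square)
  finally show "(\<Sum>n. real n * ((1 - p) * p ^ n)) = p / (1 - p)" "summable (\<lambda>n. real n * ((1 - p) * p ^ n))"
    by (simp_all add: sums_iff)
qed

lemma sum_log: "(\<Sum>n. real n * (p ^ n / real n)) = p / (1 - p)"
proof -
  have "(\<lambda>n. p * p ^ n) sums (p * (1 / (1 - p)))"
    using p by (intro sums_mult geometric_sums) auto
  then have "(\<lambda>n. real (Suc n) * (p ^ Suc n / real (Suc n))) sums (p / (1 - p))"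
    by (simp del: of_nat_Suc)
  then have "(\<lambda>n. real n * (p ^ n / real n)) sums (p / (1 - p))"
    by (subst (asm) sums_Suc_iff) simp
  then show ?thesis
    by (simp add: sums_iff)
qed

lemma sum_exp: "(\<Sum>n. real n * (exp (- B) * (B ^ n / fact n))) = B" "summable (\<lambda>n. real n * (exp (- B) * (B ^ n / fact n)))"
proof -
  have "(\<lambda>n. exp (- B) * B * (B ^ n /\<^sub>R fact n)) sums (exp (- B) * B * exp B)"
    by (intro sums_mult exp_converges)
  moreover have "exp (- B) * B * (B ^ n /\<^sub>R fact n) = real (Suc n) * (exp (- B) * (B ^ Suc n / fact (Suc n)))" for n
    by (simp add: field_simps del: of_nat_Suc)
  ultimately have "(\<lambda>n. real (Suc n) * (exp (- B) * (B ^ Suc n / fact (Suc n)))) sums (exp (- B) * B * exp B)"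
    by simp
  then have "(\<lambda>n. real n * (exp (- B) * (B ^ n / fact n))) sums (exp (- B) * B * exp B)"
    by (subst (asm) sums_Suc_iff) simp
  then show "(\<Sum>n. real n * (exp (- B) * (B ^ n / fact n))) = B" "summable (\<lambda>n. real n * (exp (- B) * (B ^ n / fact n)))"
    by (simp_all add: sums_iff exp_minus)
qed

text \<open>
  Any \<open>z\<close> with \<open>1 < z < 1 / p\<close> serves in \<open>ratio_lim_mixture\<close>; this is the harmonic mean of the two bounds.
\<close>

lemma radius: "1 < 2 / (1 + p)" "summable (\<lambda>n. p ^ n * (2 / (1 + p)) ^ n)"
proof -
  show "1 < 2 / (1 + p)"
    using p by simp
  have "p * (2 / (1 + p)) < 1"
    using p by (simp add: divide_less_eq)
  then show "summable (\<lambda>n. p ^ n * (2 / (1 + p)) ^ n)"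
    using p unfolding power_mult_distrib[symmetric] by (intro summable_geometric) auto
qed

lemma subexponential_G0_imp:
  assumes "local_subexponential c G0"
  shows "((\<lambda>x. loc c \<pi> x / loc c G0 x) \<longlongrightarrow> p / (1 - p)) at_top"
    and "((\<lambda>x. loc c \<nu> x / loc c G0 x) \<longlongrightarrow> p / (1 - p)) at_top"
proof -
  interpret local_subexponential c G0 by fact
  have "ratio_lim (mixture (\<lambda>n. (1 - p) * p ^ n) (\<lambda>n. conv_power n G0)) (\<Sum>n. real n * ((1 - p) * p ^ n))"
  proof (rule ratio_lim_mixture[OF _ radius(1)])
    show "summable (\<lambda>n. (1 - p) * p ^ n * (2 / (1 + p)) ^ n)"
      unfolding mult.assoc by (intro summable_mult radius)
  qed (use p in auto)
  then show "((\<lambda>x. loc c \<pi> x / loc c G0 x) \<longlongrightarrow> p / (1 - p)) at_top"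
    by (simp only: ratio_lim_def \<pi>_geometric[symmetric] sum_geometric)
  have "ratio_lim (mixture (\<lambda>n. p ^ n / real n) (\<lambda>n. conv_power n G0)) (\<Sum>n. real n * (p ^ n / real n))"
  proof (rule ratio_lim_mixture[OF _ radius(1)])
    have "p ^ n / real n \<le> p ^ n" for n
      using p by (cases "n = 0") (auto simp: divide_le_eq mult_le_cancel_left1)
    then have "p ^ n / real n * (2 / (1 + p)) ^ n \<le> p ^ n * (2 / (1 + p)) ^ n" for n
      using p by (intro mult_right_mono) auto
    then show "summable (\<lambda>n. p ^ n / real n * (2 / (1 + p)) ^ n)"
      using p by (intro summable_comparison_test'[OF radius(2), of 0]) simp_all
  qed (use p in auto)
  then show "((\<lambda>x. loc c \<nu> x / loc c G0 x) \<longlongrightarrow> p / (1 - p)) at_top"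
    by (simp only: ratio_lim_def \<nu>_log[symmetric] sum_log)
qed

lemma subexponential_\<nu>1_imp:
  assumes "local_subexponential c \<nu>1"
  shows "local_subexponential c \<pi>"
proof -
  interpret local_subexponential c \<nu>1 by fact
  have "ratio_lim (mixture (\<lambda>n. exp (- B) * (B ^ n / fact n)) (\<lambda>n. conv_power n \<nu>1))
      (\<Sum>n. real n * (exp (- B) * (B ^ n / fact n)))"
  proof (rule ratio_lim_mixture[where z = 2])
    have "summable (\<lambda>n. exp (- B) * ((2 * B) ^ n /\<^sub>R fact n))"
      by (intro summable_mult summable_exp_generic)
    then show "summable (\<lambda>n. exp (- B) * (B ^ n / fact n) * 2 ^ n)"
      by (simp add: power_mult_distrib field_simps)
  qed (use B_pos in auto)
  then have "ratio_lim \<pi> B"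
    by (simp only: \<pi>_exp[symmetric] sum_exp)
  then show ?thesis
    using \<pi> B_pos by (intro local_subexponential_transfer)
qed

lemma long_tail_\<nu>1_imp:
  assumes "local_long_tail c \<nu>1" "((\<lambda>x. loc c \<pi> x / loc c \<nu>1 x) \<longlongrightarrow> B) at_top"
  shows "local_subexponential c \<nu>1"
proof -
  interpret local_long_tail c \<nu>1 by fact
  have "ratio_lim (convolution \<nu>1 \<nu>1) 2"
  proof (rule ratio_lim_mixture_imp_square)
    show "ratio_lim (mixture (\<lambda>n. exp (- B) * (B ^ n / fact n)) (\<lambda>n. conv_power n \<nu>1))
        (\<Sum>n. real n * (exp (- B) * (B ^ n / fact n)))"
      using assms(2) by (simp only: \<pi>_exp[symmetric] sum_exp ratio_lim_def)
    show "summable (\<lambda>n. exp (- B) * (B ^ n / fact n))"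
      using summable_exp[of B] by (intro summable_mult) (simp add: field_simps)
  qed (use B_pos sum_exp(2) in auto)
  then show ?thesis
    by unfold_locales
qed

lemma long_tail_G0_imp:
  assumes "local_long_tail c G0" "((\<lambda>x. loc c \<pi> x / loc c G0 x) \<longlongrightarrow> p / (1 - p)) at_top"
  shows "local_subexponential c G0"
proof -
  interpret local_long_tail c G0 by fact
  have "ratio_lim (convolution G0 G0) 2"
  proof (rule ratio_lim_mixture_imp_square)
    show "ratio_lim (mixture (\<lambda>n. (1 - p) * p ^ n) (\<lambda>n. conv_power n G0)) (\<Sum>n. real n * ((1 - p) * p ^ n))"
      using assms(2) by (simp only: \<pi>_geometric[symmetric] sum_geometric ratio_lim_def)
    show "summable (\<lambda>n. (1 - p) * p ^ n)"
      using p by (intro summable_mult summable_geometric) auto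
  qed (use p sum_geometric(2) in auto)
  then show ?thesis
    by unfold_locales
qed

lemma subexponential_\<pi>_imp:
  assumes "local_subexponential c \<pi>"
  shows "local_subexponential c G0"
proof -
  interpret local_subexponential c \<pi> by fact
  have "ratio_lim \<Lambda> (1 - p)"
    using \<Lambda> p char_\<pi> by (intro ratio_lim_geometric_root) auto
  then have "((\<lambda>x. loc c \<Lambda> x / loc c \<pi> x / p) \<longlongrightarrow> (1 - p) / p) at_top"
    unfolding ratio_lim_def using p by (intro tendsto_divide tendsto_const) auto
  then have "ratio_lim G0 ((1 - p) / p)"
    by (simp add: ratio_lim_def G0 mult.commute)
  then show ?thesis
    by (rule local_subexponential_transfer[OF G0(1,2)]) (use p in simp)
qed

lemma equivalences:
  "local_subexponential c \<pi> \<longleftrightarrow> local_subexponential c \<nu>1" (is "?i \<longleftrightarrow> ?ii")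
  "local_subexponential c \<pi> \<longleftrightarrow> local_long_tail c \<nu>1 \<and> loc c \<pi> \<sim>[at_top] loc c \<nu>" (is "_ \<longleftrightarrow> ?iii")
  "local_subexponential c \<pi> \<longleftrightarrow> local_subexponential c G0" (is "_ \<longleftrightarrow> ?iv")
  "local_subexponential c \<pi> \<longleftrightarrow> local_long_tail c G0 \<and> loc c \<pi> \<sim>[at_top] (\<lambda>x. p / (1 - p) * loc c G0 x)" (is "_ \<longleftrightarrow> ?v")
proof -
  have \<nu>_scale: "loc c \<nu> = (\<lambda>x. B * loc c \<nu>1 x)"
    using B_pos by (simp add: \<nu>1 fun_eq_iff)
  have r: "0 < p / (1 - p)"
    using p by simp
  have iv: ?v ?iii ?ii ?i if iv: ?iv
  proof -
    interpret local_subexponential c G0 by (rule iv)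
    note lims = subexponential_G0_imp[OF iv]
    show ?v
      using lims(1) local_long_tail_axioms asymp_equiv_scaled_iff[OF eventually_positive r] by simp
    show ?i
      using lims(1) \<pi> r by (intro local_subexponential_transfer) (auto simp: ratio_lim_def)
    have "((\<lambda>x. loc c \<nu> x / loc c G0 x / B) \<longlongrightarrow> p / (1 - p) / B) at_top"
      using tendsto_divide[OF lims(2) tendsto_const[of B]] B_pos by simp
    then have "ratio_lim \<nu>1 (p / (1 - p) / B)"
      by (simp add: ratio_lim_def \<nu>1 mult.commute)
    then show ii: ?ii
      by (rule local_subexponential_transfer[OF \<nu>1(1,2)]) (rule divide_pos_pos[OF r B_pos])
    have "loc c \<pi> \<sim>[at_top] (\<lambda>x. p / (1 - p) * loc c G0 x)"
      "loc c \<nu> \<sim>[at_top] (\<lambda>x. p / (1 - p) * loc c G0 x)"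
      using lims asymp_equiv_scaled_iff[OF eventually_positive r] by auto
    then have "loc c \<pi> \<sim>[at_top] loc c \<nu>"
      by (metis asymp_equiv_sym asymp_equiv_trans)
    then show ?iii
      using ii by (simp add: local_subexponential_def)
  qed
  have iii: ?ii if iii: ?iii
  proof -
    interpret local_long_tail c \<nu>1
      using iii by simp
    have "((\<lambda>x. loc c \<pi> x / loc c \<nu>1 x) \<longlongrightarrow> B) at_top"
      using iii asymp_equiv_scaled_iff[OF eventually_positive B_pos] by (simp add: \<nu>_scale)
    then show ?thesis
      by (rule long_tail_\<nu>1_imp[OF local_long_tail_axioms])
  qed
  have v: ?iv if v: ?v
  proof -
    interpret local_long_tail c G0
      using v by simp
    show ?thesis
      using v asymp_equiv_scaled_iff[OF eventually_positive r]
      by (intro long_tail_G0_imp) auto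
  qed
  have i: "?i \<Longrightarrow> ?iv" and ii: "?ii \<Longrightarrow> ?i"
    by (rule subexponential_\<pi>_imp subexponential_\<nu>1_imp; assumption)+
  show "?i \<longleftrightarrow> ?ii" "?i \<longleftrightarrow> ?iii" "?i \<longleftrightarrow> ?iv" "?i \<longleftrightarrow> ?v"
    using i ii iii iv v by blast+
qed

end


section \<open>Total masses under negative drift\<close>

context negative_drift
begin

lemma harmonic_mass_eq: "harmonic_mass G = - ln (1 - p)" and ladder_prob_eq: "ladder_prob G = p"
proof -
  interpret \<nu>: finite_borel_measure "harmonic G"
    by (rule finite_borel_measure_harmonic)
  have "1 - complex_of_real p = complex_of_real (1 - p)"
    by simp
  then have "Ln (1 - complex_of_real p) = complex_of_real (ln (1 - p))"
    using p by (simp only: Ln_of_real)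
  then have "complex_of_real (measure (harmonic G) UNIV) = complex_of_real (- ln (1 - p))"
    using char_harmonic[of 0] by (simp add: char_0 finite_borel_measureD(3)[OF finite_borel_measure_ladder_law] mass_ladder_law)
  moreover have "measure (harmonic G) UNIV = measure (harmonic G) {..0} + measure (harmonic G) {0<..}"
    by (subst \<nu>.finite_measure_Union[symmetric]) (auto intro!: arg_cong[where f = "measure (harmonic G)"])
  ultimately show m: "harmonic_mass G = - ln (1 - p)"
    by (simp only: of_real_eq_iff measure_harmonic_nonpos harmonic_mass_def)
  show "ladder_prob G = p"
    using p by (simp add: ladder_prob_def m)
qed

lemma nonneg_harmonic: "nonneg_measure (harmonic G)"
proof -
  interpret \<nu>: finite_borel_measure "harmonic G"
    by (rule finite_borel_measure_harmonic)
  have "measure (harmonic G) {..<0} \<le> measure (harmonic G) {..0}"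
    by (intro \<nu>.finite_measure_mono) auto
  then show ?thesis
    by (simp add: nonneg_measure_def finite_borel_measure_harmonic measure_harmonic_nonpos measure_le_0_iff)
qed

lemma max_law_mass: "measure max_law UNIV = 1"
  using prob_space.prob_space[OF real_distribution.axioms(1)[OF real_distribution_max_law]]
    finite_borel_measureD(3)[OF nonneg_measureD(1)[OF nonneg_max_law]] by simp

text \<open>
  If \<open>p = 0\<close>, then \<open>ratio_lim_geometric_root\<close> assigns the ratio 1 to the null measure.
\<close>

lemma subexponential_max_law_imp_p_pos:
  assumes "local_subexponential c max_law"
  shows "0 < p"
proof (rule ccontr)
  assume "\<not> 0 < p"
  then have p0: "p = 0"
    using mass_ladder_law measure_nonneg[of ladder_law UNIV] by simp
  interpret local_subexponential c max_law by fact
  have "char max_law t * (1 - char ladder_law t) = complex_of_real (1 - p)" for t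
    using char_max_law[of t] by (simp only: char_ladder_law)
  then have "ratio_lim ladder_law (1 - p)"
    using p(2) by (intro ratio_lim_geometric_root nonneg_ladder_law) (simp_all add: mass_ladder_law)
  moreover have "loc c ladder_law x = 0" for x
    using loc_le_mass[OF finite_borel_measure_ladder_law, of c x] loc_nonneg[of c ladder_law x]
    by (simp add: mass_ladder_law p0)
  ultimately show False
    by (simp add: ratio_lim_def p0 tendsto_const_iff)
qed

end

section \<open>From the given random walk to the sequence space\<close>

locale random_walk = base: prob_space P for P :: "'a measure" +
  fixes X :: "nat \<Rightarrow> 'a \<Rightarrow> real" and G :: "real measure"
  assumes indep: "base.indep_vars (\<lambda>_. borel) X {1..}"
    and ident: "\<And>k. 1 \<le> k \<Longrightarrow> distr P borel (X k) = G"
begin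

lemma rv: "1 \<le> k \<Longrightarrow> X k \<in> borel_measurable P"
  using indep by (simp add: base.indep_vars_def)

sublocale step_law G
proof (unfold step_law_def)
  have "real_distribution (distr P borel (X 1))"
    by (intro base.real_distribution_distr rv) simp
  then show "real_distribution G"
    by (simp add: ident)
qed

definition steps :: "'a \<Rightarrow> nat \<Rightarrow> real" where
  "steps \<omega> i = X (Suc i) \<omega>"

lemma steps_measurable: "steps \<in> measurable P S"
proof (rule measurable_PiM_single')
  fix i
  have "X (Suc i) \<in> measurable P G"
    using rv[of "Suc i"] measurable_cong_sets[OF refl G.events_eq_borel] by simp
  then show "(\<lambda>\<omega>. steps \<omega> i) \<in> measurable P G"
    by (simp add: steps_def[abs_def])
qed (auto simp: PiE_UNIV_domain)

lemma distr_steps: "distr P S steps = S"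
proof -
  have "distr P (\<Pi>\<^sub>M i\<in>{1..}. borel) (\<lambda>\<omega>. \<lambda>i\<in>{1..}. X i \<omega>) = (\<Pi>\<^sub>M i\<in>{1..}. distr P borel (X i))"
    by (rule base.indep_vars_iff_distr_eq_PiM'[THEN iffD1, OF _ _ indep]) (auto intro: rv)
  also have "\<dots> = (\<Pi>\<^sub>M i\<in>{1..}. G)"
    by (rule PiM_cong) (auto simp: ident)
  finally have D: "distr P (\<Pi>\<^sub>M i\<in>{1..}. borel) (\<lambda>\<omega>. \<lambda>i\<in>{1..}. X i \<omega>) = (\<Pi>\<^sub>M i\<in>{1..}. G)" .
  have m1: "(\<lambda>\<omega>. \<lambda>i\<in>{1..}. X i \<omega>) \<in> measurable P (\<Pi>\<^sub>M i\<in>{1..}. borel)"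
    by (rule measurable_restrict) (simp add: rv)
  have sets: "sets (\<Pi>\<^sub>M i\<in>{1 :: nat..}. G) = sets (\<Pi>\<^sub>M i\<in>{1 :: nat..}. borel)"
    by (rule sets_PiM_cong) simp_all
  have m2: "(\<lambda>\<omega>. \<lambda>n\<in>UNIV. \<omega> (Suc n)) \<in> measurable (\<Pi>\<^sub>M i\<in>{1..}. borel) S"
    unfolding measurable_cong_sets[OF sets[symmetric] refl]
    by (rule measurable_restrict) (rule measurable_component_singleton, simp)
  have "S = distr (\<Pi>\<^sub>M i\<in>{1..}. G) S (\<lambda>\<omega>. \<lambda>n\<in>UNIV. \<omega> (Suc n))"
    using distr_PiM_reindex[of "{1..}" "\<lambda>_. G" Suc UNIV] G.prob_space_axioms by simp
  also have "\<dots> = distr P S ((\<lambda>\<omega>. \<lambda>n\<in>UNIV. \<omega> (Suc n)) \<circ> (\<lambda>\<omega>. \<lambda>i\<in>{1..}. X i \<omega>))"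
    unfolding D[symmetric] by (rule distr_distr[OF m2 m1])
  also have "(\<lambda>\<omega>. \<lambda>n\<in>UNIV. \<omega> (Suc n)) \<circ> (\<lambda>\<omega>. \<lambda>i\<in>{1..}. X i \<omega>) = steps"
    by (auto simp: fun_eq_iff steps_def)
  finally show ?thesis ..
qed

lemma walk_eq: "walk X n \<omega> = psum n (steps \<omega>)"
  by (simp add: walk_def psum_def steps_def sum.atLeast1_atMost_eq)

lemma emeasure_steps: "A \<in> sets S \<Longrightarrow> emeasure P (steps -` A \<inter> space P) = emeasure S A"
  using emeasure_distr[OF steps_measurable, of A] by (simp add: distr_steps)

lemma ladder_epoch_eq:
  assumes "enters_pos n (steps \<omega>)"
  shows "ladder_epoch X \<omega> = n"
  unfolding ladder_epoch_def walk_eq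
proof (rule cInf_eq_minimum)
  have "n \<noteq> 0"
    using assms by (cases n) (auto simp: enters_pos_def)
  then show "n \<in> {n. 1 \<le> n \<and> 0 < psum n (steps \<omega>)}"
    using assms by (simp add: enters_pos_def)
  fix m assume "m \<in> {n. 1 \<le> n \<and> 0 < psum n (steps \<omega>)}"
  then show "n \<le> m"
    using assms by (auto simp: enters_pos_def not_less[symmetric])
qed

lemma ladder_event_iff: "\<omega> \<in> ladder_event P X \<longleftrightarrow> \<omega> \<in> space P \<and> (\<exists>n. enters_pos n (steps \<omega>))"
proof -
  have "(\<exists>n\<ge>1. 0 < psum n y) \<longleftrightarrow> (\<exists>n. 0 < psum n y)" for y
    by (metis psum_0 less_irrefl One_nat_def Suc_leI gr0I)
  then show ?thesis
    by (simp add: ladder_event_def walk_eq ex_enters_pos_iff)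
qed

lemma entrance_sets: "A \<in> sets borel \<Longrightarrow> {y. enters_pos n y \<and> psum n y \<in> A} \<in> sets S"
proof -
  assume A: "A \<in> sets borel"
  have "{y. enters_pos n y \<and> psum n y \<in> A} = {y. enters_pos n y} \<inter> (psum n -` A \<inter> space S)"
    by (auto simp: space_S)
  then show ?thesis
    using enters_pos_sets measurable_sets[OF psum_measurable A] by auto
qed

lemma ladder_preimage:
  "(\<lambda>\<omega>. walk X (ladder_epoch X \<omega>) \<omega>) -` A \<inter> ladder_event P X =
    (\<Union>n. steps -` {y. enters_pos n y \<and> psum n y \<in> A} \<inter> space P)"
  by (auto simp: ladder_event_iff walk_eq ladder_epoch_eq) blast

lemma ladder_event_sets: "ladder_event P X \<in> sets P"
proof -
  have "ladder_event P X = (\<Union>n. steps -` {y. enters_pos n y} \<inter> space P)"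
    by (auto simp: ladder_event_iff)
  also have "\<dots> \<in> sets P"
    by (intro sets.countable_UN image_subsetI measurable_sets[OF steps_measurable enters_pos_sets])
  finally show ?thesis .
qed

lemma emeasure_ladder_defective:
  assumes A: "A \<in> sets borel"
  shows "emeasure (ladder_defective P X) A = (\<Sum>n. emeasure (L n) A)"
proof -
  let ?W = "\<lambda>\<omega>. walk X (ladder_epoch X \<omega>) \<omega>" and ?E = "ladder_event P X"
  let ?D = "\<lambda>n. steps -` {y. enters_pos n y \<and> psum n y \<in> A} \<inter> space P"
  have E: "?E \<inter> space P = ?E"
    using sets.sets_into_space[OF ladder_event_sets] by auto
  have pre: "?W -` B \<inter> space (restrict_space P ?E) \<in> sets (restrict_space P ?E)" if "B \<in> sets borel" for B
  proof -
    have "?W -` B \<inter> ?E \<in> sets P"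
      unfolding ladder_preimage
      by (intro sets.countable_UN image_subsetI measurable_sets[OF steps_measurable entrance_sets[OF that]])
    then show ?thesis
      using ladder_event_sets by (simp add: space_restrict_space E sets_restrict_space_iff)
  qed
  have W: "?W \<in> borel_measurable (restrict_space P ?E)"
    by (rule measurableI) (use pre in auto)
  have "emeasure (ladder_defective P X) A = emeasure (restrict_space P ?E) (?W -` A \<inter> ?E)"
    unfolding ladder_defective_def using W A by (simp add: emeasure_distr space_restrict_space E)
  also have "\<dots> = emeasure P (?W -` A \<inter> ?E)"
    using ladder_event_sets E by (intro emeasure_restrict_space) auto
  also have "\<dots> = emeasure P (\<Union>n. ?D n)"
    by (simp only: ladder_preimage)
  also have "\<dots> = (\<Sum>n. emeasure P (?D n))"
    using measurable_sets[OF steps_measurable entrance_sets[OF A]]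
    by (intro suminf_emeasure[symmetric]) (auto simp: disjoint_family_on_def dest: enters_pos_unique)
  also have "\<dots> = (\<Sum>n. emeasure (L n) A)"
    unfolding L_def emeasure_part_law[OF enters_pos_measurable A]
    by (intro suminf_cong emeasure_steps entrance_sets A)
  finally show ?thesis .
qed

end

section \<open>Equivalence of the five conditions\<close>

theorem theorem5p2:
  fixes P :: "'a measure" and X :: "nat \<Rightarrow> 'a \<Rightarrow> real" and G :: "real measure" and c :: real
  assumes c: "0 < c"
    and P: "prob_space P"
    and indep: "prob_space.indep_vars P (\<lambda>_. borel) X {1..}"
    and ident: "\<And>k. 1 \<le> k \<Longrightarrow> distr P borel (X k) = G"
    and mean_finite: "integrable P (X 1)"
    and mean_neg: "integral\<^sup>L P (X 1) < 0"
    and non_lattice: "non_lattice G"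
  shows
    "let \<pi> = sup_distr P X;
         \<nu> = harmonic G;
         B = harmonic_mass G;
         l = ladder_prob G;
         \<nu>\<^sub>1 = scale_measure (ennreal (1 / B)) \<nu>;
         G\<^sub>0 = scale_measure (ennreal (1 / l)) (ladder_defective P X);
         i = class_S c \<pi>;
         ii = (0 < B \<and> class_S c \<nu>\<^sub>1);
         iii = (0 < B \<and> class_L c \<nu>\<^sub>1 \<and> loc c \<pi> \<sim>[at_top] loc c \<nu>);
         iv = (0 < B \<and> class_S c G\<^sub>0);
         v = (0 < B \<and> class_L c G\<^sub>0 \<and> loc c \<pi> \<sim>[at_top] (\<lambda>x. l / (1 - l) * loc c G\<^sub>0 x))
     in (i \<longleftrightarrow> ii) \<and> (i \<longleftrightarrow> iii) \<and> (i \<longleftrightarrow> iv) \<and> (i \<longleftrightarrow> v)"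
proof -
  interpret random_walk P X G
    using P indep ident by (simp add: random_walk_def random_walk_axioms_def)
  interpret negative_drift G
  proof
    have m: "X 1 \<in> borel_measurable P"
      by (simp add: rv)
    show "integrable G (\<lambda>x. x)"
      using mean_finite ident[of 1] integrable_distr_eq[OF m, of "\<lambda>x. x"] by simp
    show "(\<integral>x. x \<partial>G) < 0"
      using mean_neg ident[of 1] integral_distr[OF m, of "\<lambda>x. x"] by simp
  qed
  have sup_distr_eq: "sup_distr P X = max_law"
  proof -
    have "max_law = distr (distr P S steps) borel (\<lambda>y. real_of_ereal (run_max y))"
      by (simp only: max_law_def distr_steps)
    also have "\<dots> = distr P borel ((\<lambda>y. real_of_ereal (run_max y)) \<circ> steps)"
      by (rule distr_distr[OF real_run_max_measurable steps_measurable])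
    finally show ?thesis
      by (simp add: sup_distr_def walk_eq run_max_def o_def)
  qed
  have ladder_defective_eq: "ladder_defective P X = ladder_law"
  proof (rule measure_eqI)
    show "sets (ladder_defective P X) = sets ladder_law"
      by (simp add: ladder_defective_def ladder_law_def)
    fix A assume "A \<in> sets (ladder_defective P X)"
    then have "A \<in> sets borel"
      by (simp add: ladder_defective_def)
    then show "emeasure (ladder_defective P X) A = emeasure ladder_law A"
      using finite_borel_measureD(2)[OF L(1)]
      by (simp add: emeasure_ladder_defective ladder_law_def emeasure_mixture)
  qed
  have mass_pos_iff: "0 < - ln (1 - p) \<longleftrightarrow> 0 < p"
    using p(2) by simp
  show ?thesis
  proof (cases "0 < p")
    case True
    interpret ladder_triple c max_law "harmonic G" ladder_law p
    proof
      show "char max_law t * (1 - char ladder_law t) = complex_of_real (1 - p)" for t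
        using char_max_law[of t] by (simp only: char_ladder_law)
    qed (fact c nonneg_max_law max_law_mass nonneg_ladder_law mass_ladder_law True p(2) nonneg_harmonic char_harmonic)+
    note G0 = G0(1)[unfolded G0_def] and \<nu>1 = \<nu>1(1)[unfolded \<nu>1_def B_def]
    show ?thesis
      unfolding Let_def sup_distr_eq ladder_defective_eq harmonic_mass_eq ladder_prob_eq mass_pos_iff
        class_S_iff[OF c nonneg_max_law] class_S_iff[OF c \<nu>1] class_L_iff[OF c \<nu>1]
        class_S_iff[OF c G0] class_L_iff[OF c G0]
      using equivalences True by (simp only: G0_def \<nu>1_def B_def) blast
  next
    case False
    then have "\<not> class_S c max_law"
      using subexponential_max_law_imp_p_pos class_S_iff[OF c nonneg_max_law] by blast
    then show ?thesis
      unfolding Let_def sup_distr_eq ladder_defective_eq harmonic_mass_eq ladder_prob_eq mass_pos_iff using False by simp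
  qed
qed

end
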